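(* Let $n\ge1$, $\tau_1<\dots<\tau_n$ real, and for each $j$ let $J_j=[a_j^{(1)},a_j^{(2)}]\cup[a_j^{(3)},a_j^{(4)}]\cup\dots\cup[a_j^{(2k_j-1)},a_j^{(2k_j)}]$ with $a_j^{(1)}<\dots<a_j^{(2k_j)}$. Let $P$ be the $n\times n$ matrix (multi-time) Pearcey kernel and $\chi_{\vec J}$ the corresponding multiplication operator (see context). Then $$\det(\mathrm{Id}-\chi_{\vec J}P)=\det(\mathrm{Id}-K_P),$$ where $K_P$ is the integrable operator on $V:=L^2(i\mathbb R,\mathbb C^n)\oplus L^2(\gamma_L\cup\gamma_R,\mathbb C^n)$ with $n\times n$ matrix kernel $$K_P(\lambda,\mu)=\frac{\mathbf f_P^T(\lambda)\mathbf g_P(\mu)}{\lambda-\mu},\qquad \mathbf f_P:=\frac1{2\pi i}(\vec f_{P,1},\dots,\vec f_{P,n}),\quad \mathbf g_P:=(\vec g_{P,1},\dots,\vec g_{P,n}),$$ the column vectors of length $1+\sum_m2k_m$, in blocks of sizes $1,2k_1,\dots,2k_n$, being: - $\vec f_{P,i}(\lambda)$: first entry $e^{\frac12\Theta_i(0,\lambda)}\chi_{\gamma_L\cup\gamma_R}(\lambda)$; $i$-th block $\big(e^{a_i^{(s)}\lambda}\chi_{i\mathbb R}(\lambda)\big)_{s=1}^{2k_i}$; other blocks zero. - $\vec g_{P,j}(\mu)$: first entry $e^{-\Theta_j(0,\mu)}\chi_{i\mathbb R}(\mu)$; for $m<j$ the $m$-th block $\epsilon_{2k_m}\big(e^{-a_m^{(t)}\mu+(\tau_j-\tau_m)\mu^2/2}\chi_{i\mathbb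 R}(\mu)\big)_{t=1}^{2k_m}$; the $j$-th block $\epsilon_{2k_j}\big(e^{\frac12\Theta_j(0,\mu)-a_j^{(t)}\mu}\chi_{\gamma_L\cup\gamma_R}(\mu)\big)_{t=1}^{2k_j}$; blocks $m>j$ zero. Both determinants are understood as Fredholm series.
   Context: Notation: $\Theta_i(x,\mu):=\frac{\mu^4}{4}-\frac{\tau_i}{2}\mu^2-x\mu$; $\epsilon_k:=\mathrm{diag}(1,-1,\dots,(-1)^{k+1})$; $\chi_S$ the indicator of $S$; $i\mathbb R$ oriented upward. The contours $\gamma_R,\gamma_L$ are the usual Pearcey contours: $\gamma_R$ lies in the right half-plane and consists of a ray from $\infty e^{i\pi/4}$ to a point $c>0$ and a ray from $c$ to $\infty e^{-i\pi/4}$; $\gamma_L$ lies in the left half-plane and consists of a ray from $\infty e^{3i\pi/4}$ to $-c$ and a ray from $-c$ to $\infty e^{-3i\pi/4}$ (so that $e^{\Theta_i(x,\mu)}$ decays along them and they do not meet $i\mathbb R$). Pearcey kernel on $L^2(\mathbb R,\mathbb C^n)$: $P_{ij}(x,y)=\widetilde P_{ij}(x,y)-Q_{ij}(x,y)$ with $\widetilde P_{ij}(x,y)=\frac{1}{(2\pi i)^2}\int_{\gamma_L\cup\gamma_R}d\mu\int_{i\mathbb R}d\lambda\,\frac{e^{\Theta_i(x,\mu)-\Theta_j(y,\lambda)}}{\lambda-\mu}$ and $Q_{ij}(x,y)=\chi_{\tau_i<\tau_j}\frac{1}{\sqrt{2\pi(\tau_j-\tau_i)}}e^{-\frac{(x-y)^2}{2(\tau_j-\tau_i)}}$.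 $\chi_{\vec J}$ multiplies the $i$-th component by $\chi_{J_i}$. "$\det(\mathrm{Id}-G)$" denotes the Fredholm series $1+\sum_{k\ge1}\frac1{k!}\int_{X^k}\det[G(\xi_a,\xi_b)]_{a,b\le k}\prod d\xi_a$ (matrix index treated as a discrete variable); for $P$ this equals $e^{-\mathrm{Tr}(\chi_{\vec J}\widetilde P)}\det_2(\mathrm{Id}-\chi_{\vec J}P)$ with $\det_2$ the Carleman regularized determinant.
   Formalization: The Fredholm series of det(Id−G) is taken with the standard factor (−1)^k/k!, where the notation section's display omits the sign (without it the identity fails already for n=1). *)

theory Defs
  imports "HOL-Analysis.Analysis"
begin

definition ldet :: "nat \<Rightarrow> (nat \<Rightarrow> nat \<Rightarrow> complex) \<Rightarrow> complex" where
  "ldet k A = (\<Sum>p | p permutes {..<k}. of_int (sign p) * (\<Prod>i<k. A i (p i)))"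

text \<open>k-th term of the Fredholm series of det(Id - G) on the space I x X, where the
  finite (matrix/piece) index set I carries counting measure and X carries the measure M:
  (-1)^k/k! * integral over (I x X)^k of det[G(xi_a, xi_b)].\<close>
definition fredholm_term ::
  "'i set \<Rightarrow> 'x measure \<Rightarrow> ('i \<Rightarrow> 'x \<Rightarrow> 'i \<Rightarrow> 'x \<Rightarrow> complex) \<Rightarrow> nat \<Rightarrow> complex" where
  "fredholm_term I M G k =
     ((-1) ^ k / of_nat (fact k)) *
     (\<Sum>\<iota>\<in>PiE {..<k} (\<lambda>_. I).
        integral\<^sup>L (PiM {..<k} (\<lambda>_. M)) (\<lambda>\<xi>. ldet k (\<lambda>a b. G (\<iota> a) (\<xi> a) (\<iota> b) (\<xi> b))))"

definition Theta :: "(nat \<Rightarrow> real) \<Rightarrow> nat \<Rightarrow> real \<Rightarrow> complex \<Rightarrow> complex" where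
  "Theta \<tau> i x \<mu> = \<mu> ^ 4 / 4 - of_real (\<tau> i) / 2 * \<mu> ^ 2 - of_real x * \<mu>"

definition bray :: "complex \<Rightarrow> complex \<Rightarrow> complex \<Rightarrow> real \<Rightarrow> complex" where
  "bray v d1 d2 s = (if s \<le> 0 then v + of_real (- s) * d1 else v + of_real s * d2)"

definition bray_dz :: "complex \<Rightarrow> complex \<Rightarrow> real \<Rightarrow> complex" where
  "bray_dz d1 d2 s = (if s \<le> 0 then - d1 else d2)"

text \<open>Parametrisation (by s in R) of the three contour pieces: r = 0 is iR (upward),
  r = 1 is gamma_L, r = 2 is gamma_R; cdz is the derivative d(point)/ds.\<close>
definition cpt :: "real \<Rightarrow> nat \<Rightarrow> real \<Rightarrow> complex" where
  "cpt c r s =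
     (if r = 0 then \<i> * of_real s
      else if r = 1 then bray (- of_real c) (cis (3 * pi / 4)) (cis (- 3 * pi / 4)) s
      else bray (of_real c) (cis (pi / 4)) (cis (- pi / 4)) s)"

definition cdz :: "nat \<Rightarrow> real \<Rightarrow> complex" where
  "cdz r s =
     (if r = 0 then \<i>
      else if r = 1 then bray_dz (cis (3 * pi / 4)) (cis (- 3 * pi / 4)) s
      else bray_dz (cis (pi / 4)) (cis (- pi / 4)) s)"

definition iR_set :: "complex set" where
  "iR_set = {z. Re z = 0}"

definition gammaLR_set :: "real \<Rightarrow> complex set" where
  "gammaLR_set c = range (cpt c 1) \<union> range (cpt c 2)"

definition iR_integral :: "(complex \<Rightarrow> complex) \<Rightarrow> complex" where
  "iR_integral f = integral\<^sup>L lborel (\<lambda>t. f (cpt 0 0 t) * cdz 0 t)"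

definition gammaLR_integral :: "real \<Rightarrow> (complex \<Rightarrow> complex) \<Rightarrow> complex" where
  "gammaLR_integral c f = (\<Sum>r\<in>{1, 2}. integral\<^sup>L lborel (\<lambda>s. f (cpt c r s) * cdz r s))"

definition Ptilde :: "(nat \<Rightarrow> real) \<Rightarrow> real \<Rightarrow> nat \<Rightarrow> nat \<Rightarrow> real \<Rightarrow> real \<Rightarrow> complex" where
  "Ptilde \<tau> c i j x y =
     1 / (2 * pi * \<i>) ^ 2 *
     gammaLR_integral c (\<lambda>\<mu>. iR_integral (\<lambda>la.
        exp (Theta \<tau> i x \<mu> - Theta \<tau> j y la) / (la - \<mu>)))"

definition Qker :: "(nat \<Rightarrow> real) \<Rightarrow> nat \<Rightarrow> nat \<Rightarrow> real \<Rightarrow> real \<Rightarrow> complex" where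
  "Qker \<tau> i j x y =
     (if \<tau> i < \<tau> j
      then of_real (1 / sqrt (2 * pi * (\<tau> j - \<tau> i)) * exp (- ((x - y) ^ 2) / (2 * (\<tau> j - \<tau> i))))
      else 0)"

definition Pearcey :: "(nat \<Rightarrow> real) \<Rightarrow> real \<Rightarrow> nat \<Rightarrow> nat \<Rightarrow> real \<Rightarrow> real \<Rightarrow> complex" where
  "Pearcey \<tau> c i j x y = Ptilde \<tau> c i j x y - Qker \<tau> i j x y"

definition Jset :: "(nat \<Rightarrow> nat \<Rightarrow> real) \<Rightarrow> (nat \<Rightarrow> nat) \<Rightarrow> nat \<Rightarrow> real set" where
  "Jset a k j = (\<Union>l\<in>{1..k j}. {a j (2 * l - 1) .. a j (2 * l)})"

text \<open>0-based position of the first entry of block m (blocks of sizes 1, 2k_1, ..., 2k_n).\<close>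
definition boff :: "(nat \<Rightarrow> nat) \<Rightarrow> nat \<Rightarrow> nat" where
  "boff k m = 1 + (\<Sum>l\<in>{1..<m}. 2 * k l)"

definition vlen :: "nat \<Rightarrow> (nat \<Rightarrow> nat) \<Rightarrow> nat" where
  "vlen n k = 1 + (\<Sum>m\<in>{1..n}. 2 * k m)"

text \<open>Column vector of length vlen n k with first entry v0 and entry s (1 \<le> s \<le> 2k_m) of
  block m equal to blk m s.\<close>
definition blockvec :: "nat \<Rightarrow> (nat \<Rightarrow> nat) \<Rightarrow> complex \<Rightarrow> (nat \<Rightarrow> nat \<Rightarrow> complex) \<Rightarrow> nat \<Rightarrow> complex" where
  "blockvec n k v0 blk p =
     (if p = 0 then v0
      else (\<Sum>m\<in>{1..n}. \<Sum>s\<in>{1..2 * k m}. if p = boff k m + s - 1 then blk m s else 0))"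

definition fP :: "(nat \<Rightarrow> real) \<Rightarrow> (nat \<Rightarrow> nat \<Rightarrow> real) \<Rightarrow> (nat \<Rightarrow> nat) \<Rightarrow> nat \<Rightarrow> real
                   \<Rightarrow> nat \<Rightarrow> complex \<Rightarrow> nat \<Rightarrow> complex" where
  "fP \<tau> a k n c i la =
     blockvec n k
       (exp (Theta \<tau> i 0 la / 2) * indicator (gammaLR_set c) la)
       (\<lambda>m s. if m = i then exp (of_real (a i s) * la) * indicator iR_set la else 0)"

definition gP :: "(nat \<Rightarrow> real) \<Rightarrow> (nat \<Rightarrow> nat \<Rightarrow> real) \<Rightarrow> (nat \<Rightarrow> nat) \<Rightarrow> nat \<Rightarrow> real
                   \<Rightarrow> nat \<Rightarrow> complex \<Rightarrow> nat \<Rightarrow> complex" where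
  "gP \<tau> a k n c j \<mu> =
     blockvec n k
       (exp (- Theta \<tau> j 0 \<mu>) * indicator iR_set \<mu>)
       (\<lambda>m t. if m < j then (-1) ^ (t + 1) *
                  exp (- of_real (a m t) * \<mu> + of_real (\<tau> j - \<tau> m) * \<mu> ^ 2 / 2)
                  * indicator iR_set \<mu>
              else if m = j then (-1) ^ (t + 1) *
                  exp (Theta \<tau> j 0 \<mu> / 2 - of_real (a j t) * \<mu>)
                  * indicator (gammaLR_set c) \<mu>
              else 0)"

definition KP :: "(nat \<Rightarrow> real) \<Rightarrow> (nat \<Rightarrow> nat \<Rightarrow> real) \<Rightarrow> (nat \<Rightarrow> nat) \<Rightarrow> nat \<Rightarrow> real
                   \<Rightarrow> nat \<Rightarrow> nat \<Rightarrow> complex \<Rightarrow> complex \<Rightarrow> complex" where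
  "KP \<tau> a k n c i j la \<mu> =
     (1 / (2 * pi * \<i>) * (\<Sum>p<vlen n k. fP \<tau> a k n c i la p * gP \<tau> a k n c j \<mu> p)) / (la - \<mu>)"

text \<open>K_P as a kernel on {1..n} x {pieces 0,1,2} x R (parametrised contour), including the
  oriented line element d\<mu> = cdz r' s' ds'.\<close>
definition KP_param :: "(nat \<Rightarrow> real) \<Rightarrow> (nat \<Rightarrow> nat \<Rightarrow> real) \<Rightarrow> (nat \<Rightarrow> nat) \<Rightarrow> nat \<Rightarrow> real
                   \<Rightarrow> nat \<times> nat \<Rightarrow> real \<Rightarrow> nat \<times> nat \<Rightarrow> real \<Rightarrow> complex" where
  "KP_param \<tau> a k n c ir s jr' s' =
     KP \<tau> a k n c (fst ir) (fst jr') (cpt c (snd ir) s) (cpt c (snd jr') s') * cdz (snd jr') s'"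

end

theory Submission
  imports Defs "HOL-Probability.Characteristic_Functions" "Jordan_Normal_Form.Determinant"
begin

text \<open>
  Both operators are Schur complements of one kernel on the disjoint union of \<open>J\<close>, \<open>i\<real>\<close> and
  \<open>\<gamma>\<close>. Since \<open>\<Sum>\<^sub>s (-1)\<^bsup>s+1\<^esup> e\<^bsup>a\<^sub>s z\<^esup> / z = - \<integral>\<^sub>J e\<^bsup>xz\<^esup> dx\<close>, every entry of \<open>K\<^sub>P\<close> with row in
  \<open>i\<real>\<close> factors through \<open>L\<^sup>2(J)\<close> by the Laplace kernel \<open>F(\<lambda>, x) = e\<^bsup>x\<lambda>\<^esup>\<close>. In the block kernel with rows
  \<open>J: (0, N, B)\<close>, \<open>i\<real>: (F, 0, 0)\<close>, \<open>\<gamma>: (0, C, 0)\<close>, eliminating \<open>J\<close> leaves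
  \<open>(FN, FB; C, 0) = K\<^sub>P\<close>, while eliminating \<open>i\<real>\<close> and then \<open>\<gamma>\<close> leaves \<open>NF + BCF\<close>, which is
  \<open>\<chi>\<^sub>J P \<chi>\<^sub>J\<close>: \<open>BCF\<close> is the double contour integral and \<open>NF = - Q\<close> is a Gaussian Fourier integral.

  The elimination rule \<open>det(1 - (A, B; C, 0)) = det(1 - A - BC)\<close> is proved on the Fredholm series.
  Expanding in the rows turns both sides into sums over one array \<open>t(p, q)\<close>, where \<open>p\<close>
  counts the remaining variables and \<open>q\<close> the factors \<open>BC\<close>: the term of degree \<open>m\<close> is \<open>\<Sum>\<^sub>q t(m - q, q)\<close> on
  the left and \<open>\<Sum>\<^sub>q t(m, q)\<close> on the right. Hadamard's inequality makes the array absolutely summable.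
\<close>

section \<open>Determinants and Hadamard's inequality\<close>

text \<open>No trace-class theory enters. The obstacle is that the factors need not decay in both
  variables: \<open>F\<close> has modulus one along the imaginary axis. Every kernel is therefore
  controlled through its column variable alone, by a multiple of an integrable \<open>h j y\<close>.
  This one-sided bound is what Hadamard's inequality, taken by columns, can use, and composition of
  kernels preserves it. The phase on \<gamma> is split into two factors exp(Theta/2), one in
  \<open>B\<close> and one in \<open>C\<close>, because each factor has to satisfy its own bound
  before the two are composed. One discrepancy between the factored kernel and \<open>KP\<close>
  remains: division by zero makes \<open>KP\<close> vanish where its two arguments coincide on the
  imaginary axis, while the factored kernel need not vanish there. The series do not see this, since
  two different coordinates coincide only on a null set and the diagonal entries of the matrices on
  that axis vanish for both kernels.\<close>

lemma ldet_cong: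
  assumes "\<And>a b. a < k \<Longrightarrow> b < k \<Longrightarrow> A a b = B a b"
  shows "ldet k A = ldet k B"
  unfolding ldet_def
  by (intro sum.cong refl arg_cong2[where f="(*)"] prod.cong)
     (auto simp: assms permutes_in_image[where S="{..<k}", simplified])

text \<open>Opens the way to the matrix facts on transposes, row permutations, repeated rows and
  products.\<close>

lemma ldet_eq_det: "ldet k A = Determinant.det (Matrix.mat k k (\<lambda>(i, j). A i j))"
proof -
  have "(\<Prod>i<k. A i (p i)) = (\<Prod>i = 0..<k. Matrix.mat k k (\<lambda>(i, j). A i j) $$ (i, p i))"
    if "p permutes {..<k}" for p
    using that by (intro prod.cong) (auto simp: permutes_in_image[where S="{..<k}", simplified])
  then show ?thesis
    unfolding ldet_def Determinant.det_def by (auto simp: lessThan_atLeast0 intro!: sum.cong)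
qed

lemma ldet_transpose: "ldet k (\<lambda>i j. A j i) = ldet k A"
proof -
  have "Matrix.mat k k (\<lambda>(i, j). A j i) = transpose_mat (Matrix.mat k k (\<lambda>(i, j). A i j))"
    by (intro eq_matI) auto
  then show ?thesis
    unfolding ldet_eq_det by (simp add: Determinant.det_transpose[of _ k])
qed

lemma ldet_permute_rows:
  assumes "\<sigma> permutes {..<k}"
  shows "ldet k (\<lambda>i j. A (\<sigma> i) j) = of_int (sign \<sigma>) * ldet k A"
proof -
  have "Matrix.mat k k (\<lambda>(i, j). A (\<sigma> i) j)
      = Matrix.mat k k (\<lambda>(i, j). Matrix.mat k k (\<lambda>(i, j). A i j) $$ (\<sigma> i, j))"
    using assms by (intro eq_matI) (auto simp: permutes_in_image[where S="{..<k}", simplified])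
  then show ?thesis
    using assms unfolding ldet_eq_det
    by (simp add: Determinant.det_permute_rows[of _ k] lessThan_atLeast0)
qed

lemma ldet_permute_both:
  assumes "\<sigma> permutes {..<k}"
  shows "ldet k (\<lambda>i j. A (\<sigma> i) (\<sigma> j)) = ldet k A"
proof -
  have "ldet k (\<lambda>i j. A (\<sigma> i) (\<sigma> j)) = of_int (sign \<sigma>) * ldet k (\<lambda>i j. A i (\<sigma> j))"
    by (rule ldet_permute_rows[OF assms, where A="\<lambda>i j. A i (\<sigma> j)"])
  also have "ldet k (\<lambda>i j. A i (\<sigma> j)) = ldet k (\<lambda>i j. A j (\<sigma> i))"
    by (rule ldet_transpose[symmetric])
  also have "\<dots> = of_int (sign \<sigma>) * ldet k (\<lambda>i j. A j i)"
    by (rule ldet_permute_rows[OF assms, where A="\<lambda>i j. A j i"])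
  also have "ldet k (\<lambda>i j. A j i) = ldet k A"
    by (rule ldet_transpose)
  finally show ?thesis by (simp add: sign_def)
qed

text \<open>The determinants with a unit row are the cofactors of row \<open>r\<close>. They do not
  involve \<open>v\<close>, so an integral or a linear combination in that row can be moved
  outside.\<close>

lemma ldet_row_expand:
  assumes r: "r < k"
  shows "ldet k (\<lambda>i j. if i = r then v j else A i j)
       = (\<Sum>b<k. v b * ldet k (\<lambda>i j. if i = r then of_bool (j = b) else A i j))"
proof -
  have split: "(\<Prod>i<k. if i = r then w (p i) else A i (p i)) = w (p r) * (\<Prod>i\<in>{..<k} - {r}. A i (p i))"
    for w p
    using r by (subst prod.remove[of _ r]) (auto intro!: prod.cong)
  have "(\<Sum>b<k. v b * ldet k (\<lambda>i j. if i = r then of_bool (j = b) else A i j))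
      = (\<Sum>p | p permutes {..<k}. of_int (sign p) *
          ((\<Sum>b<k. v b * of_bool (p r = b)) * (\<Prod>i\<in>{..<k} - {r}. A i (p i))))"
    unfolding ldet_def split[where w="\<lambda>j. of_bool (j = _)"] sum_distrib_left sum_distrib_right
    by (subst sum.swap) (simp add: mult_ac)
  also have "\<dots> = (\<Sum>p | p permutes {..<k}. of_int (sign p) * (v (p r) * (\<Prod>i\<in>{..<k} - {r}. A i (p i))))"
    using r by (intro sum.cong refl)
      (auto simp: permutes_in_image[where S="{..<k}", simplified] of_bool_def if_distrib cong: if_cong)
  finally show ?thesis
    unfolding ldet_def split by simp
qed

lemma ldet_zero_row:
  assumes "r < k" "\<And>j. j < k \<Longrightarrow> A r j = 0"
  shows "ldet k A = 0"
proof -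
  have "ldet k A = ldet k (\<lambda>i j. if i = r then 0 else A i j)"
    using assms by (intro ldet_cong) auto
  then show ?thesis
    by (simp add: ldet_row_expand[OF assms(1), where v="\<lambda>_. 0"])
qed

lemma ldet_equal_rows:
  assumes "r < k" "s < k" "r \<noteq> s" "\<And>j. j < k \<Longrightarrow> A r j = A s j"
  shows "ldet k A = 0"
  unfolding ldet_eq_det
  by (rule det_identical_rows[of _ k r s]) (use assms in \<open>auto intro!: eq_vecI\<close>)

text \<open>Expansion along the last column. The cofactor sign of the entry in row \<open>a\<close>
  and the sign of moving the last row into the gap left by row \<open>a\<close> combine to -1; the
  corner entry, which has no such gap, is zero.\<close>

lemma ldet_bordered:
  assumes "M k k = 0"
  shows "ldet (Suc k) M = - (\<Sum>a<k. M a k * ldet k (\<lambda>i j. if i = a then M k j else M i j))"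
proof -
  have eq: "of_int (sign (Transposition.transpose k a \<circ> q)) * (\<Prod>i<Suc k. M ((Transposition.transpose k a \<circ> q) i) i)
      = - (M a k * (of_int (sign q) * (\<Prod>j<k. if q j = a then M k j else M (q j) j)))"
    if a: "a < k" and q: "q permutes {..<k}" for a q
  proof -
    have qk: "q k = k" using q by (simp add: permutes_def)
    have "sign (Transposition.transpose k a \<circ> q) = - sign q"
    proof -
      have "permutation q" using q finite_lessThan permutation_permutes by blast
      then show ?thesis using a by (simp add: sign_compose permutation_swap_id sign_swap_id)
    qed
    moreover have "(\<Prod>j<k. M ((Transposition.transpose k a \<circ> q) j) j) = (\<Prod>j<k. if q j = a then M k j else M (q j) j)"
    proof (intro prod.cong refl)
      fix j assume "j \<in> {..<k}"
      then have "q j < k" using q by (simp add: permutes_in_image[where S="{..<k}", simplified])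
      then show "M ((Transposition.transpose k a \<circ> q) j) j = (if q j = a then M k j else M (q j) j)"
        by (auto simp: Transposition.transpose_def)
    qed
    ultimately show ?thesis using qk by (simp add: Transposition.transpose_def)
  qed
  have eqk: "(\<Prod>i<Suc k. M ((Transposition.transpose k k \<circ> q) i) i) = 0" if "q permutes {..<k}" for q
  proof -
    have "q k = k" using that by (simp add: permutes_def)
    then show ?thesis using assms by simp
  qed
  have "ldet (Suc k) M = ldet (Suc k) (\<lambda>i j. M j i)"
    by (rule ldet_transpose[symmetric])
  \<comment> \<open>Each permutation of k + 1 points is uniquely a transposition of \<open>k\<close>
    with some \<open>a\<close> composed with a permutation fixing \<open>k\<close>. After passing to
    the transpose, that transposition acts on rows.\<close>
  also have "\<dots> = (\<Sum>a\<in>insert k {..<k}. \<Sum>q | q permutes {..<k}.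
      of_int (sign (Transposition.transpose k a \<circ> q)) * (\<Prod>i<Suc k. M ((Transposition.transpose k a \<circ> q) i) i))"
    unfolding ldet_def lessThan_Suc[of k] by (subst sum_over_permutations_insert) auto
  also have "\<dots> = (\<Sum>a<k. \<Sum>q | q permutes {..<k}.
      of_int (sign (Transposition.transpose k a \<circ> q)) * (\<Prod>i<Suc k. M ((Transposition.transpose k a \<circ> q) i) i))"
  proof -
    have "(\<Sum>q | q permutes {..<k}. of_int (sign (Transposition.transpose k k \<circ> q))
        * (\<Prod>i<Suc k. M ((Transposition.transpose k k \<circ> q) i) i)) = 0"
      by (intro sum.neutral ballI) (use eqk in \<open>simp del: prod.lessThan_Suc transpose_same\<close>)
    then show ?thesis by (subst sum.insert) (auto simp del: prod.lessThan_Suc)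
  qed
  also have "\<dots> = (\<Sum>a<k. - (M a k * ldet k (\<lambda>i j. if j = a then M k i else M j i)))"
    unfolding ldet_def sum_distrib_left sum_negf[symmetric]
    by (intro sum.cong refl eq) auto
  also have "\<dots> = (\<Sum>a<k. - (M a k * ldet k (\<lambda>i j. if i = a then M k j else M i j)))"
    by (intro sum.cong refl) (simp add: ldet_transpose[symmetric, where A="\<lambda>i j. if i = _ then M k j else M i j"])
  finally show ?thesis by (simp add: sum_negf)
qed

lemma ldet_sum_rows:
  "ldet k (\<lambda>i j. A i j + B i j)
     = (\<Sum>S\<in>Pow {..<k}. ldet k (\<lambda>i j. if i \<in> S then A i j else B i j))"
proof -
  have "(\<Prod>i<k. if i \<in> S then A i (p i) else B i (p i)) = (\<Prod>i\<in>S. A i (p i)) * (\<Prod>i\<in>{..<k}-S. B i (p i))"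
    if "S \<in> Pow {..<k}" for S p
  proof -
    have "{..<k} \<inter> S = S" "{..<k} \<inter> - S = {..<k} - S" using that by auto
    then show ?thesis by (subst prod.If_cases) auto
  qed
  then have "(\<Sum>S\<in>Pow {..<k}. ldet k (\<lambda>i j. if i \<in> S then A i j else B i j))
     = (\<Sum>S\<in>Pow {..<k}. \<Sum>p | p permutes {..<k}. of_int (sign p) *
          ((\<Prod>i\<in>S. A i (p i)) * (\<Prod>i\<in>{..<k}-S. B i (p i))))"
    unfolding ldet_def by (intro sum.cong refl) simp
  also have "\<dots> = (\<Sum>p | p permutes {..<k}. of_int (sign p) * (\<Prod>i<k. A i (p i) + B i (p i)))"
    by (subst sum.swap) (simp add: prod_add sum_distrib_left)
  finally show ?thesis by (simp add: ldet_def)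
qed

section \<open>Hadamard's inequality by orthogonalisation\<close>

definition cip :: "nat \<Rightarrow> (nat \<Rightarrow> complex) \<Rightarrow> (nat \<Rightarrow> complex) \<Rightarrow> complex" where
  "cip k u v = (\<Sum>b<k. u b * cnj (v b))"

lemma cip_self: "cip k u u = of_real (\<Sum>b<k. (cmod (u b))\<^sup>2)"
  by (simp add: cip_def complex_norm_square del: of_real_power)

lemma cip_commute: "cip k v u = cnj (cip k u v)"
  by (simp add: cip_def mult.commute)

lemma cip_diff_left: "cip k (\<lambda>b. u b - v b) w = cip k u w - cip k v w"
  by (simp add: cip_def algebra_simps sum_subtractf)

lemma cip_sum_left: "cip k (\<lambda>b. \<Sum>a\<in>S. c a * u a b) w = (\<Sum>a\<in>S. c a * cip k (u a) w)"
  unfolding cip_def sum_distrib_right sum_distrib_left by (subst sum.swap) (simp add: mult_ac)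

text \<open>Covers zero rows in the Gram--Schmidt step, where the coefficient is a quotient by 0 and
  hence 0.\<close>

lemma cip_zero_left:
  assumes "cip k u u = 0" shows "cip k u v = 0"
proof -
  have "(\<Sum>b<k. (cmod (u b))\<^sup>2) = 0" using assms unfolding cip_self of_real_eq_0_iff .
  then have "\<forall>b\<in>{..<k}. (cmod (u b))\<^sup>2 = 0" by (subst (asm) sum_nonneg_eq_0_iff) auto
  then show ?thesis by (simp add: cip_def)
qed

text \<open>Gram--Schmidt one row at a time: \<open>m\<close> counts the rows already orthogonalised.\<close>

lemma hadamard_orthogonalised:
  assumes "m \<le> k" "\<And>a b. a < m \<Longrightarrow> b < m \<Longrightarrow> a \<noteq> b \<Longrightarrow> cip k (A a) (A b) = 0"
  shows "(cmod (ldet k A))\<^sup>2 \<le> (\<Prod>a<k. \<Sum>b<k. (cmod (A a b))\<^sup>2)"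
  using assms
proof (induction "k - m" arbitrary: m A)
  case 0
  then have mk: "m = k" by simp
  define M where "M = Matrix.mat k k (\<lambda>(i, j). A i j)"
  define N where "N = Matrix.mat k k (\<lambda>(i, j). cnj (A j i))"
  \<comment> \<open>All rows are orthogonal here, so A times its adjoint is diagonal, and the
    determinant of that product is the squared modulus of the determinant of A.\<close>
  have "M * N = Matrix.mat k k (\<lambda>(i, j). cip k (A i) (A j))"
    unfolding M_def N_def cip_def
    by (intro eq_matI) (auto simp: scalar_prod_def lessThan_atLeast0)
  then have "ldet k (\<lambda>i j. cip k (A i) (A j)) = Determinant.det M * Determinant.det N"
    unfolding ldet_eq_det by (subst Determinant.det_mult[symmetric, where n=k]) (auto simp: M_def N_def)
  also have "Determinant.det N = ldet k (\<lambda>i j. cnj (A j i))" by (simp add: ldet_eq_det N_def)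
  also have "\<dots> = ldet k (\<lambda>i j. cnj (A i j))" by (rule ldet_transpose)
  also have "\<dots> = cnj (ldet k A)" by (simp add: ldet_def)
  finally have "ldet k (\<lambda>i j. cip k (A i) (A j)) = ldet k A * cnj (ldet k A)"
    by (simp add: M_def ldet_eq_det)
  moreover have "ldet k (\<lambda>i j. cip k (A i) (A j)) = (\<Prod>a<k. cip k (A a) (A a))"
  proof -
    have "ldet k (\<lambda>i j. cip k (A i) (A j)) =
      (\<Sum>p\<in>{id}. of_int (sign p) * (\<Prod>i<k. cip k (A i) (A (p i))))"
      unfolding ldet_def
    proof (intro sum.mono_neutral_right ballI)
      fix p assume p: "p \<in> {p. p permutes {..<k}} - {id}"
      then obtain i where i: "p i \<noteq> i" by (metis DiffE eq_id_iff singletonI)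
      have pp: "p permutes {..<k}" using p by simp
      have "i < k" using permutes_not_in[OF pp, of i] i by auto
      moreover have "p i < k" using permutes_in_image[OF pp, of i] \<open>i < k\<close> by simp
      ultimately
      have "cip k (A i) (A (p i)) = 0" using 0(3) i mk by metis
      then have "(\<Prod>i<k. cip k (A i) (A (p i))) = 0"
        using \<open>i < k\<close> by (intro prod_zero) auto
      then show "of_int (sign p) * (\<Prod>i<k. cip k (A i) (A (p i))) = 0" by simp
    qed (auto simp: finite_permutations permutes_id)
    then show ?thesis by simp
  qed
  ultimately have "complex_of_real ((cmod (ldet k A))\<^sup>2) = of_real (\<Prod>a<k. \<Sum>b<k. (cmod (A a b))\<^sup>2)"
    by (simp add: complex_norm_square cip_self del: of_real_power of_real_sum)
  then show ?case by (simp only: of_real_eq_iff)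
next
  case (Suc d)
  then have mk: "m < k" by simp
  \<comment> \<open>Coefficients of the orthogonal projection of row \<open>m\<close> onto the
    earlier rows; \<open>w\<close> is the projection and \<open>r\<close> the remainder.\<close>
  define c where "c a = cip k (A m) (A a) / cip k (A a) (A a)" for a
  define w where "w j = (\<Sum>a<m. c a * A a j)" for j
  define r where "r j = A m j - w j" for j
  define A' where "A' = A(m := r)"
  have w_ip: "cip k w (A b) = cip k (A m) (A b)" if "b < m" for b
  proof -
    have "cip k w (A b) = (\<Sum>a<m. c a * cip k (A a) (A b))"
      unfolding w_def by (rule cip_sum_left)
    also have "\<dots> = (\<Sum>a\<in>{b}. c a * cip k (A a) (A b))"
      using that Suc.prems(2) by (intro sum.mono_neutral_right) auto
    also have "\<dots> = cip k (A m) (A b)"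
      using cip_zero_left[of k "A b" "A m"] cip_commute[of k "A m" "A b"] by (auto simp: c_def)
    finally show ?thesis .
  qed
  have r_ip: "cip k r (A b) = 0" if "b < m" for b
    using w_ip[OF that] unfolding r_def cip_diff_left by simp
  have rw: "cip k w r = 0"
    unfolding w_def cip_sum_left using r_ip cip_commute[of k r] by simp
  \<comment> \<open>Pythagoras: replacing row \<open>m\<close> by its remainder can only shorten it,
    while the determinant stays the same by \<open>det_eq\<close>.\<close>
  have "cip k (A m) (A m) = cip k r r + cip k w w"
  proof -
    have "A m = (\<lambda>j. r j + w j)" by (simp add: r_def)
    then have "cip k (A m) (A m) = cip k r r + cip k w w + cip k w r + cip k r w"
      by (simp add: cip_def algebra_simps sum.distrib)
    then show ?thesis using rw cip_commute[of k w r] by simp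
  qed
  then have "complex_of_real (\<Sum>b<k. (cmod (A m b))\<^sup>2)
      = of_real ((\<Sum>b<k. (cmod (r b))\<^sup>2) + (\<Sum>b<k. (cmod (w b))\<^sup>2))"
    unfolding cip_self by simp
  then have norm_eq: "(\<Sum>b<k. (cmod (A m b))\<^sup>2) = (\<Sum>b<k. (cmod (r b))\<^sup>2) + (\<Sum>b<k. (cmod (w b))\<^sup>2)"
    by (simp only: of_real_eq_iff)
  have norm_le: "(\<Sum>b<k. (cmod (r b))\<^sup>2) \<le> (\<Sum>b<k. (cmod (A m b))\<^sup>2)"
    unfolding norm_eq by (simp add: sum_nonneg)
  have det_eq: "ldet k A' = ldet k A"
  proof -
    let ?C = "\<lambda>b. ldet k (\<lambda>i j. if i = m then of_bool (j = b) else A i j)"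
    have zero: "(\<Sum>b<k. A a b * ?C b) = 0" if "a < m" for a
    proof -
      have "(\<Sum>b<k. A a b * ?C b) = ldet k (\<lambda>i j. if i = m then A a j else A i j)"
        by (rule ldet_row_expand[OF mk, symmetric])
      also have "\<dots> = 0" using that mk by (intro ldet_equal_rows[of a k m]) auto
      finally show ?thesis .
    qed
    have "ldet k A' = ldet k (\<lambda>i j. if i = m then r j else A i j)"
      by (intro ldet_cong) (auto simp: A'_def)
    also have "\<dots> = (\<Sum>b<k. r b * ?C b)" by (rule ldet_row_expand[OF mk])
    also have "\<dots> = (\<Sum>b<k. A m b * ?C b) - (\<Sum>a<m. c a * (\<Sum>b<k. A a b * ?C b))"
      unfolding r_def w_def sum_distrib_left left_diff_distrib sum_subtractf sum_distrib_right
      by (subst sum.swap) (simp add: mult_ac)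
    also have "\<dots> = (\<Sum>b<k. A m b * ?C b)" using zero by simp
    also have "\<dots> = ldet k (\<lambda>i j. if i = m then A m j else A i j)"
      by (rule ldet_row_expand[OF mk, symmetric])
    also have "\<dots> = ldet k A" by (intro ldet_cong) auto
    finally show ?thesis .
  qed
  have "(cmod (ldet k A'))\<^sup>2 \<le> (\<Prod>a<k. \<Sum>b<k. (cmod (A' a b))\<^sup>2)"
  proof (rule Suc.hyps(1))
    show "d = k - Suc m" "Suc m \<le> k" using Suc.hyps(2) mk by auto
    show "cip k (A' a) (A' b) = 0" if "a < Suc m" "b < Suc m" "a \<noteq> b" for a b
      using that Suc.prems(2)[of a b] r_ip[of b] r_ip[of a] cip_commute[of k r "A a"]
      by (auto simp: A'_def less_Suc_eq)
  qed
  also have "\<dots> \<le> (\<Prod>a<k. \<Sum>b<k. (cmod (A a b))\<^sup>2)"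
    using norm_le by (intro prod_mono) (auto simp: A'_def sum_nonneg)
  finally show ?case by (simp add: det_eq)
qed

text \<open>The transposed form, by columns: each column has length at most sqrt k times
  \<open>R b\<close>. Columns are needed because the kernels are majorised in the column
  variable.\<close>

lemma hadamard_bound:
  assumes "\<And>a b. a < k \<Longrightarrow> b < k \<Longrightarrow> cmod (A a b) \<le> R b" "\<And>b. b < k \<Longrightarrow> 0 \<le> R b"
  shows "cmod (ldet k A) \<le> sqrt (real k ^ k) * (\<Prod>b<k. R b)"
proof -
  have "(cmod (ldet k A))\<^sup>2 = (cmod (ldet k (\<lambda>i j. A j i)))\<^sup>2"
    by (simp only: ldet_transpose[of k A])
  also have "\<dots> \<le> (\<Prod>b<k. \<Sum>a<k. (cmod (A a b))\<^sup>2)"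
    by (rule hadamard_orthogonalised[of 0]) auto
  also have "\<dots> \<le> (\<Prod>b<k. \<Sum>a<k. (R b)\<^sup>2)"
    using assms by (intro prod_mono conjI sum_nonneg sum_mono power_mono) auto
  also have "\<dots> = (sqrt (real k ^ k) * (\<Prod>b<k. R b))\<^sup>2"
  proof -
    have "(\<Prod>b<k. \<Sum>a<k. (R b)\<^sup>2) = (\<Prod>b<k. real k) * (\<Prod>b<k. (R b)\<^sup>2)"
      unfolding prod.distrib[symmetric] by (intro prod.cong) auto
    then show ?thesis by (simp add: power_mult_distrib prod_power_distrib[symmetric])
  qed
  finally show ?thesis
    by (rule power2_le_imp_le) (use assms in \<open>auto intro!: mult_nonneg_nonneg prod_nonneg\<close>)
qed

section \<open>Two series\<close>

lemma prod_falling: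
  assumes "q \<le> p"
  shows "(\<Prod>s<q. of_nat (p - s)) = (fact p / fact (p - q) :: complex)"
  using assms
proof (induction q)
  case (Suc q)
  have "p - q = Suc (p - Suc q)" using Suc.prems by simp
  then have "(fact (p - q) :: complex) = of_nat (p - q) * fact (p - Suc q)"
    by (metis fact_Suc)
  moreover have "of_nat (p - q) \<noteq> (0::complex)" using Suc.prems by simp
  ultimately show ?case using Suc by simp
qed simp

text \<open>From p^p / p! \<le> e^p the square of p^(p/2) / p! is at most e^p / p!, so a factorial
  remains to beat any power of \<open>E\<close>.\<close>

lemma summable_hadamard_series:
  fixes E :: real
  assumes "0 \<le> E"
  shows "summable (\<lambda>p. E ^ p * sqrt (real p ^ p) / fact p)"
proof -
  have "summable (\<lambda>p. ((2 * E\<^sup>2 * exp 1) ^ p / fact p + (1 / 2) ^ p) / 2)"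
  proof (intro summable_divide summable_add summable_geometric)
    show "summable (\<lambda>p. (2 * E\<^sup>2 * exp 1) ^ p / fact p)"
      using summable_exp[of "2 * E\<^sup>2 * exp 1"] by (simp only: divide_inverse mult.commute)
  qed simp
  moreover have "norm (E ^ p * sqrt (real p ^ p) / fact p) \<le> ((2 * E\<^sup>2 * exp 1) ^ p / fact p + (1 / 2) ^ p) / 2" for p
  proof -
    have pp: "real p ^ p / fact p \<le> exp (real p)"
    proof -
      have "(\<Sum>n\<in>{p}. real p ^ n /\<^sub>R fact n) \<le> (\<Sum>n. real p ^ n /\<^sub>R fact n)"
        by (rule sum_le_suminf[OF summable_exp_generic]) auto
      then show ?thesis by (simp add: exp_def divide_inverse mult.commute)
    qed
    \<comment> \<open>The term is u v, bounded by half of u^2 + v^2: u^2 lies below an exponential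
      series and v^2 is geometric. The 2 under the root of \<open>u\<close> and the 1/2 in
      \<open>v\<close> cancel in the product.\<close>
    define u where "u = sqrt ((2 * E\<^sup>2) ^ p * real p ^ p) / fact p"
    define v where "v = sqrt ((1 / 2) ^ p)"
    have "E ^ p * sqrt (real p ^ p) / fact p = u * v"
    proof -
      have "sqrt ((2 * E\<^sup>2) ^ p * real p ^ p) * sqrt ((1 / 2) ^ p) = sqrt ((E ^ p)\<^sup>2 * real p ^ p)"
        unfolding real_sqrt_mult[symmetric]
        by (rule arg_cong[where f=sqrt]) (simp add: power_mult_distrib power_mult[symmetric] power_one_over mult.commute)
      also have "\<dots> = E ^ p * sqrt (real p ^ p)"
        using assms by (simp only: real_sqrt_mult real_sqrt_abs abs_of_nonneg zero_le_power)
      finally show ?thesis by (simp add: u_def v_def)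
    qed
    also have "\<dots> \<le> (u\<^sup>2 + v\<^sup>2) / 2"
      using sum_squares_bound[of u v] by simp
    also have "u\<^sup>2 = (2 * E\<^sup>2) ^ p * (real p ^ p / fact p) / fact p"
      by (simp add: u_def power_divide power2_eq_square)
    also have "\<dots> \<le> (2 * E\<^sup>2) ^ p * exp (real p) / fact p"
      using pp by (intro divide_right_mono mult_left_mono) auto
    also have "\<dots> = (2 * E\<^sup>2 * exp 1) ^ p / fact p"
      by (simp add: power_mult_distrib exp_of_nat_mult[symmetric])
    also have "v\<^sup>2 = (1 / 2) ^ p" by (simp add: v_def)
    finally show ?thesis using assms by simp
  qed
  ultimately show ?thesis by (rule summable_comparison_test'[where N=0]) 
qed

text \<open>One absolutely summable family, added up along p and along m = p + q. The binomial
  bounds of row p add up to 2^p.\<close>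

lemma regroup_double_series:
  fixes t :: "nat \<Rightarrow> nat \<Rightarrow> complex"
  assumes zero: "\<And>p q. p < q \<Longrightarrow> t p q = 0"
    and bound: "\<And>p q. q \<le> p \<Longrightarrow> norm (t p q) \<le> real (p choose q) * b p"
    and summ: "summable (\<lambda>p. 2 ^ p * b p)"
  shows "\<exists>D. (\<lambda>p. \<Sum>q\<le>p. t p q) sums D \<and> (\<lambda>m. \<Sum>q\<le>m. t (m - q) q) sums D"
proof -
  let ?S = "SIGMA p:UNIV. {..p::nat}"
  have "Infinite_Sum.abs_summable_on (\<lambda>(p, q). t p q) ?S"
    unfolding Infinite_Sum.abs_summable_on_Sigma_iff
  proof (intro conjI ballI)
    have "norm (\<Sum>\<^sub>\<infinity>q\<in>{..p}. norm (t p q)) \<le> 2 ^ p * b p" for p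
    proof -
      have "(\<Sum>q\<le>p. norm (t p q)) \<le> (\<Sum>q\<le>p. real (p choose q) * b p)"
        by (intro sum_mono bound) auto
      also have "\<dots> = 2 ^ p * b p"
        unfolding sum_distrib_right[symmetric]
        by (metis choose_row_sum of_nat_sum of_nat_power of_nat_numeral)
      finally show ?thesis by (simp add: sum_nonneg)
    qed
    then have "summable (\<lambda>p. norm (norm (\<Sum>\<^sub>\<infinity>q\<in>{..p}. norm (t p q))))"
      by (intro summable_comparison_test'[OF summ, where N=0]) simp
    then show "Infinite_Sum.abs_summable_on (\<lambda>p. \<Sum>\<^sub>\<infinity>q\<in>{..p}. norm (case (p, q) of (p, q) \<Rightarrow> t p q)) UNIV"
      by (simp add: norm_summable_imp_summable_on)
  qed auto
  then obtain D where D: "((\<lambda>(p, q). t p q) has_sum D) ?S"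
    using Infinite_Sum.abs_summable_summable summable_on_def by blast
  have "((\<lambda>p. \<Sum>q\<le>p. t p q) has_sum D) UNIV"
    by (rule has_sum_SigmaD[OF D]) (auto intro!: has_sum_finiteI)
  moreover have "((\<lambda>m. \<Sum>q\<le>m. t (m - q) q) has_sum D) UNIV"
  proof -
    \<comment> \<open>The map from (p, q) to (p + q, q) carries the region q \<le> p onto 2 q \<le>
      m.\<close>
    have "((\<lambda>(m, q). t (m - q) q) has_sum D) {(m, q). 2 * q \<le> m}"
      using D by (subst has_sum_reindex_bij_witness[where j="\<lambda>(m, q). (m - q, q)" and i="\<lambda>(p, q). (p + q, q)" and T="?S" and h="\<lambda>(p, q). t p q"]) auto
    \<comment> \<open>The pairs added have m - q < q, where the array is zero.\<close>
    then have "((\<lambda>(m, q). t (m - q) q) has_sum D) ?S"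
      by (subst has_sum_cong_neutral[where T="{(m, q). 2 * q \<le> m}" and g="\<lambda>(m, q). t (m - q) q"]) (auto intro: zero)
    then show ?thesis
      by (rule has_sum_SigmaD) (auto intro!: has_sum_finiteI)
  qed
  ultimately show ?thesis by (blast intro: has_sum_imp_sums)
qed

section \<open>Fredholm series of dominated kernels\<close>

lemma norm_integral_le_majorant:
  fixes f :: "'a \<Rightarrow> 'b::{banach, second_countable_topology}"
  assumes "integrable M f" "integrable M g" "\<And>x. x \<in> space M \<Longrightarrow> norm (f x) \<le> g x"
  shows "norm (integral\<^sup>L M f) \<le> integral\<^sup>L M g"
  by (rule order_trans[OF integral_norm_bound integral_mono]) (use assms in auto)

text \<open>Supplies the relabelling that moves a kernel from the rows in \<open>S\<close> to the
  rows in \<open>T\<close>.\<close>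

lemma permutes_carrying_subset:
  assumes "finite U" "S \<subseteq> U" "T \<subseteq> U" "card S = card T"
  shows "\<exists>\<sigma>. \<sigma> permutes U \<and> (\<forall>a\<in>U. \<sigma> a \<in> T \<longleftrightarrow> a \<in> S)"
proof -
  have fin: "finite S" "finite T" using assms finite_subset by auto
  obtain f where f: "bij_betw f S T"
    using finite_same_card_bij[OF fin assms(4)] by blast
  have "card (U - S) = card (U - T)" using assms fin by (simp add: card_Diff_subset)
  then obtain g where g: "bij_betw g (U - S) (U - T)"
    using finite_same_card_bij[of "U - S" "U - T"] assms(1) by blast
  define \<sigma> where "\<sigma> a = (if a \<in> S then f a else if a \<in> U then g a else a)" for a
  have "bij_betw \<sigma> S T" using f by (rule bij_betw_cong[THEN iffD1, rotated]) (simp add: \<sigma>_def)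
  moreover have "bij_betw \<sigma> (U - S) (U - T)" using g by (rule bij_betw_cong[THEN iffD1, rotated]) (simp add: \<sigma>_def)
  ultimately have "bij_betw \<sigma> (S \<union> (U - S)) (T \<union> (U - T))"
    by (rule bij_betw_combine) auto
  then have "bij_betw \<sigma> U U" using assms(2,3) by (simp add: Un_absorb1)
  then have "\<sigma> permutes U"
    by (rule bij_imp_permutes) (use assms(2) in \<open>auto simp: \<sigma>_def\<close>)
  moreover have "\<sigma> a \<in> T \<longleftrightarrow> a \<in> S" if "a \<in> U" for a
    using that f g by (auto simp: \<sigma>_def bij_betw_def)
  ultimately show ?thesis by blast
qed

text \<open>The Schur complement for a kernel whose \<open>Y\<close> block is zero, so that no
  inverse appears. It is padded with zeros on \<open>Y\<close>, which keeps one index set and one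
  majorant through successive eliminations.\<close>

definition schur_kernel :: "'x measure \<Rightarrow> 'i set \<Rightarrow> ('i \<Rightarrow> 'x \<Rightarrow> 'i \<Rightarrow> 'x \<Rightarrow> complex)
    \<Rightarrow> 'i \<Rightarrow> 'x \<Rightarrow> 'i \<Rightarrow> 'x \<Rightarrow> complex" where
  "schur_kernel M Y G i x j y = (if i \<in> Y \<or> j \<in> Y then 0
     else G i x j y + (\<Sum>l\<in>Y. \<integral>z. G i x l z * G l z j y \<partial>M))"

text \<open>The majorant sees only the column index and column point; a composition then costs no
  more than the finite integral of one \<open>h l\<close>.\<close>

locale fredholm_kernels = sigma_finite_measure M
  for M :: "'x measure" +
  fixes I :: "'i set" and h :: "'i \<Rightarrow> 'x \<Rightarrow> real"
  assumes finite_index: "finite I"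
    and h_nonneg: "0 \<le> h j y"
    and h_integrable: "j \<in> I \<Longrightarrow> integrable M (h j)"
begin

sublocale prod: product_sigma_finite "\<lambda>_::nat. M" ..

definition meas_kernel :: "('i \<Rightarrow> 'x \<Rightarrow> 'i \<Rightarrow> 'x \<Rightarrow> complex) \<Rightarrow> bool" where
  "meas_kernel G \<longleftrightarrow> (\<forall>i\<in>I. \<forall>j\<in>I. (\<lambda>p. G i (fst p) j (snd p)) \<in> borel_measurable (M \<Otimes>\<^sub>M M))"

definition bdd_kernel :: "real \<Rightarrow> ('i \<Rightarrow> 'x \<Rightarrow> 'i \<Rightarrow> 'x \<Rightarrow> complex) \<Rightarrow> bool" where
  "bdd_kernel C G \<longleftrightarrow> 0 \<le> C \<and> (\<forall>i\<in>I. \<forall>j\<in>I. \<forall>x y. cmod (G i x j y) \<le> C * h j y)"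

definition adm :: "('i \<Rightarrow> 'x \<Rightarrow> 'i \<Rightarrow> 'x \<Rightarrow> complex) \<Rightarrow> bool" where
  "adm G \<longleftrightarrow> meas_kernel G \<and> (\<exists>C. bdd_kernel C G)"

lemma bdd_kernel_mono: "bdd_kernel C G \<Longrightarrow> C \<le> C' \<Longrightarrow> bdd_kernel C' G"
  unfolding bdd_kernel_def by (meson h_nonneg mult_right_mono order_trans)

lemma adm_common_bound:
  assumes "finite S" "\<And>G. G \<in> S \<Longrightarrow> adm G"
  shows "\<exists>C. 0 \<le> C \<and> (\<forall>G\<in>S. bdd_kernel C G)"
  using assms
proof (induction S rule: finite_induct)
  case empty
  show ?case by (rule exI[of _ 0]) simp
next
  case (insert G S)
  then obtain C C' where "0 \<le> C" "\<forall>G\<in>S. bdd_kernel C G" "bdd_kernel C' G"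
    unfolding adm_def by blast
  then show ?case
    by (intro exI[of _ "max C C'"]) (auto intro: bdd_kernel_mono)
qed

lemma meas_kernel_compose:
  assumes "meas_kernel G" "i \<in> I" "j \<in> I" "f \<in> N \<rightarrow>\<^sub>M M" "g \<in> N \<rightarrow>\<^sub>M M"
  shows "(\<lambda>w. G i (f w) j (g w)) \<in> borel_measurable N"
proof -
  have "(\<lambda>p. G i (fst p) j (snd p)) \<in> borel_measurable (M \<Otimes>\<^sub>M M)"
    using assms(1-3) unfolding meas_kernel_def by blast
  from measurable_compose[OF measurable_Pair[OF assms(4,5)] this] show ?thesis by simp
qed

lemma adm_add:
  assumes "adm G" "adm H" shows "adm (\<lambda>i x j y. G i x j y + H i x j y)"
proof -
  obtain C C' where C: "bdd_kernel C G" "bdd_kernel C' H" using assms unfolding adm_def by blast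
  have "bdd_kernel (C + C') (\<lambda>i x j y. G i x j y + H i x j y)"
    using C unfolding bdd_kernel_def
    by (auto simp: distrib_right intro!: norm_triangle_mono)
  moreover have "meas_kernel (\<lambda>i x j y. G i x j y + H i x j y)"
    using assms unfolding adm_def meas_kernel_def by (intro ballI borel_measurable_add) auto
  ultimately show ?thesis unfolding adm_def by blast
qed

lemma adm_zero: "adm (\<lambda>i x j y. 0)"
  unfolding adm_def bdd_kernel_def meas_kernel_def by (auto intro!: exI[of _ 0])

lemma adm_sum: "finite S \<Longrightarrow> (\<And>l. l \<in> S \<Longrightarrow> adm (G l)) \<Longrightarrow> adm (\<lambda>i x j y. \<Sum>l\<in>S. G l i x j y)"
  by (induction S rule: finite_induct) (simp_all add: adm_zero adm_add)

lemma adm_restrict: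
  assumes "adm G" shows "adm (\<lambda>i x j y. if P i j then G i x j y else 0)"
proof -
  obtain C where C: "bdd_kernel C G" using assms unfolding adm_def by blast
  then have "bdd_kernel C (\<lambda>i x j y. if P i j then G i x j y else 0)"
    unfolding bdd_kernel_def using h_nonneg by auto
  moreover have "meas_kernel (\<lambda>i x j y. if P i j then G i x j y else 0)"
    unfolding meas_kernel_def
  proof (intro ballI)
    fix i j assume "i \<in> I" "j \<in> I"
    then have "(\<lambda>p. G i (fst p) j (snd p)) \<in> borel_measurable (M \<Otimes>\<^sub>M M)"
      using assms unfolding adm_def meas_kernel_def by blast
    then show "(\<lambda>p. if P i j then G i (fst p) j (snd p) else 0) \<in> borel_measurable (M \<Otimes>\<^sub>M M)"
      by (cases "P i j") simp_all
  qed
  ultimately show ?thesis unfolding adm_def by blast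
qed

lemma integrable_kernel_product:
  assumes B: "adm B" and C: "adm C" and ind: "i \<in> I" "l \<in> I" "j \<in> I" and x: "x \<in> space M" "y \<in> space M"
  shows "integrable M (\<lambda>z. B i x l z * C l z j y)"
proof -
  obtain c c' where c: "bdd_kernel c B" "bdd_kernel c' C" using assms unfolding adm_def by blast
  have [measurable]: "(\<lambda>z. B i x l z) \<in> borel_measurable M" "(\<lambda>z. C l z j y) \<in> borel_measurable M"
    using B C ind x unfolding adm_def by (auto intro!: meas_kernel_compose)
  show ?thesis
  proof (rule Bochner_Integration.integrable_bound)
    show "integrable M (\<lambda>z. c * h l z * (c' * h j y))" using h_integrable[OF ind(2)] by simp
    have "cmod (B i x l z * C l z j y) \<le> c * h l z * (c' * h j y)" for z
      using c ind unfolding norm_mult bdd_kernel_def by (intro mult_mono) (auto simp: h_nonneg)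
    then show "AE z in M. cmod (B i x l z * C l z j y) \<le> norm (c * h l z * (c' * h j y))"
      by (intro AE_I2) (simp add: order_trans[OF _ abs_ge_self])
  qed simp
qed

lemma adm_kernel_product:
  assumes B: "adm B" and C: "adm C" and l: "l \<in> I"
  shows "adm (\<lambda>i x j y. \<integral>z. B i x l z * C l z j y \<partial>M)"
proof -
  obtain c c' where c: "bdd_kernel c B" "bdd_kernel c' C" using assms unfolding adm_def by blast
  have "meas_kernel (\<lambda>i x j y. \<integral>z. B i x l z * C l z j y \<partial>M)"
    unfolding meas_kernel_def
  proof (intro ballI)
    fix i j assume ind: "i \<in> I" "j \<in> I"
    have "(\<lambda>w. B i (fst (fst w)) l (snd w)) \<in> borel_measurable ((M \<Otimes>\<^sub>M M) \<Otimes>\<^sub>M M)"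
      "(\<lambda>w. C l (snd w) j (snd (fst w))) \<in> borel_measurable ((M \<Otimes>\<^sub>M M) \<Otimes>\<^sub>M M)"
      using B C ind l unfolding adm_def by (auto intro!: meas_kernel_compose)
    then show "(\<lambda>p. \<integral>z. B i (fst p) l z * C l z j (snd p) \<partial>M) \<in> borel_measurable (M \<Otimes>\<^sub>M M)"
      by (intro borel_measurable_lebesgue_integral) (simp add: case_prod_beta)
  qed
  moreover have "bdd_kernel (c * (\<integral>z. h l z \<partial>M) * c') (\<lambda>i x j y. \<integral>z. B i x l z * C l z j y \<partial>M)"
    unfolding bdd_kernel_def
  proof (intro conjI ballI allI)
    show "0 \<le> c * (\<integral>z. h l z \<partial>M) * c'"
      using c h_nonneg unfolding bdd_kernel_def by (intro mult_nonneg_nonneg integral_nonneg_AE) auto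
    fix i j x y assume ind: "i \<in> I" "j \<in> I"
    show "cmod (\<integral>z. B i x l z * C l z j y \<partial>M) \<le> c * (\<integral>z. h l z \<partial>M) * c' * h j y"
    proof (cases "integrable M (\<lambda>z. B i x l z * C l z j y)")
      case True
      have "cmod (\<integral>z. B i x l z * C l z j y \<partial>M) \<le> (\<integral>z. c * h l z * (c' * h j y) \<partial>M)"
      proof (rule norm_integral_le_majorant[OF True])
        show "integrable M (\<lambda>z. c * h l z * (c' * h j y))" using h_integrable[OF l] by simp
        show "norm (B i x l z * C l z j y) \<le> c * h l z * (c' * h j y)" for z
          using c ind l unfolding norm_mult bdd_kernel_def by (intro mult_mono) (auto simp: h_nonneg)
      qed
      then show ?thesis by (simp add: mult_ac)
    next
      \<comment> \<open>The bound is demanded at all points, whereas integrability is only known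
        over \<open>space M\<close>; a non-integrable product has integral 0.\<close>
      case False
      have "0 \<le> c * (\<integral>z. h l z \<partial>M) * c' * h j y"
        using c h_nonneg unfolding bdd_kernel_def by (intro mult_nonneg_nonneg integral_nonneg_AE) auto
      then show ?thesis using False by (simp add: not_integrable_integral_eq)
    qed
  qed
  ultimately show ?thesis unfolding adm_def by blast
qed

section \<open>Integrated determinants with a separate kernel in each row\<close>

text \<open>Elimination alters one row at a time, so row \<open>a\<close> gets its own kernel
  \<open>Gs a\<close>. A constant family gives the Fredholm term without its coefficient.\<close>

definition Phi :: "nat \<Rightarrow> (nat \<Rightarrow> 'i \<Rightarrow> 'x \<Rightarrow> 'i \<Rightarrow> 'x \<Rightarrow> complex) \<Rightarrow> complex" where
  "Phi k Gs = (\<Sum>\<iota>\<in>PiE {..<k} (\<lambda>_. I). integral\<^sup>L (PiM {..<k} (\<lambda>_. M))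
      (\<lambda>\<xi>. ldet k (\<lambda>a b. Gs a (\<iota> a) (\<xi> a) (\<iota> b) (\<xi> b))))"

lemma fredholm_term_eq_Phi:
  "fredholm_term I M G k = (-1) ^ k / of_nat (fact k) * Phi k (\<lambda>_. G)"
  by (simp add: fredholm_term_def Phi_def)

lemma ldet_kernel_measurable:
  assumes "\<And>a. a < k \<Longrightarrow> meas_kernel (Gs a)" "\<iota> \<in> PiE {..<k} (\<lambda>_. I)"
  shows "(\<lambda>\<xi>. ldet k (\<lambda>a b. Gs a (\<iota> a) (\<xi> a) (\<iota> b) (\<xi> b))) \<in> borel_measurable (PiM {..<k} (\<lambda>_. M))"
  unfolding ldet_def
proof (intro borel_measurable_sum borel_measurable_times borel_measurable_const borel_measurable_prod)
  fix p a assume "p \<in> {p. p permutes {..<k}}" and a: "a \<in> {..<k}"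
  then have "p a < k" by (auto simp: permutes_in_image[where S="{..<k}", simplified])
  then show "(\<lambda>\<xi>. Gs a (\<iota> a) (\<xi> a) (\<iota> (p a)) (\<xi> (p a))) \<in> borel_measurable (PiM {..<k} (\<lambda>_. M))"
    using assms a by (intro meas_kernel_compose) (auto simp: PiE_def Pi_def)
qed

lemma ldet_kernel_bound:
  assumes "\<And>a. a < k \<Longrightarrow> bdd_kernel C (Gs a)" "\<iota> \<in> PiE {..<k} (\<lambda>_. I)" "0 \<le> C"
  shows "cmod (ldet k (\<lambda>a b. Gs a (\<iota> a) (\<xi> a) (\<iota> b) (\<xi> b)))
    \<le> sqrt (real k ^ k) * (\<Prod>b<k. C * h (\<iota> b) (\<xi> b))"
  using assms unfolding bdd_kernel_def
  by (intro hadamard_bound) (auto simp: PiE_def Pi_def h_nonneg)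

lemma integrable_majorant:
  assumes "\<iota> \<in> PiE {..<k} (\<lambda>_. I)"
  shows "integrable (PiM {..<k} (\<lambda>_. M)) (\<lambda>\<xi>. sqrt (real k ^ k) * (\<Prod>b<k. C * h (\<iota> b) (\<xi> b)))"
  using assms h_integrable
  by (intro integrable_mult_right prod.product_integrable_prod) (auto simp: PiE_def Pi_def)

lemma integrable_ldet_kernel:
  assumes "\<And>a. a < k \<Longrightarrow> adm (Gs a)" and \<iota>: "\<iota> \<in> PiE {..<k} (\<lambda>_. I)"
  shows "integrable (PiM {..<k} (\<lambda>_. M)) (\<lambda>\<xi>. ldet k (\<lambda>a b. Gs a (\<iota> a) (\<xi> a) (\<iota> b) (\<xi> b)))"
proof -
  obtain C where C: "0 \<le> C" "\<And>a. a < k \<Longrightarrow> bdd_kernel C (Gs a)"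
    using adm_common_bound[of "Gs ` {..<k}"] assms(1) by auto
  show ?thesis
  proof (rule Bochner_Integration.integrable_bound[OF integrable_majorant[OF \<iota>, of C]])
    show "(\<lambda>\<xi>. ldet k (\<lambda>a b. Gs a (\<iota> a) (\<xi> a) (\<iota> b) (\<xi> b))) \<in> borel_measurable (PiM {..<k} (\<lambda>_. M))"
      using assms unfolding adm_def by (intro ldet_kernel_measurable) auto
    show "AE \<xi> in PiM {..<k} (\<lambda>_. M). cmod (ldet k (\<lambda>a b. Gs a (\<iota> a) (\<xi> a) (\<iota> b) (\<xi> b)))
      \<le> norm (sqrt (real k ^ k) * (\<Prod>b<k. C * h (\<iota> b) (\<xi> b)))"
      by (intro AE_I2 order_trans[OF ldet_kernel_bound[of k C Gs \<iota>]]) (use C \<iota> in auto)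
  qed
qed

text \<open>Hadamard's bound splits into a product over columns; summing the column integrals over
  all index assignments turns the product into a k-th power.\<close>

lemma Phi_bound:
  assumes adm: "\<And>a. a < k \<Longrightarrow> adm (Gs a)" and C: "\<And>a. a < k \<Longrightarrow> bdd_kernel C (Gs a)" "0 \<le> C"
  shows "cmod (Phi k Gs) \<le> sqrt (real k ^ k) * (C * (\<Sum>i\<in>I. \<integral>x. h i x \<partial>M)) ^ k"
proof -
  have "cmod (Phi k Gs) \<le> (\<Sum>\<iota>\<in>PiE {..<k} (\<lambda>_. I). sqrt (real k ^ k) * (\<Prod>b<k. C * (\<integral>x. h (\<iota> b) x \<partial>M)))"
    unfolding Phi_def
  proof (rule sum_norm_le)
    fix \<iota> assume \<iota>: "\<iota> \<in> PiE {..<k} (\<lambda>_. I)"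
    have "cmod (\<integral>\<xi>. ldet k (\<lambda>a b. Gs a (\<iota> a) (\<xi> a) (\<iota> b) (\<xi> b)) \<partial>PiM {..<k} (\<lambda>_. M))
      \<le> (\<integral>\<xi>. sqrt (real k ^ k) * (\<Prod>b<k. C * h (\<iota> b) (\<xi> b)) \<partial>PiM {..<k} (\<lambda>_. M))"
      using \<iota> adm C
      by (intro norm_integral_le_majorant integrable_ldet_kernel integrable_majorant ldet_kernel_bound) auto
    also have "\<dots> = sqrt (real k ^ k) * (\<Prod>b<k. \<integral>x. C * h (\<iota> b) x \<partial>M)"
      using \<iota> h_integrable
      by (subst Bochner_Integration.integral_mult_right_zero, subst prod.product_integral_prod) (auto simp: PiE_def Pi_def)
    finally show "cmod (\<integral>\<xi>. ldet k (\<lambda>a b. Gs a (\<iota> a) (\<xi> a) (\<iota> b) (\<xi> b)) \<partial>PiM {..<k} (\<lambda>_. M))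
      \<le> sqrt (real k ^ k) * (\<Prod>b<k. C * (\<integral>x. h (\<iota> b) x \<partial>M))" by simp
  qed
  also have "\<dots> = sqrt (real k ^ k) * (\<Prod>b<k. \<Sum>i\<in>I. C * (\<integral>x. h i x \<partial>M))"
    by (subst prod_sum_PiE) (auto simp: finite_index sum_distrib_left)
  finally show ?thesis by (simp add: sum_distrib_left)
qed

lemma Phi_cong:
  assumes "\<And>\<iota> \<xi>. \<iota> \<in> PiE {..<k} (\<lambda>_. I) \<Longrightarrow> \<xi> \<in> space (PiM {..<k} (\<lambda>_. M)) \<Longrightarrow>
     ldet k (\<lambda>a b. Gs a (\<iota> a) (\<xi> a) (\<iota> b) (\<xi> b)) = ldet k (\<lambda>a b. Gs' a (\<iota> a) (\<xi> a) (\<iota> b) (\<xi> b))"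
  shows "Phi k Gs = Phi k Gs'"
  unfolding Phi_def using assms by (intro sum.cong refl Bochner_Integration.integral_cong)

lemma Phi_cong_slots:
  assumes "\<And>a. a < k \<Longrightarrow> Gs a = Gs' a"
  shows "Phi k Gs = Phi k Gs'"
  using assms by (intro Phi_cong ldet_cong) auto

text \<open>All factors are the same measure, and on boxes a permutation of coordinates only
  reorders a finite product.\<close>

lemma distr_PiM_permute:
  assumes "\<sigma> permutes {..<k::nat}"
  shows "distr (PiM {..<k} (\<lambda>_. M)) (PiM {..<k} (\<lambda>_. M)) (\<lambda>\<xi>. \<lambda>a\<in>{..<k}. \<xi> (\<sigma> a)) = PiM {..<k} (\<lambda>_. M)"
proof (rule prod.PiM_eqI)
  have \<sigma>: "\<sigma> a < k \<longleftrightarrow> a < k" for a using permutes_in_image[OF assms, of a] by simp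
  have meas: "(\<lambda>\<xi>. \<lambda>a\<in>{..<k}. \<xi> (\<sigma> a)) \<in> PiM {..<k} (\<lambda>_. M) \<rightarrow>\<^sub>M PiM {..<k} (\<lambda>_. M)"
    using \<sigma> by (intro measurable_restrict measurable_component_singleton) auto
  fix A :: "nat \<Rightarrow> 'x set" assume A: "\<And>i. i \<in> {..<k} \<Longrightarrow> A i \<in> sets M"
  define \<rho> where "\<rho> = Hilbert_Choice.inv \<sigma>"
  have \<rho>: "\<rho> a < k \<longleftrightarrow> a < k" "\<sigma> (\<rho> a) = a" "\<rho> (\<sigma> a) = a" for a
    using permutes_in_image[OF permutes_inv[OF assms], of a] permutes_inverses[OF assms]
    by (auto simp: \<rho>_def)
  have "(\<lambda>\<xi>. \<lambda>a\<in>{..<k}. \<xi> (\<sigma> a)) -` (PiE {..<k} A) \<inter> space (PiM {..<k} (\<lambda>_. M))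
      = PiE {..<k} (\<lambda>a. A (\<rho> a))"
  proof (intro equalityI subsetI)
    fix \<xi> assume "\<xi> \<in> (\<lambda>\<xi>. \<lambda>a\<in>{..<k}. \<xi> (\<sigma> a)) -` (PiE {..<k} A) \<inter> space (PiM {..<k} (\<lambda>_. M))"
    then have e: "\<xi> \<in> extensional {..<k}" and a: "\<And>a. a < k \<Longrightarrow> \<xi> (\<sigma> a) \<in> A a"
      by (auto simp: space_PiM PiE_def Pi_def)
    then show "\<xi> \<in> PiE {..<k} (\<lambda>a. A (\<rho> a))"
      using a[of "\<rho> _"] \<rho> by (auto simp: PiE_def Pi_def)
  next
    fix \<xi> assume \<xi>: "\<xi> \<in> PiE {..<k} (\<lambda>a. A (\<rho> a))"
    have "\<xi> (\<sigma> a) \<in> A a" if "a < k" for a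
      using that \<xi> \<sigma>[of a] \<rho>(3)[of a] by (auto simp: PiE_def Pi_def dest!: spec[of _ "\<sigma> a"])
    moreover have "\<xi> a \<in> space M" if "a < k" for a
      using that \<xi> A[of "\<rho> a"] sets.sets_into_space[of "A (\<rho> a)" M] \<rho>(1)[of a] by (auto simp: PiE_def Pi_def)
    ultimately show "\<xi> \<in> (\<lambda>\<xi>. \<lambda>a\<in>{..<k}. \<xi> (\<sigma> a)) -` (PiE {..<k} A) \<inter> space (PiM {..<k} (\<lambda>_. M))"
      using \<xi> by (auto simp: space_PiM PiE_def Pi_def)
  qed
  then have "emeasure (distr (PiM {..<k} (\<lambda>_. M)) (PiM {..<k} (\<lambda>_. M)) (\<lambda>\<xi>. \<lambda>a\<in>{..<k}. \<xi> (\<sigma> a))) (PiE {..<k} A)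
      = emeasure (PiM {..<k} (\<lambda>_. M)) (PiE {..<k} (\<lambda>a. A (\<rho> a)))"
    using A by (subst emeasure_distr[OF meas]) (auto intro!: sets_PiM_I_finite)
  also have "\<dots> = (\<Prod>a<k. emeasure M (A (\<rho> a)))"
    using A \<rho> by (intro prod.emeasure_PiM) auto
  also have "\<dots> = (\<Prod>a<k. emeasure M (A a))"
    using permutes_inv[OF assms] unfolding \<rho>_def[symmetric]
    by (rule prod.permute[where g="\<lambda>a. emeasure M (A a)", unfolded comp_def, symmetric])
  finally show "emeasure (distr (PiM {..<k} (\<lambda>_. M)) (PiM {..<k} (\<lambda>_. M)) (\<lambda>\<xi>. \<lambda>a\<in>{..<k}. \<xi> (\<sigma> a))) (PiE {..<k} A)
      = (\<Prod>a<k. emeasure M (A a))" .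
qed (auto simp: finite_lessThan)

text \<open>Permuting rows and columns together preserves the determinant, and the sum over indices
  and the product measure absorb the relabelling. Only the multiset of kernels matters, not their
  positions.\<close>

lemma Phi_permute:
  assumes \<sigma>: "\<sigma> permutes {..<k}" and adm: "\<And>a. a < k \<Longrightarrow> adm (Gs a)"
  shows "Phi k (\<lambda>a. Gs (\<sigma> a)) = Phi k Gs"
proof -
  define N where "N = PiM {..<k} (\<lambda>_. M)"
  define \<rho> where "\<rho> = Hilbert_Choice.inv \<sigma>"
  have \<rho>: "\<rho> permutes {..<k}" unfolding \<rho>_def by (rule permutes_inv[OF \<sigma>])
  have lt: "\<sigma> a < k \<longleftrightarrow> a < k" "\<rho> a < k \<longleftrightarrow> a < k" and inv: "\<sigma> (\<rho> a) = a" "\<rho> (\<sigma> a) = a" for a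
    using permutes_in_image[OF \<sigma>, of a] permutes_in_image[OF \<rho>, of a] permutes_inverses[OF \<sigma>]
    by (auto simp: \<rho>_def)
  have meas: "(\<lambda>\<xi>. \<lambda>a\<in>{..<k}. \<xi> (\<sigma> a)) \<in> N \<rightarrow>\<^sub>M N"
    unfolding N_def using lt by (intro measurable_restrict measurable_component_singleton) auto
  define F where "F \<iota> \<xi> = ldet k (\<lambda>a b. Gs (\<sigma> a) (\<iota> a) (\<xi> a) (\<iota> b) (\<xi> b))" for \<iota> \<xi>
  have "Phi k Gs = (\<Sum>\<iota>\<in>PiE {..<k} (\<lambda>_. I). \<integral>\<xi>. F (\<lambda>a\<in>{..<k}. \<iota> (\<sigma> a)) (\<lambda>a\<in>{..<k}. \<xi> (\<sigma> a)) \<partial>N)"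
    unfolding Phi_def N_def[symmetric]
  proof (intro sum.cong refl Bochner_Integration.integral_cong)
    fix \<iota> \<xi>
    have "ldet k (\<lambda>a b. Gs a (\<iota> a) (\<xi> a) (\<iota> b) (\<xi> b))
        = ldet k (\<lambda>a b. Gs (\<sigma> a) (\<iota> (\<sigma> a)) (\<xi> (\<sigma> a)) (\<iota> (\<sigma> b)) (\<xi> (\<sigma> b)))"
      by (rule ldet_permute_both[OF \<sigma>, symmetric])
    also have "\<dots> = F (\<lambda>a\<in>{..<k}. \<iota> (\<sigma> a)) (\<lambda>a\<in>{..<k}. \<xi> (\<sigma> a))"
      unfolding F_def by (intro ldet_cong) auto
    finally show "ldet k (\<lambda>a b. Gs a (\<iota> a) (\<xi> a) (\<iota> b) (\<xi> b)) = \<dots>" .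
  qed
  also have "\<dots> = (\<Sum>\<iota>\<in>PiE {..<k} (\<lambda>_. I). \<integral>\<xi>. F (\<lambda>a\<in>{..<k}. \<iota> (\<sigma> a)) \<xi> \<partial>N)"
  proof (intro sum.cong refl)
    fix \<iota> assume "\<iota> \<in> PiE {..<k} (\<lambda>_. I)"
    then have \<iota>: "(\<lambda>a\<in>{..<k}. \<iota> (\<sigma> a)) \<in> PiE {..<k} (\<lambda>_. I)" using lt by (auto simp: PiE_def Pi_def)
    have "F (\<lambda>a\<in>{..<k}. \<iota> (\<sigma> a)) \<in> borel_measurable N"
      unfolding F_def N_def by (rule ldet_kernel_measurable[OF _ \<iota>]) (use adm lt in \<open>simp add: adm_def\<close>)
    from integral_distr[OF meas this] distr_PiM_permute[OF \<sigma>, folded N_def]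
    show "(\<integral>\<xi>. F (\<lambda>a\<in>{..<k}. \<iota> (\<sigma> a)) (\<lambda>a\<in>{..<k}. \<xi> (\<sigma> a)) \<partial>N) = (\<integral>\<xi>. F (\<lambda>a\<in>{..<k}. \<iota> (\<sigma> a)) \<xi> \<partial>N)"
      by simp
  qed
  also have "\<dots> = (\<Sum>\<iota>\<in>PiE {..<k} (\<lambda>_. I). \<integral>\<xi>. F \<iota> \<xi> \<partial>N)"
  proof (rule sum.reindex_bij_witness[where i="\<lambda>\<iota>. \<lambda>a\<in>{..<k}. \<iota> (\<rho> a)" and j="\<lambda>\<iota>. \<lambda>a\<in>{..<k}. \<iota> (\<sigma> a)"])
    fix \<iota> assume "\<iota> \<in> PiE {..<k} (\<lambda>_. I)"
    then show "(\<lambda>a\<in>{..<k}. (\<lambda>a\<in>{..<k}. \<iota> (\<sigma> a)) (\<rho> a)) = \<iota>" "(\<lambda>a\<in>{..<k}. (\<lambda>a\<in>{..<k}. \<iota> (\<rho> a)) (\<sigma> a)) = \<iota>"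
      by (auto simp: fun_eq_iff lt inv PiE_def extensional_def)
  qed (auto simp: lt PiE_def Pi_def)
  finally show ?thesis by (simp add: Phi_def F_def N_def)
qed

lemma Phi_two_kernels_card:
  assumes "adm K" "adm L" "S \<subseteq> {..<k}" "T \<subseteq> {..<k}" "card S = card T"
  shows "Phi k (\<lambda>a. if a \<in> S then L else K) = Phi k (\<lambda>a. if a \<in> T then L else K)"
proof -
  obtain \<sigma> where \<sigma>: "\<sigma> permutes {..<k}" "\<forall>a\<in>{..<k}. \<sigma> a \<in> T \<longleftrightarrow> a \<in> S"
    using permutes_carrying_subset[of "{..<k}" S T] assms(3-5) by auto
  have "Phi k (\<lambda>a. if a \<in> S then L else K) = Phi k (\<lambda>a. if \<sigma> a \<in> T then L else K)"
    using \<sigma>(2) by (intro Phi_cong_slots) simp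
  also have "\<dots> = Phi k (\<lambda>a. if a \<in> T then L else K)"
    using assms(1,2) by (intro Phi_permute[OF \<sigma>(1), where Gs="\<lambda>a. if a \<in> T then L else K"]) auto
  finally show ?thesis .
qed

text \<open>The 2^k ways of choosing a summand in each row give only k + 1 values, one for each
  cardinality. The representatives \<open>U q\<close> are left open: final segments suit the
  integration of last variables, initial segments suit its outcome.\<close>

lemma Phi_binomial:
  assumes K: "adm K" and L: "adm L" and U: "\<And>q. q \<le> k \<Longrightarrow> U q \<subseteq> {..<k} \<and> card (U q) = q"
  shows "Phi k (\<lambda>_ i x j y. L i x j y + K i x j y)
    = (\<Sum>q\<le>k. of_nat (k choose q) * Phi k (\<lambda>a. if a \<in> U q then L else K))"
proof -
  have "Phi k (\<lambda>_ i x j y. L i x j y + K i x j y)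
    = (\<Sum>\<iota>\<in>PiE {..<k} (\<lambda>_. I). \<Sum>S\<in>Pow {..<k}. \<integral>\<xi>. ldet k (\<lambda>a b.
         (if a \<in> S then L else K) (\<iota> a) (\<xi> a) (\<iota> b) (\<xi> b)) \<partial>PiM {..<k} (\<lambda>_. M))"
    unfolding Phi_def
  proof (intro sum.cong refl)
    fix \<iota> assume \<iota>: "\<iota> \<in> PiE {..<k} (\<lambda>_. I)"
    have "ldet k (\<lambda>a b. L (\<iota> a) (\<xi> a) (\<iota> b) (\<xi> b) + K (\<iota> a) (\<xi> a) (\<iota> b) (\<xi> b))
       = (\<Sum>S\<in>Pow {..<k}. ldet k (\<lambda>a b. (if a \<in> S then L else K) (\<iota> a) (\<xi> a) (\<iota> b) (\<xi> b)))" for \<xi>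
      unfolding ldet_sum_rows by (intro sum.cong refl ldet_cong) auto
    then show "(\<integral>\<xi>. ldet k (\<lambda>a b. L (\<iota> a) (\<xi> a) (\<iota> b) (\<xi> b) + K (\<iota> a) (\<xi> a) (\<iota> b) (\<xi> b)) \<partial>PiM {..<k} (\<lambda>_. M))
       = (\<Sum>S\<in>Pow {..<k}. \<integral>\<xi>. ldet k (\<lambda>a b. (if a \<in> S then L else K) (\<iota> a) (\<xi> a) (\<iota> b) (\<xi> b)) \<partial>PiM {..<k} (\<lambda>_. M))"
      using K L by (simp only:)
        (intro Bochner_Integration.integral_sum integrable_ldet_kernel[OF _ \<iota>], auto)
  qed
  also have "\<dots> = (\<Sum>S\<in>Pow {..<k}. Phi k (\<lambda>a. if a \<in> S then L else K))"
    unfolding Phi_def by (rule sum.swap)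
  also have "\<dots> = (\<Sum>q\<le>k. \<Sum>S\<in>{S \<in> Pow {..<k}. card S = q}. Phi k (\<lambda>a. if a \<in> S then L else K))"
    by (rule sum.group[symmetric]) (auto intro: card_mono[of "{..<k}", simplified])
  also have "\<dots> = (\<Sum>q\<le>k. \<Sum>S\<in>{S \<in> Pow {..<k}. card S = q}. Phi k (\<lambda>a. if a \<in> U q then L else K))"
    using U by (intro sum.cong refl Phi_two_kernels_card[OF K L]) auto
  also have "\<dots> = (\<Sum>q\<le>k. of_nat (k choose q) * Phi k (\<lambda>a. if a \<in> U q then L else K))"
    using n_subsets[of "{..<k}"] by (intro sum.cong refl) (simp add: Pow_def)
  finally show ?thesis .
qed

text \<open>Integrating out the last variable, whose column meets only the rows in \<open>T\<close>:
  each cofactor is the smaller determinant with row \<open>a\<close> replaced by the last row.\<close>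

lemma Phi_Suc_reduce:
  assumes adm: "\<And>a. a \<le> k \<Longrightarrow> adm (Gs a)" and T: "T \<subseteq> {..<k}" and Y: "Y \<subseteq> I"
    and last_row: "\<And>i x j y. i \<notin> Y \<Longrightarrow> Gs k i x j y = 0"
    and corner: "\<And>i x j y. i \<in> Y \<Longrightarrow> j \<in> Y \<Longrightarrow> Gs k i x j y = 0"
    and last_col: "\<And>a i x j y. a < k \<Longrightarrow> a \<notin> T \<Longrightarrow> j \<in> Y \<Longrightarrow> Gs a i x j y = 0"
  shows "Phi (Suc k) Gs
    = - (\<Sum>a\<in>T. Phi k (Gs(a := (\<lambda>i x j y. \<Sum>l\<in>Y. \<integral>z. Gs a i x l z * Gs k l z j y \<partial>M))))"
proof -
  define N where "N = PiM {..<k} (\<lambda>_. M)"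
  define Cp where "Cp a l = (\<lambda>i x j y. \<integral>z. Gs a i x l z * Gs k l z j y \<partial>M)" for a l
  have finY: "finite Y" and finT: "finite T" using Y T finite_index finite_subset by auto
  have adm_Cp: "adm (Cp a l)" if "a \<in> T" "l \<in> Y" for a l
    unfolding Cp_def using that adm T Y by (intro adm_kernel_product) auto
  have adm_upd: "adm ((Gs(a := Cp a l)) b)" if "a \<in> T" "l \<in> Y" "b < k" for a b l
    using adm_Cp that adm by auto
  \<comment> \<open>If the last index is outside \<open>Y\<close>, the whole last row vanishes, so
    only \<open>Y\<close> survives in the sum over that index.\<close>
  have inner: "(\<integral>z. ldet (Suc k) (\<lambda>a b. Gs a ((\<iota>(k := l)) a) ((\<xi>(k := z)) a) ((\<iota>(k := l)) b) ((\<xi>(k := z)) b)) \<partial>M)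
      = (if l \<in> Y then - (\<Sum>a\<in>T. ldet k (\<lambda>i j. (Gs(a := Cp a l)) i (\<iota> i) (\<xi> i) (\<iota> j) (\<xi> j))) else 0)"
    (is "integral\<^sup>L M ?D = _")
    if \<iota>: "\<iota> \<in> PiE {..<k} (\<lambda>_. I)" and \<xi>: "\<xi> \<in> space N" and l: "l \<in> I" for \<iota> \<xi> l
  proof (cases "l \<in> Y")
    case False
    have "?D z = 0" for z
      by (rule ldet_zero_row[of k]) (use last_row[OF False] in auto)
    then show ?thesis using False by simp
  next
    case True
    \<comment> \<open>These cofactors do not contain \<open>z\<close>; the integral over
      \<open>z\<close> acts only on the product of two kernel entries and produces
      \<open>Cp\<close>.\<close>
    define cof where "cof a b = ldet k (\<lambda>i j. if i = a then of_bool (j = b) else Gs i (\<iota> i) (\<xi> i) (\<iota> j) (\<xi> j))" for a b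
    have idx: "\<iota> b \<in> I" "\<xi> b \<in> space M" if "b < k" for b
      using \<iota> \<xi> that by (auto simp: N_def space_PiM PiE_def Pi_def)
    have "?D z = - (\<Sum>a\<in>T. \<Sum>b<k. (Gs a (\<iota> a) (\<xi> a) l z * Gs k l z (\<iota> b) (\<xi> b)) * cof a b)" for z
    proof -
      have "?D z = - (\<Sum>a<k. Gs a (\<iota> a) (\<xi> a) l z *
          ldet k (\<lambda>i j. if i = a then Gs k l z (\<iota> j) (\<xi> j) else Gs i (\<iota> i) (\<xi> i) (\<iota> j) (\<xi> j)))"
        by (subst ldet_bordered)
           (use corner[OF True True] in \<open>auto intro!: sum.cong ldet_cong arg_cong2[where f="(*)"]\<close>)
      also have "\<dots> = - (\<Sum>a\<in>T. Gs a (\<iota> a) (\<xi> a) l z *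
          ldet k (\<lambda>i j. if i = a then Gs k l z (\<iota> j) (\<xi> j) else Gs i (\<iota> i) (\<xi> i) (\<iota> j) (\<xi> j)))"
        using T last_col True by (intro arg_cong[where f=uminus] sum.mono_neutral_right) auto
      also have "\<dots> = - (\<Sum>a\<in>T. Gs a (\<iota> a) (\<xi> a) l z * (\<Sum>b<k. Gs k l z (\<iota> b) (\<xi> b) * cof a b))"
        using T unfolding cof_def
        by (intro arg_cong[where f=uminus] sum.cong refl arg_cong2[where f="(*)"] ldet_row_expand) auto
      finally show ?thesis by (simp add: sum_distrib_left mult_ac)
    qed
    then have "integral\<^sup>L M ?D = - (\<Sum>a\<in>T. \<Sum>b<k. Cp a l (\<iota> a) (\<xi> a) (\<iota> b) (\<xi> b) * cof a b)"
    proof -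
      assume D: "\<And>z. ?D z = - (\<Sum>a\<in>T. \<Sum>b<k. (Gs a (\<iota> a) (\<xi> a) l z * Gs k l z (\<iota> b) (\<xi> b)) * cof a b)"
      have int: "integrable M (\<lambda>z. Gs a (\<iota> a) (\<xi> a) l z * Gs k l z (\<iota> b) (\<xi> b))" if "a \<in> T" "b < k" for a b
        using that T adm l idx by (intro integrable_kernel_product) auto
      let ?f = "\<lambda>a b z. Gs a (\<iota> a) (\<xi> a) l z * Gs k l z (\<iota> b) (\<xi> b)"
      have "integral\<^sup>L M ?D = - (\<integral>z. (\<Sum>a\<in>T. \<Sum>b<k. ?f a b z * cof a b) \<partial>M)"
        unfolding D by (rule Bochner_Integration.integral_minus)
      also have "(\<integral>z. (\<Sum>a\<in>T. \<Sum>b<k. ?f a b z * cof a b) \<partial>M) = (\<Sum>a\<in>T. \<integral>z. (\<Sum>b<k. ?f a b z * cof a b) \<partial>M)"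
        by (intro Bochner_Integration.integral_sum Bochner_Integration.integrable_sum integrable_mult_left int) auto
      also have "\<dots> = (\<Sum>a\<in>T. \<Sum>b<k. \<integral>z. ?f a b z * cof a b \<partial>M)"
        by (intro sum.cong refl Bochner_Integration.integral_sum integrable_mult_left int) auto
      finally show ?thesis by (simp add: Cp_def)
    qed
    also have "\<dots> = - (\<Sum>a\<in>T. ldet k (\<lambda>i j. if i = a then Cp a l (\<iota> a) (\<xi> a) (\<iota> j) (\<xi> j) else Gs i (\<iota> i) (\<xi> i) (\<iota> j) (\<xi> j)))"
      using T unfolding cof_def by (intro arg_cong[where f=uminus] sum.cong refl ldet_row_expand[symmetric]) auto
    also have "\<dots> = - (\<Sum>a\<in>T. ldet k (\<lambda>i j. (Gs(a := Cp a l)) i (\<iota> i) (\<xi> i) (\<iota> j) (\<xi> j)))"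
      by (intro arg_cong[where f=uminus] sum.cong refl ldet_cong) auto
    finally show ?thesis using True by simp
  qed
  define F where "F \<iota> \<xi> = ldet (Suc k) (\<lambda>a b. Gs a (\<iota> a) (\<xi> a) (\<iota> b) (\<xi> b))" for \<iota> \<xi>
  have "Phi (Suc k) Gs = (\<Sum>\<iota>\<in>PiE (insert k {..<k}) (\<lambda>_. I). \<integral>\<xi>. F \<iota> \<xi> \<partial>PiM (insert k {..<k}) (\<lambda>_. M))"
    unfolding Phi_def F_def by (simp only: lessThan_Suc)
  also have "\<dots> = (\<Sum>(l, \<iota>)\<in>I \<times> PiE {..<k} (\<lambda>_. I). \<integral>\<xi>. F (\<iota>(k := l)) \<xi> \<partial>PiM (insert k {..<k}) (\<lambda>_. M))"
    unfolding PiE_insert_eq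
    by (subst sum.reindex[OF inj_combinator[where T="\<lambda>_. I"]]) (auto simp: case_prod_beta)
  also have "\<dots> = (\<Sum>\<iota>\<in>PiE {..<k} (\<lambda>_. I). \<Sum>l\<in>I. \<integral>\<xi>. F (\<iota>(k := l)) \<xi> \<partial>PiM (insert k {..<k}) (\<lambda>_. M))"
    by (subst sum.cartesian_product[symmetric]) (rule sum.swap)
  also have "\<dots> = (\<Sum>\<iota>\<in>PiE {..<k} (\<lambda>_. I). \<Sum>l\<in>I. \<integral>\<xi>. (if l \<in> Y then
      - (\<Sum>a\<in>T. ldet k (\<lambda>i j. (Gs(a := Cp a l)) i (\<iota> i) (\<xi> i) (\<iota> j) (\<xi> j))) else 0) \<partial>N)"
  proof (intro sum.cong refl)
    fix \<iota> l assume \<iota>: "\<iota> \<in> PiE {..<k} (\<lambda>_. I)" and l: "l \<in> I"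
    then have "\<iota>(k := l) \<in> PiE {..<Suc k} (\<lambda>_. I)" by (auto simp: PiE_def Pi_def extensional_def)
    then have "integrable (PiM {..<Suc k} (\<lambda>_. M)) (F (\<iota>(k := l)))"
      unfolding F_def using adm by (intro integrable_ldet_kernel) auto
    then have "(\<integral>\<xi>. F (\<iota>(k := l)) \<xi> \<partial>PiM (insert k {..<k}) (\<lambda>_. M)) = (\<integral>\<xi>. \<integral>z. F (\<iota>(k := l)) (\<xi>(k := z)) \<partial>M \<partial>N)"
      unfolding N_def by (intro prod.product_integral_insert) (auto simp: lessThan_Suc)
    also have "\<dots> = (\<integral>\<xi>. (if l \<in> Y then
      - (\<Sum>a\<in>T. ldet k (\<lambda>i j. (Gs(a := Cp a l)) i (\<iota> i) (\<xi> i) (\<iota> j) (\<xi> j))) else 0) \<partial>N)"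
      unfolding F_def using inner[OF \<iota> _ l] by (intro Bochner_Integration.integral_cong refl)
    finally show "(\<integral>\<xi>. F (\<iota>(k := l)) \<xi> \<partial>PiM (insert k {..<k}) (\<lambda>_. M)) = \<dots>" .
  qed
  also have "\<dots> = (\<Sum>\<iota>\<in>PiE {..<k} (\<lambda>_. I). \<Sum>l\<in>Y. \<integral>\<xi>.
      - (\<Sum>a\<in>T. ldet k (\<lambda>i j. (Gs(a := Cp a l)) i (\<iota> i) (\<xi> i) (\<iota> j) (\<xi> j))) \<partial>N)"
    using Y finite_index by (intro sum.cong refl sum.mono_neutral_cong_right) auto
  also have "\<dots> = (\<Sum>\<iota>\<in>PiE {..<k} (\<lambda>_. I). \<integral>\<xi>. - (\<Sum>a\<in>T. \<Sum>l\<in>Y.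
        ldet k (\<lambda>i j. (Gs(a := Cp a l)) i (\<iota> i) (\<xi> i) (\<iota> j) (\<xi> j))) \<partial>N)"
  proof (intro sum.cong refl)
    fix \<iota> assume \<iota>: "\<iota> \<in> PiE {..<k} (\<lambda>_. I)"
    have int: "integrable N (\<lambda>\<xi>. ldet k (\<lambda>i j. (Gs(a := Cp a l)) i (\<iota> i) (\<xi> i) (\<iota> j) (\<xi> j)))" if "a \<in> T" "l \<in> Y" for a l
      unfolding N_def by (rule integrable_ldet_kernel[OF adm_upd \<iota>]) (use that in auto)
    have "(\<integral>\<xi>. - (\<Sum>a\<in>T. \<Sum>l\<in>Y. ldet k (\<lambda>i j. (Gs(a := Cp a l)) i (\<iota> i) (\<xi> i) (\<iota> j) (\<xi> j))) \<partial>N)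
      = (\<integral>\<xi>. (\<Sum>l\<in>Y. - (\<Sum>a\<in>T. ldet k (\<lambda>i j. (Gs(a := Cp a l)) i (\<iota> i) (\<xi> i) (\<iota> j) (\<xi> j)))) \<partial>N)"
      by (subst sum.swap) (simp add: sum_negf)
    also have "\<dots> = (\<Sum>l\<in>Y. \<integral>\<xi>. - (\<Sum>a\<in>T. ldet k (\<lambda>i j. (Gs(a := Cp a l)) i (\<iota> i) (\<xi> i) (\<iota> j) (\<xi> j))) \<partial>N)"
      by (rule Bochner_Integration.integral_sum)
         (intro Bochner_Integration.integrable_minus Bochner_Integration.integrable_sum int)
    finally show "(\<Sum>l\<in>Y. \<integral>\<xi>. - (\<Sum>a\<in>T. ldet k (\<lambda>i j. (Gs(a := Cp a l)) i (\<iota> i) (\<xi> i) (\<iota> j) (\<xi> j))) \<partial>N)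
      = (\<integral>\<xi>. - (\<Sum>a\<in>T. \<Sum>l\<in>Y. ldet k (\<lambda>i j. (Gs(a := Cp a l)) i (\<iota> i) (\<xi> i) (\<iota> j) (\<xi> j))) \<partial>N)" by simp
  qed
  also have "\<dots> = (\<Sum>\<iota>\<in>PiE {..<k} (\<lambda>_. I). \<integral>\<xi>. - (\<Sum>a\<in>T.
        ldet k (\<lambda>i j. (Gs(a := (\<lambda>i x j y. \<Sum>l\<in>Y. Cp a l i x j y))) i (\<iota> i) (\<xi> i) (\<iota> j) (\<xi> j))) \<partial>N)"
  proof (intro sum.cong refl Bochner_Integration.integral_cong arg_cong[where f=uminus])
    fix \<iota> \<xi> a assume a: "a \<in> T"
    let ?A = "\<lambda>i j. Gs i (\<iota> i) (\<xi> i) (\<iota> j) (\<xi> j)"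
    \<comment> \<open>Linearity in row \<open>a\<close> lets the sum over \<open>l\<close> return
      inside the determinant.\<close>
    have ex: "ldet k (\<lambda>i j. (Gs(a := G)) i (\<iota> i) (\<xi> i) (\<iota> j) (\<xi> j))
       = (\<Sum>b<k. G (\<iota> a) (\<xi> a) (\<iota> b) (\<xi> b) * ldet k (\<lambda>i j. if i = a then of_bool (j = b) else ?A i j))" for G
    proof -
      have "ldet k (\<lambda>i j. (Gs(a := G)) i (\<iota> i) (\<xi> i) (\<iota> j) (\<xi> j))
        = ldet k (\<lambda>i j. if i = a then G (\<iota> a) (\<xi> a) (\<iota> j) (\<xi> j) else ?A i j)"
        by (intro ldet_cong) auto
      then show ?thesis using a T by (subst (asm) ldet_row_expand) auto
    qed
    show "(\<Sum>l\<in>Y. ldet k (\<lambda>i j. (Gs(a := Cp a l)) i (\<iota> i) (\<xi> i) (\<iota> j) (\<xi> j)))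
      = ldet k (\<lambda>i j. (Gs(a := (\<lambda>i x j y. \<Sum>l\<in>Y. Cp a l i x j y))) i (\<iota> i) (\<xi> i) (\<iota> j) (\<xi> j))"
      unfolding ex sum_distrib_right by (rule sum.swap)
  qed
  also have "\<dots> = (\<Sum>\<iota>\<in>PiE {..<k} (\<lambda>_. I). - (\<Sum>a\<in>T. \<integral>\<xi>.
        ldet k (\<lambda>i j. (Gs(a := (\<lambda>i x j y. \<Sum>l\<in>Y. Cp a l i x j y))) i (\<iota> i) (\<xi> i) (\<iota> j) (\<xi> j)) \<partial>N))"
  proof (intro sum.cong refl)
    fix \<iota> assume \<iota>: "\<iota> \<in> PiE {..<k} (\<lambda>_. I)"
    have "integrable N (\<lambda>\<xi>. ldet k (\<lambda>i j. (Gs(a := (\<lambda>i x j y. \<Sum>l\<in>Y. Cp a l i x j y))) i (\<iota> i) (\<xi> i) (\<iota> j) (\<xi> j)))"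
      if "a \<in> T" for a
      unfolding N_def by (rule integrable_ldet_kernel[OF _ \<iota>]) (use that adm adm_Cp finY in \<open>auto intro!: adm_sum\<close>)
    then show "(\<integral>\<xi>. - (\<Sum>a\<in>T.
        ldet k (\<lambda>i j. (Gs(a := (\<lambda>i x j y. \<Sum>l\<in>Y. Cp a l i x j y))) i (\<iota> i) (\<xi> i) (\<iota> j) (\<xi> j))) \<partial>N)
      = - (\<Sum>a\<in>T. \<integral>\<xi>.
        ldet k (\<lambda>i j. (Gs(a := (\<lambda>i x j y. \<Sum>l\<in>Y. Cp a l i x j y))) i (\<iota> i) (\<xi> i) (\<iota> j) (\<xi> j)) \<partial>N)"
      by (subst Bochner_Integration.integral_minus, subst Bochner_Integration.integral_sum) auto
  qed
  also have "\<dots> = - (\<Sum>a\<in>T. Phi k (Gs(a := (\<lambda>i x j y. \<Sum>l\<in>Y. Cp a l i x j y))))"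
    unfolding Phi_def N_def[symmetric] sum_negf by (subst sum.swap) simp
  finally show ?thesis by (simp add: Cp_def)
qed

section \<open>The elimination rule\<close>

text \<open>Integrating out an \<open>L1\<close> row joins it to one of the remaining
  \<open>K1\<close> rows, which becomes an \<open>H\<close> row, at the cost of a sign. The numbers
  of choices are p, p - 1, and so on; the resulting falling factorial is 0 when q > p.\<close>

lemma elimination_terms:
  assumes G: "adm G" and Y: "Y \<subseteq> I" and YY: "\<And>i x j y. i \<in> Y \<Longrightarrow> j \<in> Y \<Longrightarrow> G i x j y = 0"
  defines "K1 \<equiv> (\<lambda>i x j y. if i \<notin> Y then G i x j y else 0)"
    and "L1 \<equiv> (\<lambda>i x j y. if i \<in> Y then G i x j y else 0)"
    and "A \<equiv> (\<lambda>i x j y. if i \<notin> Y \<and> j \<notin> Y then G i x j y else 0)"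
  defines "H \<equiv> (\<lambda>i x j y. \<Sum>l\<in>Y. \<integral>z. K1 i x l z * L1 l z j y \<partial>M)"
  shows "Phi (p + q) (\<lambda>a. if a < p then K1 else L1)
    = (-1) ^ q * (\<Prod>s<q. of_nat (p - s)) * Phi p (\<lambda>a. if a < q then H else A)"
proof -
  have adm_K1: "adm K1" and adm_L1: "adm L1" unfolding K1_def L1_def by (rule adm_restrict[OF G])+
  have adm_H: "adm H" unfolding H_def
    using Y finite_index finite_subset by (intro adm_sum adm_kernel_product adm_K1 adm_L1) auto
  \<comment> \<open>\<open>r\<close> counts the rows already turned into \<open>H\<close>. They
    stand first, so that the last row is an \<open>L1\<close> row as long as q > 0.\<close>
  define W where "W p q r = Phi (p + q) (\<lambda>a. if a < r then H else if a < p then K1 else L1)" for p q r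
  have H_col: "H i x j y = 0" if "j \<in> Y" for i x j y
    using that YY by (simp add: H_def L1_def)
  have H_row: "H i x j y = 0" if "i \<in> Y" for i x j y
    using that by (simp add: H_def K1_def)
  have W_Suc: "W p (Suc q) r = - (of_nat (p - r) * W p q (Suc r))" if "r \<le> p" for p q r
  proof -
    let ?Gs = "\<lambda>a. if a < r then H else if a < p then K1 else L1"
    have "W p (Suc q) r = Phi (Suc (p + q)) ?Gs" by (simp add: W_def)
    also have "\<dots> = - (\<Sum>a\<in>{r..<p}. Phi (p + q)
        (?Gs(a := (\<lambda>i x j y. \<Sum>l\<in>Y. \<integral>z. ?Gs a i x l z * ?Gs (p + q) l z j y \<partial>M))))"
    proof (rule Phi_Suc_reduce[OF _ _ Y])
      show "adm (?Gs a)" for a using adm_H adm_K1 adm_L1 by simp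
      show "{r..<p} \<subseteq> {..<p + q}" by auto
      show "?Gs (p + q) i x j y = 0" if "i \<notin> Y" for i x j y
        using that \<open>r \<le> p\<close> by (simp add: L1_def)
      show "?Gs (p + q) i x j y = 0" if "i \<in> Y" "j \<in> Y" for i x j y
        using that \<open>r \<le> p\<close> YY by (simp add: L1_def)
      \<comment> \<open>Columns at \<open>Y\<close> vanish in \<open>H\<close> and in
        \<open>L1\<close> because the \<open>Y\<close> block of \<open>G\<close> is zero, so the
        last column meets only \<open>K1\<close> rows.\<close>
      show "?Gs a i x j y = 0" if "a < p + q" "a \<notin> {r..<p}" "j \<in> Y" for a i x j y
        using that H_col YY by (auto simp: L1_def)
    qed
    also have "(\<Sum>a\<in>{r..<p}. Phi (p + q)
        (?Gs(a := (\<lambda>i x j y. \<Sum>l\<in>Y. \<integral>z. ?Gs a i x l z * ?Gs (p + q) l z j y \<partial>M)))) = (\<Sum>a\<in>{r..<p}. W p q (Suc r))"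
    proof (intro sum.cong refl)
      fix a assume a: "a \<in> {r..<p}"
      have "(\<lambda>i x j y. \<Sum>l\<in>Y. \<integral>z. ?Gs a i x l z * ?Gs (p + q) l z j y \<partial>M) = H"
        using a that by (simp add: H_def)
      \<comment> \<open>The new \<open>H\<close> row arises at position \<open>a\<close>; exchanging
        it with position \<open>r\<close> restores the order of the three groups.\<close>
      moreover have "Phi (p + q) (?Gs(a := H)) = W p q (Suc r)"
      proof -
        have perm: "Transposition.transpose a r permutes {..<p + q}"
          using a that by (intro permutes_swap_id) auto
        have "Phi (p + q) (\<lambda>b. (?Gs(a := H)) (Transposition.transpose a r b)) = Phi (p + q) (?Gs(a := H))"
          by (rule Phi_permute[OF perm]) (use adm_H adm_K1 adm_L1 in simp)
        moreover have "Phi (p + q) (\<lambda>b. (?Gs(a := H)) (Transposition.transpose a r b)) = W p q (Suc r)"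
          unfolding W_def using a by (intro Phi_cong_slots) (auto simp: Transposition.transpose_def)
        ultimately show ?thesis by simp
      qed
      ultimately show "Phi (p + q)
        (?Gs(a := (\<lambda>i x j y. \<Sum>l\<in>Y. \<integral>z. ?Gs a i x l z * ?Gs (p + q) l z j y \<partial>M))) = W p q (Suc r)"
        by (simp only:)
    qed
    finally show ?thesis by simp
  qed
  have "W p q r = (-1) ^ q * (\<Prod>s<q. of_nat (p - r - s)) * W p 0 (r + q)" if "r \<le> p" for r
    using that
  proof (induction q arbitrary: r)
    case (Suc q)
    show ?case
    proof (cases "r = p")
      \<comment> \<open>No \<open>K1\<close> row is left, and both sides contain the factor p - r =
        0.\<close>
      case True
      then show ?thesis using W_Suc[of r p q] by (simp add: prod.lessThan_Suc_shift del: prod.lessThan_Suc)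
    next
      case False
      then have "W p q (Suc r) = (-1) ^ q * (\<Prod>s<q. of_nat (p - Suc r - s)) * W p 0 (Suc r + q)"
        using Suc by (intro Suc.IH) auto
      moreover have "(\<Prod>s<Suc q. of_nat (p - r - s)) = of_nat (p - r) * (\<Prod>s<q. of_nat (p - Suc r - s) :: complex)"
        by (simp add: prod.lessThan_Suc_shift del: prod.lessThan_Suc)
      ultimately show ?thesis using W_Suc[OF Suc.prems, of q] by simp
    qed
  qed simp
  from this[of 0] have "W p q 0 = (-1) ^ q * (\<Prod>s<q. of_nat (p - s)) * W p 0 q" by simp
  moreover have "W p 0 q = Phi p (\<lambda>a. if a < q then H else A)"
    unfolding W_def add_0_right
  proof (rule Phi_cong)
    fix \<iota> :: "nat \<Rightarrow> 'i" and \<xi> :: "nat \<Rightarrow> 'x"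
    let ?M = "\<lambda>Gs a b. (Gs :: nat \<Rightarrow> _) a (\<iota> a) (\<xi> a) (\<iota> b) (\<xi> b) :: complex"
    let ?Gs = "\<lambda>a. if a < q then H else if a < p then K1 else L1" and ?Gs' = "\<lambda>a. if a < q then H else A"
    show "ldet p (?M ?Gs) = ldet p (?M ?Gs')"
    \<comment> \<open>An index in \<open>Y\<close> produces a zero row on either side; without one,
      \<open>K1\<close> and \<open>A\<close> have the same entries.\<close>
    proof (cases "\<exists>b<p. \<iota> b \<in> Y")
      case True
      then obtain b where b: "b < p" "\<iota> b \<in> Y" by blast
      have "ldet p (?M ?Gs) = 0" by (rule ldet_zero_row[OF b(1)]) (use b H_row in \<open>auto simp: K1_def\<close>)
      moreover have "ldet p (?M ?Gs') = 0" by (rule ldet_zero_row[OF b(1)]) (use b H_row in \<open>auto simp: A_def\<close>)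
      ultimately show ?thesis by simp
    next
      case False
      then show ?thesis by (intro ldet_cong) (auto simp: K1_def A_def)
    qed
  qed
  ultimately show ?thesis by (simp add: W_def)
qed

theorem fredholm_elimination:
  assumes G: "adm G" and Y: "Y \<subseteq> I" and YY: "\<And>i x j y. i \<in> Y \<Longrightarrow> j \<in> Y \<Longrightarrow> G i x j y = 0"
  shows "adm (schur_kernel M Y G)"
    "\<exists>D. fredholm_term I M G sums D \<and> fredholm_term I M (schur_kernel M Y G) sums D"
proof -
  define R where "R = schur_kernel M Y G"
  define K1 where "K1 = (\<lambda>i x j y. if i \<notin> Y then G i x j y else 0)"
  define L1 where "L1 = (\<lambda>i x j y. if i \<in> Y then G i x j y else 0)"
  define A where "A = (\<lambda>i x j y. if i \<notin> Y \<and> j \<notin> Y then G i x j y else 0)"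
  define H where "H = (\<lambda>i x j y. \<Sum>l\<in>Y. \<integral>z. K1 i x l z * L1 l z j y \<partial>M)"
  have adm_K1: "adm K1" and adm_L1: "adm L1" and adm_A: "adm A"
    unfolding K1_def L1_def A_def by (rule adm_restrict[OF G])+
  have adm_H: "adm H" unfolding H_def
    using Y finite_index finite_subset by (intro adm_sum adm_kernel_product adm_K1 adm_L1) auto
  have R_eq: "R = (\<lambda>i x j y. H i x j y + A i x j y)"
  proof (intro ext)
    fix i x j y
    have "H i x j y = 0" if "i \<in> Y \<or> j \<in> Y"
      using that YY by (auto simp: H_def K1_def L1_def)
    moreover have "H i x j y = (\<Sum>l\<in>Y. \<integral>z. G i x l z * G l z j y \<partial>M)" if "i \<notin> Y"
      using that by (simp add: H_def K1_def L1_def)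
    ultimately show "R i x j y = H i x j y + A i x j y" by (auto simp: R_def schur_kernel_def A_def)
  qed
  then show "adm (schur_kernel M Y G)" using adm_add[OF adm_H adm_A] by (simp add: R_def)
  define \<Psi> where "\<Psi> p q = Phi p (\<lambda>a. if a < q then H else A)" for p q
  \<comment> \<open>The coefficient is binomial(p, q) / p! up to sign. On the other side, at degree
    m = p + q, binomial(m, q) / m! times (m - q)! / (m - 2 q)! equals 1 / (q! (m - 2 q)!), which is
    the same number.\<close>
  define t where "t p q = (if q \<le> p then (-1) ^ p / (fact q * fact (p - q)) * \<Psi> p q else 0)" for p q
  have term_R: "fredholm_term I M R p = (\<Sum>q\<le>p. t p q)" for p
  proof -
    have "Phi p (\<lambda>_. R) = (\<Sum>q\<le>p. of_nat (p choose q) * Phi p (\<lambda>a. if a \<in> {..<q} then H else A))"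
      unfolding R_eq by (rule Phi_binomial[OF adm_A adm_H]) auto
    then have "fredholm_term I M R p = (\<Sum>q\<le>p. (-1) ^ p / fact p * (of_nat (p choose q) * \<Psi> p q))"
      by (simp add: fredholm_term_eq_Phi \<Psi>_def sum_distrib_left)
    also have "\<dots> = (\<Sum>q\<le>p. t p q)"
      by (intro sum.cong refl) (simp add: t_def binomial_fact field_simps)
    finally show ?thesis .
  qed
  have term_G: "fredholm_term I M G m = (\<Sum>q\<le>m. t (m - q) q)" for m
  proof -
    have "G = (\<lambda>i x j y. L1 i x j y + K1 i x j y)" by (auto simp: K1_def L1_def fun_eq_iff)
    then have "Phi m (\<lambda>_. G) = Phi m (\<lambda>_ i x j y. L1 i x j y + K1 i x j y)" by simp
    \<comment> \<open>Final segments put the \<open>L1\<close> rows last, where they are integrated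
      out.\<close>
    also have "\<dots> = (\<Sum>q\<le>m. of_nat (m choose q) * Phi m (\<lambda>a. if a \<in> {m - q..<m} then L1 else K1))"
      by (rule Phi_binomial[OF adm_K1 adm_L1]) auto
    also have "\<dots> = (\<Sum>q\<le>m. of_nat (m choose q) * ((-1) ^ q * (\<Prod>s<q. of_nat (m - q - s)) * \<Psi> (m - q) q))"
    proof (intro sum.cong refl arg_cong2[where f="(*)"])
      fix q assume "q \<in> {..m}"
      then have "Phi m (\<lambda>a. if a \<in> {m - q..<m} then L1 else K1)
          = Phi (m - q + q) (\<lambda>a. if a < m - q then K1 else L1)"
        by simp (intro Phi_cong_slots, auto)
      also have "\<dots> = (-1) ^ q * (\<Prod>s<q. of_nat (m - q - s)) * \<Psi> (m - q) q"
        unfolding K1_def L1_def \<Psi>_def H_def A_def by (rule elimination_terms[OF G Y YY])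
      finally show "Phi m (\<lambda>a. if a \<in> {m - q..<m} then L1 else K1) = \<dots>" .
    qed
    finally have "fredholm_term I M G m = (\<Sum>q\<le>m. (-1) ^ m / fact m *
        (of_nat (m choose q) * ((-1) ^ q * (\<Prod>s<q. of_nat (m - q - s)) * \<Psi> (m - q) q)))"
      by (simp add: fredholm_term_eq_Phi sum_distrib_left)
    also have "\<dots> = (\<Sum>q\<le>m. t (m - q) q)"
    proof (intro sum.cong refl)
      fix q assume q: "q \<in> {..m}"
      show "(-1) ^ m / fact m * (of_nat (m choose q) * ((-1) ^ q * (\<Prod>s<q. of_nat (m - q - s)) * \<Psi> (m - q) q))
        = t (m - q) q"
      proof (cases "q \<le> m - q")
        case True
        have sign: "(-1) ^ m * (-1) ^ q = ((-1) ^ (m - q) :: complex)"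
        proof -
          have "m = (m - q) + q" using q by simp
          then have "(-1) ^ m = ((-1) ^ (m - q) * (-1) ^ q :: complex)" by (metis power_add)
          then show ?thesis by (simp add: mult.assoc)
        qed
        have "(-1) ^ m / fact m * (of_nat (m choose q) * ((-1) ^ q * (\<Prod>s<q. of_nat (m - q - s)) * \<Psi> (m - q) q))
          = ((-1) ^ m * (-1) ^ q) * (of_nat (m choose q) / fact m * (fact (m - q) / fact (m - q - q))) * \<Psi> (m - q) q"
          unfolding prod_falling[OF True] by (simp add: mult_ac)
        also have "of_nat (m choose q) / fact m * (fact (m - q) / fact (m - q - q))
          = (1 / (fact q * fact (m - q - q)) :: complex)"
          using q by (simp add: binomial_fact field_simps)
        finally show ?thesis using True by (simp add: sign t_def)
      next
        \<comment> \<open>Here there are more \<open>L1\<close> rows than \<open>K1\<close> rows to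
          join them to: the falling factorial has the factor 0 at s = m - q.\<close>
        case False
        then have "(\<Prod>s<q. of_nat (m - q - s)) = (0::complex)"
          by (intro prod_zero) (auto intro!: bexI[of _ "m - q"])
        then show ?thesis using False by (simp add: t_def)
      qed
    qed
    finally show ?thesis .
  qed
  obtain C where C: "0 \<le> C" "bdd_kernel C H" "bdd_kernel C A"
    using adm_common_bound[of "{H, A}"] adm_H adm_A by auto
  define E where "E = C * (\<Sum>i\<in>I. \<integral>x. h i x \<partial>M)"
  have E: "0 \<le> E" unfolding E_def using C(1) h_nonneg
    by (intro mult_nonneg_nonneg sum_nonneg integral_nonneg_AE) auto
  have "\<exists>D. (\<lambda>p. \<Sum>q\<le>p. t p q) sums D \<and> (\<lambda>m. \<Sum>q\<le>m. t (m - q) q) sums D"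
  proof (rule regroup_double_series)
    show "t p q = 0" if "p < q" for p q using that by (simp add: t_def)
    show "cmod (t p q) \<le> real (p choose q) * (E ^ p * sqrt (real p ^ p) / fact p)" if "q \<le> p" for p q
    proof -
      have "cmod (\<Psi> p q) \<le> sqrt (real p ^ p) * E ^ p"
        unfolding \<Psi>_def E_def using C adm_H adm_A by (intro Phi_bound) auto
      then have "cmod (t p q) \<le> 1 / (fact q * fact (p - q)) * (sqrt (real p ^ p) * E ^ p)"
        using that by (simp add: t_def norm_mult norm_divide norm_power divide_right_mono)
      also have "\<dots> = real (p choose q) * (E ^ p * sqrt (real p ^ p) / fact p)"
        using that by (simp add: binomial_fact field_simps)
      finally show ?thesis .
    qed
    \<comment> \<open>The factor 2^p from the binomial sums merely replaces \<open>E\<close> by 2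
      E.\<close>
    show "summable (\<lambda>p. 2 ^ p * (E ^ p * sqrt (real p ^ p) / fact p))"
      using summable_hadamard_series[of "2 * E"] E by (simp add: power_mult_distrib mult.assoc)
  qed
  then show "\<exists>D. fredholm_term I M G sums D \<and> fredholm_term I M (schur_kernel M Y G) sums D"
    unfolding R_def[symmetric] term_R[abs_def] term_G[abs_def] by blast
qed

end

section \<open>Index sets, one-sided cut-offs and coinciding coordinates\<close>

text \<open>A single zero row kills the determinant, so an index outside \<open>J\<close> never
  contributes, whatever its column contains. This removes the padding of
  \<open>schur_kernel\<close>.\<close>

lemma fredholm_term_restrict_index:
  assumes I: "finite I" and J: "J \<subseteq> I" and row: "\<And>i x j y. i \<in> I - J \<Longrightarrow> G i x j y = 0"
  shows "fredholm_term I M G k = fredholm_term J M G k"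
proof -
  have "(\<Sum>\<iota>\<in>PiE {..<k} (\<lambda>_. I). \<integral>\<xi>. ldet k (\<lambda>a b. G (\<iota> a) (\<xi> a) (\<iota> b) (\<xi> b)) \<partial>PiM {..<k} (\<lambda>_. M))
    = (\<Sum>\<iota>\<in>PiE {..<k} (\<lambda>_. J). \<integral>\<xi>. ldet k (\<lambda>a b. G (\<iota> a) (\<xi> a) (\<iota> b) (\<xi> b)) \<partial>PiM {..<k} (\<lambda>_. M))"
  proof (rule sum.mono_neutral_right)
    show "finite (PiE {..<k} (\<lambda>_. I))" using I by (intro finite_PiE) auto
    show "PiE {..<k} (\<lambda>_. J) \<subseteq> PiE {..<k} (\<lambda>_. I)" using J by (intro PiE_mono) auto
    show "\<forall>\<iota>\<in>PiE {..<k} (\<lambda>_. I) - PiE {..<k} (\<lambda>_. J).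
      (\<integral>\<xi>. ldet k (\<lambda>a b. G (\<iota> a) (\<xi> a) (\<iota> b) (\<xi> b)) \<partial>PiM {..<k} (\<lambda>_. M)) = 0"
    proof
      fix \<iota> assume "\<iota> \<in> PiE {..<k} (\<lambda>_. I) - PiE {..<k} (\<lambda>_. J)"
      then obtain a where a: "a < k" "\<iota> a \<in> I - J" by (auto simp: PiE_def Pi_def)
      have "ldet k (\<lambda>a b. G (\<iota> a) (\<xi> a) (\<iota> b) (\<xi> b)) = 0" for \<xi>
        by (rule ldet_zero_row[OF a(1)]) (use row[OF a(2)] in auto)
      then show "(\<integral>\<xi>. ldet k (\<lambda>a b. G (\<iota> a) (\<xi> a) (\<iota> b) (\<xi> b)) \<partial>PiM {..<k} (\<lambda>_. M)) = 0" by simp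
    qed
  qed
  then show ?thesis by (simp add: fredholm_term_def)
qed

lemma fredholm_term_cong:
  assumes "\<And>i x j y. i \<in> I \<Longrightarrow> j \<in> I \<Longrightarrow> G i x j y = H i x j y"
  shows "fredholm_term I M G k = fredholm_term I M H k"
proof -
  have "ldet k (\<lambda>a b. G (\<iota> a) (\<xi> a) (\<iota> b) (\<xi> b)) = ldet k (\<lambda>a b. H (\<iota> a) (\<xi> a) (\<iota> b) (\<xi> b))"
    if "\<iota> \<in> PiE {..<k} (\<lambda>_. I)" for \<iota> \<xi>
    using that assms by (intro ldet_cong) (auto simp: PiE_def Pi_def)
  then show ?thesis by (simp add: fredholm_term_def cong: sum.cong)
qed

text \<open>A coordinate outside its set already has a zero row by the left indicator; otherwise all
  right indicators are 1. Elimination produces the two-sided cut-off, the theorem has the left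
  one.\<close>

lemma fredholm_term_indicator_column:
  "fredholm_term I M (\<lambda>i x j y. indicator (J i) x * P i x j y * indicator (J j) y) k
   = fredholm_term I M (\<lambda>i x j y. indicator (J i) x * P i x j y) k"
proof -
  have "ldet k (\<lambda>a b. indicator (J (\<iota> a)) (\<xi> a) * P (\<iota> a) (\<xi> a) (\<iota> b) (\<xi> b) * indicator (J (\<iota> b)) (\<xi> b))
      = ldet k (\<lambda>a b. indicator (J (\<iota> a)) (\<xi> a) * P (\<iota> a) (\<xi> a) (\<iota> b) (\<xi> b))" for \<iota> \<xi>
  proof (cases "\<exists>b<k. \<xi> b \<notin> J (\<iota> b)")
    case True
    then obtain b where b: "b < k" "\<xi> b \<notin> J (\<iota> b)" by blast
    show ?thesis using b by (subst (1 2) ldet_zero_row[OF b(1)]) simp_all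
  next
    case False
    then show ?thesis by (intro ldet_cong) auto
  qed
  then show ?thesis by (simp only: fredholm_term_def)
qed

lemma fredholm_term_reindex:
  assumes f: "bij_betw f J I"
  shows "fredholm_term I M G k = fredholm_term J M (\<lambda>i x j y. G (f i) x (f j) y) k"
proof -
  define g where "g = the_inv_into J f"
  have g: "g (f i) = i" if "i \<in> J" for i
    using that f by (simp add: g_def the_inv_into_f_f bij_betw_def)
  have g': "f (g i) = i" "g i \<in> J" if "i \<in> I" for i
    using that f by (auto simp: g_def f_the_inv_into_f_bij_betw bij_betw_def intro!: the_inv_into_into)
  have fI: "f i \<in> I" if "i \<in> J" for i using that f by (auto simp: bij_betw_def)
  have "(\<Sum>\<iota>\<in>PiE {..<k} (\<lambda>_. I). \<integral>\<xi>. ldet k (\<lambda>a b. G (\<iota> a) (\<xi> a) (\<iota> b) (\<xi> b)) \<partial>PiM {..<k} (\<lambda>_. M))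
    = (\<Sum>\<iota>\<in>PiE {..<k} (\<lambda>_. J). \<integral>\<xi>. ldet k (\<lambda>a b. G (f (\<iota> a)) (\<xi> a) (f (\<iota> b)) (\<xi> b)) \<partial>PiM {..<k} (\<lambda>_. M))"
  proof (rule sum.reindex_bij_witness[where i="\<lambda>\<iota>. \<lambda>a\<in>{..<k}. f (\<iota> a)" and j="\<lambda>\<iota>. \<lambda>a\<in>{..<k}. g (\<iota> a)"])
    fix \<iota> assume \<iota>: "\<iota> \<in> PiE {..<k} (\<lambda>_. I)"
    then have \<iota>I: "\<iota> a \<in> I" if "a < k" for a using that by auto
    show "(\<lambda>a\<in>{..<k}. f ((\<lambda>a\<in>{..<k}. g (\<iota> a)) a)) = \<iota>"
      using \<iota> \<iota>I g' by (auto simp: fun_eq_iff PiE_def extensional_def)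
    show "(\<lambda>a\<in>{..<k}. g (\<iota> a)) \<in> PiE {..<k} (\<lambda>_. J)" using \<iota>I g' by auto
    show "(\<integral>\<xi>. ldet k (\<lambda>a b. G (f ((\<lambda>a\<in>{..<k}. g (\<iota> a)) a)) (\<xi> a) (f ((\<lambda>a\<in>{..<k}. g (\<iota> a)) b)) (\<xi> b)) \<partial>PiM {..<k} (\<lambda>_. M))
      = (\<integral>\<xi>. ldet k (\<lambda>a b. G (\<iota> a) (\<xi> a) (\<iota> b) (\<xi> b)) \<partial>PiM {..<k} (\<lambda>_. M))"
      using \<iota>I g' by (intro Bochner_Integration.integral_cong refl ldet_cong) auto
  next
    fix \<iota> assume \<iota>: "\<iota> \<in> PiE {..<k} (\<lambda>_. J)"
    then have \<iota>J: "\<iota> a \<in> J" if "a < k" for a using that by auto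
    show "(\<lambda>a\<in>{..<k}. g ((\<lambda>a\<in>{..<k}. f (\<iota> a)) a)) = \<iota>"
      using \<iota> \<iota>J g by (auto simp: fun_eq_iff PiE_def extensional_def)
    show "(\<lambda>a\<in>{..<k}. f (\<iota> a)) \<in> PiE {..<k} (\<lambda>_. I)" using \<iota>J fI by auto
  qed
  then show ?thesis by (simp add: fredholm_term_def)
qed

text \<open>With the other coordinates fixed, coordinate \<open>a\<close> has to hit one point,
  which is null. Kernels may thus be changed where two different coordinates agree.\<close>

lemma AE_PiM_coordinates_distinct:
  fixes k :: nat
  shows "AE \<xi> in PiM {..<k} (\<lambda>_. lborel :: real measure). \<forall>a<k. \<forall>b<k. a \<noteq> b \<longrightarrow> \<xi> a \<noteq> \<xi> b"
proof -
  interpret product_sigma_finite "\<lambda>_::nat. lborel :: real measure" ..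
  let ?N = "PiM {..<k} (\<lambda>_. lborel :: real measure)"
  have "AE \<xi> in ?N. \<xi> a \<noteq> \<xi> b" if ab: "a < k" "b < k" "a \<noteq> b" for a b
  proof -
    have ins: "insert a ({..<k} - {a}) = {..<k}" using ab by auto
    have [measurable]: "(\<lambda>\<xi>. \<xi> a) \<in> borel_measurable ?N" "(\<lambda>\<xi>. \<xi> b) \<in> borel_measurable ?N"
      using measurable_component_singleton[of a "{..<k}" "\<lambda>_. lborel :: real measure"]
        measurable_component_singleton[of b "{..<k}" "\<lambda>_. lborel :: real measure"] ab by auto
    have "(\<lambda>\<xi>. if \<xi> a = \<xi> b then 1 else 0 :: ennreal) \<in> borel_measurable ?N" by measurable
    also have "(\<lambda>\<xi>. if \<xi> a = \<xi> b then 1 else 0 :: ennreal) = indicator {\<xi>. \<xi> a = \<xi> b}"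
      by (auto simp: fun_eq_iff indicator_def)
    finally have "(indicator {\<xi>. \<xi> a = \<xi> b} :: _ \<Rightarrow> ennreal) \<in> borel_measurable ?N" .
    then have m: "(indicator {\<xi>. \<xi> a = \<xi> b} :: _ \<Rightarrow> ennreal)
        \<in> borel_measurable (PiM (insert a ({..<k} - {a})) (\<lambda>_. lborel :: real measure))"
      unfolding ins .
    have "(\<integral>\<^sup>+\<xi>. indicator {\<xi>. \<xi> a = \<xi> b} \<xi> \<partial>?N)
      = (\<integral>\<^sup>+\<xi>. (\<integral>\<^sup>+x. indicator {\<xi>. \<xi> a = \<xi> b} (\<xi>(a := x)) \<partial>lborel) \<partial>PiM ({..<k} - {a}) (\<lambda>_. lborel :: real measure))"
      using product_nn_integral_insert[OF _ _ m] unfolding ins by simp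
    also have "\<dots> = (\<integral>\<^sup>+\<xi>. 0 \<partial>PiM ({..<k} - {a}) (\<lambda>_. lborel :: real measure))"
    proof (intro nn_integral_cong)
      fix \<xi> :: "nat \<Rightarrow> real"
      have "(\<integral>\<^sup>+x. indicator {\<xi>. \<xi> a = \<xi> b} (\<xi>(a := x)) \<partial>lborel) = (\<integral>\<^sup>+x. indicator {\<xi> b} x \<partial>lborel)"
        using ab by (intro nn_integral_cong) (auto simp: indicator_def)
      then show "(\<integral>\<^sup>+x. indicator {\<xi>. \<xi> a = \<xi> b} (\<xi>(a := x)) \<partial>lborel) = 0" by simp
    qed
    finally have "(\<integral>\<^sup>+\<xi>. indicator {\<xi>. \<xi> a = \<xi> b} \<xi> \<partial>?N) = 0" by simp
    then have "AE \<xi> in ?N. (indicator {\<xi>. \<xi> a = \<xi> b} \<xi> :: ennreal) = 0"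
      using m unfolding ins by (subst (asm) nn_integral_0_iff_AE) auto
    then show ?thesis by (auto simp: indicator_def)
  qed
  then show ?thesis
    by (auto simp: AE_all_countable intro!: AE_impI)
qed

section \<open>Decay of the phase and Gaussian integrals\<close>

lemma cis_3pi4: "cis (3 * pi / 4) = Complex (- (sqrt 2 / 2)) (sqrt 2 / 2)"
  "cis (- 3 * pi / 4) = Complex (- (sqrt 2 / 2)) (- (sqrt 2 / 2))"
proof -
  have "cos (3 * pi / 4) = - (sqrt 2 / 2)" "sin (3 * pi / 4) = sqrt 2 / 2"
    using cos_pi_minus[of "pi / 4"] sin_pi_minus[of "pi / 4"]
    by (simp_all add: cos_45 sin_45 field_simps)
  then show "cis (3 * pi / 4) = Complex (- (sqrt 2 / 2)) (sqrt 2 / 2)"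
    "cis (- 3 * pi / 4) = Complex (- (sqrt 2 / 2)) (- (sqrt 2 / 2))"
    by (simp_all add: complex_eq_iff)
qed

lemma cis_pi4: "cis (pi / 4) = Complex (sqrt 2 / 2) (sqrt 2 / 2)"
  "cis (- pi / 4) = Complex (sqrt 2 / 2) (- (sqrt 2 / 2))"
  by (simp_all add: complex_eq_iff cos_45 sin_45)

lemma cpt_0: "cpt c 0 s = \<i> * of_real s"
  by (simp add: cpt_def)

lemma cpt_gamma:
  "cpt c 1 s = Complex (- (c + \<bar>s\<bar> * (sqrt 2 / 2))) (- s * (sqrt 2 / 2))"
  "cpt c 2 s = Complex (c + \<bar>s\<bar> * (sqrt 2 / 2)) (- s * (sqrt 2 / 2))"
  unfolding cpt_def bray_def cis_3pi4 cis_pi4 by (auto simp: complex_eq_iff algebra_simps)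

lemma cpt_gamma_coords:
  assumes "r \<in> {1, 2}"
  shows "(Re (cpt c r s))\<^sup>2 = (c + \<bar>s\<bar> * (sqrt 2 / 2))\<^sup>2" "(Im (cpt c r s))\<^sup>2 = s\<^sup>2 / 2"
proof -
  have "r = 1 \<or> r = 2" using assms by auto
  then show "(Re (cpt c r s))\<^sup>2 = (c + \<bar>s\<bar> * (sqrt 2 / 2))\<^sup>2" "(Im (cpt c r s))\<^sup>2 = s\<^sup>2 / 2"
    by (elim disjE; simp only: cpt_gamma complex.sel power2_minus; simp add: power_mult_distrib power_divide)+
qed

lemma cpt_gamma_Re:
  assumes "r \<in> {1, 2}" "0 < c"
  shows "c \<le> \<bar>Re (cpt c r s)\<bar>" "cmod (cpt c r s) \<le> c + \<bar>s\<bar> * sqrt 2"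
proof -
  have "r = 1 \<or> r = 2" using assms by auto
  then have "\<bar>Re (cpt c r s)\<bar> = \<bar>c + \<bar>s\<bar> * (sqrt 2 / 2)\<bar>" "\<bar>Im (cpt c r s)\<bar> = \<bar>s * (sqrt 2 / 2)\<bar>"
    by (elim disjE; simp only: cpt_gamma complex.sel abs_minus_cancel mult_minus_left)+
  moreover have "\<bar>c + \<bar>s\<bar> * (sqrt 2 / 2)\<bar> = c + \<bar>s\<bar> * (sqrt 2 / 2)" using assms by (intro abs_of_nonneg) simp
  ultimately have Re: "\<bar>Re (cpt c r s)\<bar> = c + \<bar>s\<bar> * (sqrt 2 / 2)" and Im: "\<bar>Im (cpt c r s)\<bar> = \<bar>s\<bar> * (sqrt 2 / 2)"
    by (simp_all add: abs_mult)
  show "c \<le> \<bar>Re (cpt c r s)\<bar>" unfolding Re by simp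
  show "cmod (cpt c r s) \<le> c + \<bar>s\<bar> * sqrt 2"
    using cmod_le[of "cpt c r s"] unfolding Re Im by simp
qed

lemma Re_Theta:
  "Re (Theta \<tau> i 0 z) = (((Re z)\<^sup>2 - (Im z)\<^sup>2)\<^sup>2 - 4 * (Re z)\<^sup>2 * (Im z)\<^sup>2) / 4
     - \<tau> i / 2 * ((Re z)\<^sup>2 - (Im z)\<^sup>2)"
proof -
  have z2: "z\<^sup>2 = Complex ((Re z)\<^sup>2 - (Im z)\<^sup>2) (2 * Re z * Im z)"
    by (simp add: complex_eq_iff power2_eq_square)
  have "z ^ 4 = (z\<^sup>2)\<^sup>2" by simp
  then have "Re (z ^ 4) = ((Re z)\<^sup>2 - (Im z)\<^sup>2)\<^sup>2 - 4 * (Re z)\<^sup>2 * (Im z)\<^sup>2"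
    by (simp only: z2) (simp add: power2_eq_square)
  then show ?thesis by (simp add: Theta_def z2)
qed

text \<open>On the rays the modulus of the imaginary part is u = |s| / sqrt 2 and that of the real
  part is c + u, so the difference of their squares is only linear in u. The quartic term of the
  phase is then - u^4, which beats the linear growth and leaves room for s^2.\<close>

lemma Theta_decay_gamma:
  assumes "0 < c" "0 \<le> R"
  shows "\<exists>K. \<forall>r\<in>{1, 2}. \<forall>s. Re (Theta \<tau> i 0 (cpt c r s)) / 2 + R * cmod (cpt c r s) \<le> K - s\<^sup>2"
proof -
  \<comment> \<open>\<open>B\<close> collects all coefficients linear in u and \<open>D\<close> all
    constants, after the phase has been halved.\<close>
  define B where "B = c ^ 3 / 2 + \<bar>\<tau> i\<bar> * c / 2 + 2 * R"
  define D where "D = c ^ 4 / 8 + \<bar>\<tau> i\<bar> * c\<^sup>2 / 4 + R * c"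
  have "Re (Theta \<tau> i 0 (cpt c r s)) / 2 + R * cmod (cpt c r s) \<le> (25 / 8 + B\<^sup>2 / 2 + D) - s\<^sup>2"
    if r: "r \<in> {1, 2}" for r s
  proof -
    define u where "u = \<bar>s\<bar> * (sqrt 2 / 2)"
    have u: "0 \<le> u" "s\<^sup>2 = 2 * u\<^sup>2" by (auto simp: u_def power_mult_distrib power_divide)
    have Im: "(Im (cpt c r s))\<^sup>2 = u\<^sup>2" using cpt_gamma_coords(2)[OF r, of c s] u(2) by simp
    have "Re (Theta \<tau> i 0 (cpt c r s)) = (((c + u)\<^sup>2 - u\<^sup>2)\<^sup>2 - 4 * (c + u)\<^sup>2 * u\<^sup>2) / 4 - \<tau> i / 2 * ((c + u)\<^sup>2 - u\<^sup>2)"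
      unfolding Re_Theta cpt_gamma_coords(1)[OF r] Im u_def by simp
    also have "\<dots> = c ^ 4 / 4 + c ^ 3 * u - 2 * c * u ^ 3 - u ^ 4 - \<tau> i / 2 * (c\<^sup>2 + 2 * c * u)"
      by (simp add: field_simps power2_eq_square power3_eq_cube power4_eq_xxxx)
    also have "\<dots> \<le> c ^ 4 / 4 + c ^ 3 * u - u ^ 4 + \<bar>\<tau> i\<bar> / 2 * (c\<^sup>2 + 2 * c * u)"
    proof -
      have "0 \<le> 2 * c * u ^ 3" using u assms by simp
      moreover have "- (\<tau> i / 2 * (c\<^sup>2 + 2 * c * u)) \<le> \<bar>\<tau> i\<bar> / 2 * (c\<^sup>2 + 2 * c * u)"
        unfolding minus_mult_left using u assms by (intro mult_right_mono) auto
      ultimately show ?thesis by simp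
    qed
    finally have T: "Re (Theta \<tau> i 0 (cpt c r s)) \<le> \<dots>" .
    have "cmod (cpt c r s) \<le> c + 2 * u"
      using cpt_gamma_Re(2)[OF r assms(1), of s] by (simp add: u_def)
    then have "R * cmod (cpt c r s) \<le> R * (c + 2 * u)" using assms by (intro mult_left_mono) auto
    then have "Re (Theta \<tau> i 0 (cpt c r s)) / 2 + R * cmod (cpt c r s) + s\<^sup>2
        \<le> (c ^ 4 / 4 + c ^ 3 * u - u ^ 4 + \<bar>\<tau> i\<bar> / 2 * (c\<^sup>2 + 2 * c * u)) / 2 + R * (c + 2 * u) + 2 * u\<^sup>2"
      unfolding u(2) by (intro add_mono divide_right_mono T order_refl) auto
    also have "\<dots> = - (u\<^sup>2)\<^sup>2 / 2 + 2 * u\<^sup>2 + B * u + D"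
      by (simp add: B_def D_def field_simps)
    also have "\<dots> \<le> 25 / 8 + B\<^sup>2 / 2 + D"
    proof -
      \<comment> \<open>B u \<le> (B^2 + u^2) / 2 leaves - u^4 / 2 + 5 u^2 / 2, whose maximum is
        25/8, attained at u^2 = 5/2.\<close>
      have "0 \<le> (u\<^sup>2 - 5 / 2)\<^sup>2" "0 \<le> (B - u)\<^sup>2" by simp_all
      moreover have "(u\<^sup>2 - 5 / 2)\<^sup>2 = (u\<^sup>2)\<^sup>2 - 5 * u\<^sup>2 + 25 / 4" "(B - u)\<^sup>2 = B\<^sup>2 - 2 * (B * u) + u\<^sup>2"
        by (simp_all add: power2_eq_square field_simps)
      ultimately show ?thesis by linarith
    qed
    finally show ?thesis by simp
  qed
  then show ?thesis by blast
qed

text \<open>On the imaginary axis the phase is s^4 / 4 + \<tau> s^2 / 2; the constant comes from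
  completing the square in s^2.\<close>

lemma Theta_decay_iR:
  "\<exists>K. \<forall>s. - Re (Theta \<tau> j 0 (cpt c 0 s)) \<le> K - s\<^sup>2"
proof -
  have "- Re (Theta \<tau> j 0 (cpt c 0 s)) \<le> (1 - \<tau> j / 2)\<^sup>2 - s\<^sup>2" for s
  proof -
    have "- Re (Theta \<tau> j 0 (cpt c 0 s)) = - (s\<^sup>2)\<^sup>2 / 4 - \<tau> j / 2 * s\<^sup>2"
      unfolding Re_Theta by (simp add: cpt_0)
    moreover have "(1 - \<tau> j / 2)\<^sup>2 - s\<^sup>2 - (- (s\<^sup>2)\<^sup>2 / 4 - \<tau> j / 2 * s\<^sup>2) = (s\<^sup>2 / 2 - (1 - \<tau> j / 2))\<^sup>2"
      by (simp add: power2_eq_square field_simps)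
    ultimately show ?thesis using zero_le_power2[of "s\<^sup>2 / 2 - (1 - \<tau> j / 2)"] by linarith
  qed
  then show ?thesis by blast
qed

lemma integrable_gaussian:
  assumes "0 < \<alpha>"
  shows "integrable lborel (\<lambda>x::real. exp (- \<alpha> * x\<^sup>2))"
proof -
  define \<sigma> where "\<sigma> = 1 / sqrt (2 * \<alpha>)"
  have \<sigma>: "0 < \<sigma>" "2 * \<sigma>\<^sup>2 = 1 / \<alpha>" using assms by (simp_all add: \<sigma>_def power_divide)
  have "integrable lborel (\<lambda>x. sqrt (2 * pi * \<sigma>\<^sup>2) * normal_density 0 \<sigma> x)"
    using integrable_normal_density[OF \<sigma>(1)] by simp
  also have "(\<lambda>x. sqrt (2 * pi * \<sigma>\<^sup>2) * normal_density 0 \<sigma> x) = (\<lambda>x. exp (- \<alpha> * x\<^sup>2))"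
    using \<sigma> assms by (simp add: normal_density_def fun_eq_iff)
  finally show ?thesis .
qed

text \<open>Rescaling by 1 / sqrt T reduces this to the characteristic function of the standard
  normal law.\<close>

lemma gaussian_fourier:
  assumes "0 < T"
  shows "(\<integral>t. exp (\<i> * of_real (w * t) - of_real (T * t\<^sup>2 / 2)) \<partial>lborel)
    = complex_of_real (sqrt (2 * pi / T) * exp (- w\<^sup>2 / (2 * T)))"
proof -
  define \<sigma> where "\<sigma> = 1 / sqrt T"
  have \<sigma>: "0 < \<sigma>" "\<sigma>\<^sup>2 = 1 / T" using assms by (simp_all add: \<sigma>_def power_divide)
  have "(\<integral>t. exp (\<i> * of_real (w * t) - of_real (T * t\<^sup>2 / 2)) \<partial>lborel)
     = \<sigma> *\<^sub>R (\<integral>t. exp (\<i> * of_real (w * (\<sigma> * t)) - of_real (T * (\<sigma> * t)\<^sup>2 / 2)) \<partial>lborel)"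
    using lborel_integral_real_affine[of \<sigma> "\<lambda>t. exp (\<i> * of_real (w * t) - of_real (T * t\<^sup>2 / 2))" 0] \<sigma>(1) by simp
  also have "(\<integral>t. exp (\<i> * of_real (w * (\<sigma> * t)) - of_real (T * (\<sigma> * t)\<^sup>2 / 2)) \<partial>lborel)
     = (\<integral>t. sqrt (2 * pi) *\<^sub>R (std_normal_density t *\<^sub>R iexp ((w * \<sigma>) * t)) \<partial>lborel)"
  proof (rule Bochner_Integration.integral_cong[OF refl])
    fix t :: real
    have "T * (\<sigma> * t)\<^sup>2 / 2 = t\<^sup>2 / 2" using \<sigma>(2) assms by (simp add: power_mult_distrib)
    then have "exp (\<i> * of_real (w * (\<sigma> * t)) - of_real (T * (\<sigma> * t)\<^sup>2 / 2))
      = iexp ((w * \<sigma>) * t) * of_real (exp (- (t\<^sup>2 / 2)))"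
      by (simp only: exp_diff exp_minus mult.assoc divide_inverse of_real_inverse exp_of_real)
    then show "exp (\<i> * of_real (w * (\<sigma> * t)) - of_real (T * (\<sigma> * t)\<^sup>2 / 2))
      = sqrt (2 * pi) *\<^sub>R (std_normal_density t *\<^sub>R iexp ((w * \<sigma>) * t))"
      by (simp add: normal_density_def scaleR_conv_of_real mult_ac)
  qed
  also have "\<dots> = sqrt (2 * pi) *\<^sub>R char std_normal_distribution (w * \<sigma>)"
    by (simp add: char_def integral_density del: scaleR_scaleR)
  also have "char std_normal_distribution (w * \<sigma>) = of_real (exp (- w\<^sup>2 / (2 * T)))"
    unfolding char_std_normal_distribution using \<sigma>(2) by (simp add: power_mult_distrib)
  finally show ?thesis
    using assms by (simp add: \<sigma>_def scaleR_conv_of_real real_sqrt_divide)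
qed

section \<open>Block vectors and exponential integrals\<close>

lemma increasing_on_interval:
  fixes f :: "nat \<Rightarrow> real"
  assumes "\<forall>s\<in>{1..<N}. f s < f (s + 1)" "1 \<le> s" "s < s'" "s' \<le> N"
  shows "f s < f s'"
  using assms(3,4)
proof (induction s' rule: less_induct)
  case (less s')
  then obtain m where m: "s' = Suc m" by (cases s') auto
  have step: "f m < f s'" using assms(1,2) less.prems m by (auto dest: bspec[of _ _ m])
  show ?case
  proof (cases "s = m")
    case False
    then have "f s < f m" using less m by auto
    then show ?thesis using step by simp
  qed (use step in simp)
qed

text \<open>Strict increase of the endpoints separates the intervals, so no point is counted
  twice.\<close>

lemma indicator_Jset:
  assumes "\<forall>s\<in>{1..<2 * k j}. a j s < a j (s + 1)"
  shows "(indicator (Jset a k j) x :: complex) = (\<Sum>l\<in>{1..k j}. indicator {a j (2 * l - 1)..a j (2 * l)} x)"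
  unfolding Jset_def
proof (rule indicator_UN_disjoint)
  have "{a j (2 * l - 1)..a j (2 * l)} \<inter> {a j (2 * l' - 1)..a j (2 * l')} = {}"
    if "l \<in> {1..k j}" "l' \<in> {1..k j}" "l < l'" for l l'
  proof -
    have "a j (2 * l) < a j (2 * l' - 1)"
      by (rule increasing_on_interval[OF assms]) (use that in auto)
    then show ?thesis by auto
  qed
  then show "disjoint_family_on (\<lambda>l. {a j (2 * l - 1)..a j (2 * l)}) {1..k j}"
    unfolding disjoint_family_on_def by (metis Int_commute linorder_neqE_nat)
qed simp

lemma integral_interval_exp:
  fixes w :: complex
  assumes "w \<noteq> 0" "\<alpha> \<le> \<beta>"
  shows "integrable lborel (\<lambda>z. indicator {\<alpha>..\<beta>} z * exp (of_real z * w))"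
    "(\<integral>z. indicator {\<alpha>..\<beta>} z * exp (of_real z * w) \<partial>lborel) = (exp (of_real \<beta> * w) - exp (of_real \<alpha> * w)) / w"
proof -
  have d: "((\<lambda>z. exp (of_real z * w) / w) has_vector_derivative exp (of_real x * w)) (at x within {\<alpha>..\<beta>})" for x
    by (rule has_vector_derivative_real_field[where f="\<lambda>z. exp (z * w) / w"])
       (use assms(1) in \<open>auto intro!: derivative_eq_intros\<close>)
  have c: "continuous_on {\<alpha>..\<beta>} (\<lambda>z. exp (of_real z * w))" by (intro continuous_intros)
  have eq: "(\<lambda>z. indicator {\<alpha>..\<beta>} z * exp (of_real z * w)) = (\<lambda>z. indicator {\<alpha>..\<beta>} z *\<^sub>R exp (of_real z * w))"
    by (auto simp: indicator_def)
  show "(\<integral>z. indicator {\<alpha>..\<beta>} z * exp (of_real z * w) \<partial>lborel) = (exp (of_real \<beta> * w) - exp (of_real \<alpha> * w)) / w"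
    unfolding eq using integral_FTC_Icc[OF assms(2) d c] by (simp add: diff_divide_distrib)
  show "integrable lborel (\<lambda>z. indicator {\<alpha>..\<beta>} z * exp (of_real z * w))"
    unfolding eq using borel_integrable_atLeastAtMost'[OF c] by (simp add: set_integrable_def)
qed

text \<open>Upper endpoints carry even numbers, whereas (-1)^(s+1), the diagonal entry of
  \<epsilon>, is negative at even s; hence the minus sign.\<close>

lemma alternating_sum_pairs:
  fixes e :: "nat \<Rightarrow> complex"
  shows "(\<Sum>l\<in>{1..m}. e (2 * l) - e (2 * l - 1)) = - (\<Sum>s\<in>{1..2 * m}. (-1) ^ (s + 1) * e s)"
  by (induction m) simp_all

lemma Jset_integral:
  fixes w :: complex
  assumes inc: "\<forall>s\<in>{1..<2 * k j}. a j s < a j (s + 1)" and w: "w \<noteq> 0"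
  shows "(\<integral>z. indicator (Jset a k j) z * exp (of_real z * w) \<partial>lborel)
    = - (\<Sum>s\<in>{1..2 * k j}. (-1) ^ (s + 1) * exp (of_real (a j s) * w)) / w"
proof -
  have le: "a j (2 * l - 1) \<le> a j (2 * l)" if "l \<in> {1..k j}" for l
    by (rule less_imp_le, rule increasing_on_interval[OF inc]) (use that in auto)
  have "(\<integral>z. indicator (Jset a k j) z * exp (of_real z * w) \<partial>lborel)
    = (\<Sum>l\<in>{1..k j}. \<integral>z. indicator {a j (2 * l - 1)..a j (2 * l)} z * exp (of_real z * w) \<partial>lborel)"
    unfolding indicator_Jset[where a=a and k=k and j=j, OF inc] sum_distrib_right
    by (rule Bochner_Integration.integral_sum) (use integral_interval_exp(1)[OF w le] in auto)
  also have "\<dots> = (\<Sum>l\<in>{1..k j}. exp (of_real (a j (2 * l)) * w) - exp (of_real (a j (2 * l - 1)) * w)) / w"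
    unfolding sum_divide_distrib by (intro sum.cong refl integral_interval_exp(2)[OF w le])
  also have "\<dots> = - (\<Sum>s\<in>{1..2 * k j}. (-1) ^ (s + 1) * exp (of_real (a j s) * w)) / w"
    by (subst alternating_sum_pairs[where e="\<lambda>s. exp (of_real (a j s) * w)"]) simp
  finally show ?thesis .
qed

lemma boff_mono:
  assumes "1 \<le> m" "m < m'"
  shows "boff k m + 2 * k m \<le> boff k m'"
proof -
  have "(\<Sum>l\<in>{1..<m}. 2 * k l) + 2 * k m = (\<Sum>l\<in>{1..<Suc m}. 2 * k l)" using assms by simp
  also have "\<dots> \<le> (\<Sum>l\<in>{1..<m'}. 2 * k l)" using assms by (intro sum_mono2) auto
  finally show ?thesis by (simp add: boff_def)
qed

lemma blockvec_nth:
  assumes m: "m \<in> {1..n}" "s \<in> {1..2 * k m}"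
  shows "blockvec n k v0 blk (boff k m + s - 1) = blk m s"
proof -
  \<comment> \<open>Blocks occupy disjoint ranges, so a position determines block and entry.
    Positions count from 0 and entries from 1, which accounts for the - 1.\<close>
  have eq: "boff k m + s - 1 = boff k m' + s' - 1 \<longleftrightarrow> m' = m \<and> s' = s"
    if "m' \<in> {1..n}" "s' \<in> {1..2 * k m'}" for m' s'
  proof
    assume *: "boff k m + s - 1 = boff k m' + s' - 1"
    have "m' = m"
      using boff_mono[of m m' k] boff_mono[of m' m k] m that * by (cases m m' rule: linorder_cases) auto
    then show "m' = m \<and> s' = s" using * m that by auto
  qed simp
  have "blockvec n k v0 blk (boff k m + s - 1)
    = (\<Sum>m'\<in>{1..n}. \<Sum>s'\<in>{1..2 * k m'}. if boff k m + s - 1 = boff k m' + s' - 1 then blk m' s' else 0)"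
    using m by (simp add: blockvec_def boff_def)
  also have "\<dots> = (\<Sum>m'\<in>{1..n}. \<Sum>s'\<in>{1..2 * k m'}. if m' = m \<and> s' = s then blk m' s' else 0)"
    using eq by (intro sum.cong refl if_cong) auto
  also have "\<dots> = (\<Sum>m'\<in>{1..n}. if m' = m then blk m s else 0)"
    using m by (intro sum.cong refl) (auto simp: sum.delta)
  also have "\<dots> = blk m s" using m by simp
  finally show ?thesis .
qed

lemma sum_over_blocks:
  fixes F :: "nat \<Rightarrow> complex"
  shows "(\<Sum>p<vlen n k. F p) = F 0 + (\<Sum>m\<in>{1..n}. \<Sum>s\<in>{1..2 * k m}. F (boff k m + s - 1))"
proof (induction n)
  case 0
  show ?case by (simp add: vlen_def)
next
  case (Suc n)
  have v: "vlen (Suc n) k = vlen n k + 2 * k (Suc n)" by (simp add: vlen_def)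
  \<comment> \<open>The new block starts exactly where the shorter vector ends.\<close>
  have b: "boff k (Suc n) = vlen n k" by (simp add: boff_def vlen_def atLeastLessThanSuc_atLeastAtMost)
  have "(\<Sum>p<vlen (Suc n) k. F p) = (\<Sum>p<vlen n k. F p) + (\<Sum>p\<in>{vlen n k..<vlen n k + 2 * k (Suc n)}. F p)"
    unfolding v by (simp add: lessThan_atLeast0 sum.atLeastLessThan_concat)
  also have "(\<Sum>p\<in>{vlen n k..<vlen n k + 2 * k (Suc n)}. F p) = (\<Sum>s\<in>{1..2 * k (Suc n)}. F (vlen n k + s - 1))"
    by (rule sum.reindex_bij_witness[where i="\<lambda>s. vlen n k + s - 1" and j="\<lambda>p. p - vlen n k + 1"]) auto
  finally show ?case by (simp add: Suc b)
qed

lemma blockvec_inner: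
  "(\<Sum>p<vlen n k. blockvec n k v0 blk p * blockvec n k w0 blk' p)
    = v0 * w0 + (\<Sum>m\<in>{1..n}. \<Sum>s\<in>{1..2 * k m}. blk m s * blk' m s)"
  unfolding sum_over_blocks
proof (intro arg_cong2[where f="(+)"] sum.cong refl)
  show "blockvec n k v0 blk 0 * blockvec n k w0 blk' 0 = v0 * w0" by (simp add: blockvec_def)
qed (simp only: blockvec_nth)

text \<open>Apart from the first entry, \<open>fP\<close> at time \<open>i\<close> has only its
  block \<open>i\<close>, so just that block of \<open>gP\<close> matters, and its form depends on
  how \<open>i\<close> compares with \<open>j\<close>.\<close>

lemma KP_blocks:
  assumes "i \<in> {1..n}"
  shows "KP \<tau> a k n c i j la \<mu> = (1 / (2 * pi * \<i>) *
    (exp (Theta \<tau> i 0 la / 2) * indicator (gammaLR_set c) la * (exp (- Theta \<tau> j 0 \<mu>) * indicator iR_set \<mu>)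
     + (\<Sum>s\<in>{1..2 * k i}. exp (of_real (a i s) * la) * indicator iR_set la *
        (if i < j then (-1) ^ (s + 1) * exp (- of_real (a i s) * \<mu> + of_real (\<tau> j - \<tau> i) * \<mu> ^ 2 / 2) * indicator iR_set \<mu>
         else if i = j then (-1) ^ (s + 1) * exp (Theta \<tau> j 0 \<mu> / 2 - of_real (a j s) * \<mu>) * indicator (gammaLR_set c) \<mu>
         else 0)))) / (la - \<mu>)"
proof -
  have "(\<Sum>m\<in>{1..n}. \<Sum>s\<in>{1..2 * k m}. (if m = i then exp (of_real (a i s) * la) * indicator iR_set la else 0) * g m s)
    = (\<Sum>s\<in>{1..2 * k i}. exp (of_real (a i s) * la) * indicator iR_set la * g i s)" for g
  proof -
    have "(\<Sum>m\<in>{1..n}. \<Sum>s\<in>{1..2 * k m}. (if m = i then exp (of_real (a i s) * la) * indicator iR_set la else 0) * g m s)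
      = (\<Sum>m\<in>{1..n}. if m = i then \<Sum>s\<in>{1..2 * k i}. exp (of_real (a i s) * la) * indicator iR_set la * g i s else 0)"
      by (intro sum.cong refl) auto
    then show ?thesis using assms by simp
  qed
  then show ?thesis unfolding KP_def fP_def gP_def blockvec_inner by simp
qed

section \<open>The coupled kernel\<close>

lemma Jset_compact: "compact (Jset a k j)"
  unfolding Jset_def by (intro compact_UN) auto

lemma Jset_borel [measurable]: "Jset a k j \<in> sets borel"
  by (intro borel_closed compact_imp_closed Jset_compact)

lemma measurable_cpt [measurable]: "cpt c r \<in> borel_measurable borel"
  unfolding cpt_def[abs_def] bray_def by measurable

lemma measurable_cdz [measurable]: "cdz r \<in> borel_measurable borel"
  unfolding cdz_def[abs_def] bray_dz_def by measurable

lemma norm_cdz [simp]: "cmod (cdz r s) = 1"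
  by (simp add: cdz_def bray_dz_def)

lemma cpt_iR [simp]: "cpt c 0 s \<in> iR_set"
  by (simp add: cpt_0 iR_set_def)

lemma cpt_gamma_in [simp]: "r \<in> {1, 2} \<Longrightarrow> cpt c r s \<in> gammaLR_set c"
  by (auto simp: gammaLR_set_def)

lemma Re_gamma:
  assumes "0 < c" "z \<in> gammaLR_set c" shows "c \<le> \<bar>Re z\<bar>"
  using assms cpt_gamma_Re(1)[of 1 c] cpt_gamma_Re(1)[of 2 c] by (auto simp: gammaLR_set_def)

lemma iR_gamma_disjoint: "0 < c \<Longrightarrow> z \<in> gammaLR_set c \<Longrightarrow> z \<notin> iR_set"
  using Re_gamma[of c z] by (auto simp: iR_set_def)

lemma sum_over_piece: "(\<Sum>l\<in>A \<times> {r}. f l) = (\<Sum>m\<in>A. f (m, r))"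
  by (rule sum.reindex_bij_witness[where i="\<lambda>m. (m, r)" and j=fst]) auto

lemma measurable_Theta [measurable]: "Theta \<tau> i x \<in> borel_measurable borel"
  unfolding Theta_def[abs_def] by measurable

locale pearcey =
  fixes n :: nat and \<tau> :: "nat \<Rightarrow> real" and k :: "nat \<Rightarrow> nat" and a :: "nat \<Rightarrow> nat \<Rightarrow> real" and c :: real
  assumes tau_step: "\<forall>i\<in>{1..<n}. \<tau> i < \<tau> (i + 1)"
    and a_step: "\<forall>j\<in>{1..n}. \<forall>s\<in>{1..<2 * k j}. a j s < a j (s + 1)"
    and c_pos: "0 < c"
begin

lemma tau_less_iff:
  assumes "i \<in> {1..n}" "j \<in> {1..n}" shows "\<tau> i < \<tau> j \<longleftrightarrow> i < j"
  using increasing_on_interval[OF tau_step, of i j] increasing_on_interval[OF tau_step, of j i] assms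
  by (cases i j rule: linorder_cases) auto

text \<open>The second component of an index is the piece: \<open>0\<close>, \<open>1\<close>, \<open>2\<close> are the contour pieces of \<open>cpt\<close>,
  and \<open>3\<close> is the real line carrying \<open>J\<close>. Kernels include the line element of their column variable.\<close>

definition maj :: "nat \<times> nat \<Rightarrow> real \<Rightarrow> real" where
  "maj jr y = (if snd jr = 3 then indicator (Jset a k (fst jr)) y
     else if snd jr = 0 then exp (- 1 * y\<^sup>2) + (\<Sum>i\<in>{1..<fst jr}. exp (- ((\<tau> (fst jr) - \<tau> i) / 2) * y\<^sup>2))
     else exp (- 1 * y\<^sup>2))"

text \<open>The factor \<open>F\<close>. The exponential has modulus one, so the indicator of
  \<open>J\<close> alone is its majorant.\<close>

definition kF :: "nat \<times> nat \<Rightarrow> real \<Rightarrow> nat \<times> nat \<Rightarrow> real \<Rightarrow> complex" where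
  "kF ir x jr y = (if snd ir = 0 \<and> snd jr = 3 \<and> fst ir = fst jr
     then indicator (Jset a k (fst jr)) y * exp (of_real y * cpt c 0 x) else 0)"

text \<open>The factor \<open>N\<close>. Its minus sign compensates the one produced by integrating
  exponentials over \<open>J\<close>.\<close>

definition kN :: "nat \<times> nat \<Rightarrow> real \<Rightarrow> nat \<times> nat \<Rightarrow> real \<Rightarrow> complex" where
  "kN ir x jr y = (if snd ir = 3 \<and> snd jr = 0 \<and> fst ir < fst jr
     then - 1 / (2 * pi * \<i>) * indicator (Jset a k (fst ir)) x *
       exp (of_real (\<tau> (fst jr) - \<tau> (fst ir)) * (cpt c 0 y)\<^sup>2 / 2 - of_real x * cpt c 0 y) * cdz 0 y else 0)"

text \<open>The factor \<open>B\<close>, with the same minus sign. It takes one half of the phase,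
  which makes it decay along \<gamma>.\<close>

definition kB :: "nat \<times> nat \<Rightarrow> real \<Rightarrow> nat \<times> nat \<Rightarrow> real \<Rightarrow> complex" where
  "kB ir x jr y = (if snd ir = 3 \<and> snd jr \<in> {1, 2} \<and> fst ir = fst jr
     then - 1 / (2 * pi * \<i>) * indicator (Jset a k (fst ir)) x *
       exp (Theta \<tau> (fst ir) 0 (cpt c (snd jr) y) / 2 - of_real x * cpt c (snd jr) y) * cdz (snd jr) y else 0)"

text \<open>The factor \<open>C\<close>. The other half of the phase keeps it bounded in the row
  point; the full phase on the imaginary axis supplies decay in the column point.\<close>

definition kC :: "nat \<times> nat \<Rightarrow> real \<Rightarrow> nat \<times> nat \<Rightarrow> real \<Rightarrow> complex" where
  "kC ir x jr y = (if snd ir \<in> {1, 2} \<and> snd jr = 0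
     then 1 / (2 * pi * \<i>) *
       (exp (Theta \<tau> (fst ir) 0 (cpt c (snd ir) x) / 2 - Theta \<tau> (fst jr) 0 (cpt c 0 y))
        / (cpt c (snd ir) x - cpt c 0 y)) * cdz 0 y else 0)"

text \<open>The four supports are disjoint, so every block of the sum is a single factor or
  zero.\<close>

definition big :: "nat \<times> nat \<Rightarrow> real \<Rightarrow> nat \<times> nat \<Rightarrow> real \<Rightarrow> complex" where
  "big ir x jr y = (kF ir x jr y + kN ir x jr y) + (kB ir x jr y + kC ir x jr y)"

lemma maj_nonneg: "0 \<le> maj jr y"
  by (auto simp: maj_def intro!: add_nonneg_nonneg sum_nonneg)

text \<open>\<open>J\<close> is compact, and the Gaussian rates in \<open>maj\<close> are positive
  because earlier times are strictly smaller.\<close>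

lemma maj_integrable:
  assumes "jr \<in> {1..n} \<times> {0, 1, 2, 3}" shows "integrable lborel (maj jr)"
proof -
  have J: "integrable lborel (indicator (Jset a k (fst jr)) :: real \<Rightarrow> real)"
    by (rule integrable_real_indicator[OF _ emeasure_bounded_finite[OF compact_imp_bounded[OF Jset_compact]]]) simp
  have g1: "integrable lborel (\<lambda>y::real. exp (- 1 * y\<^sup>2))"
    by (rule integrable_gaussian) simp
  have g2: "integrable lborel (\<lambda>y::real. exp (- ((\<tau> (fst jr) - \<tau> i) / 2) * y\<^sup>2))" if "i \<in> {1..<fst jr}" for i
    using tau_less_iff[of i "fst jr"] that assms by (intro integrable_gaussian) auto
  show ?thesis
    unfolding maj_def[abs_def] using J g1 g2
    by (cases "snd jr = 3"; cases "snd jr = 0") (auto intro!: Bochner_Integration.integrable_add Bochner_Integration.integrable_sum)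
qed

sublocale fredholm_kernels lborel "{1..n} \<times> {0, 1, 2, 3}" maj
  by unfold_locales (auto simp: maj_nonneg intro!: maj_integrable)

lemma Jset_abs_bound: "\<exists>R\<ge>0. \<forall>i\<in>{1..n}. \<forall>x\<in>Jset a k i. \<bar>x\<bar> \<le> R"
proof -
  have "bounded (\<Union>i\<in>{1..n}. Jset a k i)"
    by (intro bounded_UN) (auto intro: compact_imp_bounded Jset_compact)
  then obtain R where "\<forall>x\<in>(\<Union>i\<in>{1..n}. Jset a k i). norm x \<le> R" by (auto simp: bounded_iff)
  then show ?thesis by (intro exI[of _ "max R 0"]) fastforce
qed

lemma uniform_constant:
  fixes P :: "nat \<Rightarrow> real \<Rightarrow> bool"
  assumes "\<And>i. \<exists>K. P i K" and mono: "\<And>i K K'. P i K \<Longrightarrow> K \<le> K' \<Longrightarrow> P i K'"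
  shows "\<exists>K. \<forall>i\<in>{1..n}. P i K"
proof -
  obtain f where f: "\<And>i. P i (f i)" using assms(1) by metis
  have "f i \<le> (\<Sum>j\<in>{1..n}. \<bar>f j\<bar>)" if "i \<in> {1..n}" for i
    using that by (intro order_trans[OF abs_ge_self member_le_sum[of i _ "\<lambda>j. \<bar>f j\<bar>"]]) auto
  then show ?thesis using f mono by blast
qed

lemma gamma_decay:
  assumes "0 \<le> R"
  shows "\<exists>K. \<forall>i\<in>{1..n}. \<forall>r\<in>{1, 2}. \<forall>s. Re (Theta \<tau> i 0 (cpt c r s)) / 2 + R * cmod (cpt c r s) \<le> K - s\<^sup>2"
  by (rule uniform_constant[OF Theta_decay_gamma[OF c_pos assms]]) (meson diff_right_mono order_trans)

lemma iR_decay: "\<exists>K. \<forall>j\<in>{1..n}. \<forall>s. - Re (Theta \<tau> j 0 (cpt c 0 s)) \<le> K - s\<^sup>2"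
  by (rule uniform_constant[OF Theta_decay_iR]) (meson diff_right_mono order_trans)

lemma adm_kF: "adm kF"
proof -
  have "meas_kernel kF"
    unfolding meas_kernel_def kF_def by (intro ballI) measurable
  moreover have "bdd_kernel 1 kF"
    unfolding bdd_kernel_def
  proof (intro conjI ballI allI)
    fix ir jr x y
    show "cmod (kF ir x jr y) \<le> 1 * maj jr y"
      using maj_nonneg[of jr y] by (auto simp: kF_def maj_def norm_mult cpt_0 indicator_def)
  qed simp
  ultimately show ?thesis unfolding adm_def by blast
qed

lemma adm_kN: "adm kN"
proof -
  have "meas_kernel kN"
    unfolding meas_kernel_def kN_def by (intro ballI) measurable
  moreover have "bdd_kernel 1 kN"
    unfolding bdd_kernel_def
  proof (intro conjI ballI allI)
    fix ir jr :: "nat \<times> nat" and x y assume ind: "ir \<in> {1..n} \<times> {0, 1, 2, 3}" "jr \<in> {1..n} \<times> {0, 1, 2, 3}"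
    show "cmod (kN ir x jr y) \<le> 1 * maj jr y"
    proof (cases "snd ir = 3 \<and> snd jr = 0 \<and> fst ir < fst jr")
      case True
      let ?e = "exp (- ((\<tau> (fst jr) - \<tau> (fst ir)) / 2) * y\<^sup>2)"
      have "cmod (kN ir x jr y) = 1 / (2 * pi) * indicator (Jset a k (fst ir)) x * ?e"
        using True by (simp add: kN_def norm_mult norm_divide cpt_0 power_mult_distrib indicator_def)
      also have "\<dots> \<le> 1 * 1 * ?e"
        using pi_gt3 by (intro mult_mono) (auto simp: indicator_def)
      \<comment> \<open>\<open>maj\<close> cannot depend on the row, so it contains the Gaussians of
        all earlier times; the present one is a summand.\<close>
      also have "\<dots> \<le> (\<Sum>i\<in>{1..<fst jr}. exp (- ((\<tau> (fst jr) - \<tau> i) / 2) * y\<^sup>2))"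
        using True ind member_le_sum[of "fst ir" "{1..<fst jr}" "\<lambda>i. exp (- ((\<tau> (fst jr) - \<tau> i) / 2) * y\<^sup>2)"] by auto
      also have "\<dots> \<le> maj jr y" using True by (simp add: maj_def)
      finally show ?thesis by simp
    next
      case False
      then show ?thesis using maj_nonneg by (auto simp: kN_def)
    qed
  qed simp
  ultimately show ?thesis unfolding adm_def by blast
qed

lemma adm_kB: "adm kB"
proof -
  obtain R where R: "0 \<le> R" "\<forall>i\<in>{1..n}. \<forall>x\<in>Jset a k i. \<bar>x\<bar> \<le> R" using Jset_abs_bound by blast
  obtain K where K: "\<forall>i\<in>{1..n}. \<forall>r\<in>{1, 2}. \<forall>s. Re (Theta \<tau> i 0 (cpt c r s)) / 2 + R * cmod (cpt c r s) \<le> K - s\<^sup>2"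
    using gamma_decay[OF R(1)] by blast
  have "meas_kernel kB"
    unfolding meas_kernel_def kB_def by (intro ballI) measurable
  moreover have "bdd_kernel (exp K) kB"
    unfolding bdd_kernel_def
  proof (intro conjI ballI allI)
    fix ir jr :: "nat \<times> nat" and x y assume ind: "ir \<in> {1..n} \<times> {0, 1, 2, 3}" "jr \<in> {1..n} \<times> {0, 1, 2, 3}"
    show "cmod (kB ir x jr y) \<le> exp K * maj jr y"
    proof (cases "snd ir = 3 \<and> snd jr \<in> {1, 2} \<and> fst ir = fst jr \<and> x \<in> Jset a k (fst ir)")
      case True
      define \<mu> where "\<mu> = cpt c (snd jr) y"
      have i: "fst ir \<in> {1..n}" using ind by auto
      have "cmod (kB ir x jr y) = 1 / (2 * pi) * exp (Re (Theta \<tau> (fst ir) 0 \<mu>) / 2 - x * Re \<mu>)"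
        using True by (auto simp: kB_def norm_mult norm_divide \<mu>_def indicator_def)
      also have "\<dots> \<le> 1 * exp (K - y\<^sup>2)"
      proof (intro mult_mono)
        \<comment> \<open>Since \<open>J\<close> is bounded by \<open>R\<close>, the linear term
          costs at most \<open>R * cmod \<mu>\<close>, which \<open>gamma_decay\<close> has already
          absorbed.\<close>
        have "- (x * Re \<mu>) \<le> \<bar>x\<bar> * \<bar>Re \<mu>\<bar>" by (metis abs_mult abs_ge_minus_self)
        also have "\<dots> \<le> R * cmod \<mu>" using R True i by (intro mult_mono abs_Re_le_cmod) auto
        finally have "Re (Theta \<tau> (fst ir) 0 \<mu>) / 2 - x * Re \<mu> \<le> Re (Theta \<tau> (fst ir) 0 \<mu>) / 2 + R * cmod \<mu>" by simp
        also have "\<dots> \<le> K - y\<^sup>2" unfolding \<mu>_def using K i True by blast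
        finally show "exp (Re (Theta \<tau> (fst ir) 0 \<mu>) / 2 - x * Re \<mu>) \<le> exp (K - y\<^sup>2)" by simp
      qed (use pi_gt3 in auto)
      also have "\<dots> = exp K * maj jr y" using True by (auto simp: maj_def exp_diff exp_minus field_simps)
      finally show ?thesis .
    next
      case False
      then have "kB ir x jr y = 0" by (auto simp: kB_def)
      then show ?thesis using maj_nonneg[of jr y] by simp
    qed
  qed simp
  ultimately show ?thesis unfolding adm_def by blast
qed

lemma gamma_iR_distance:
  assumes "r \<in> {1, 2}" shows "c \<le> cmod (cpt c r x - cpt c 0 y)"
  using cpt_gamma_Re(1)[OF assms c_pos, of x] abs_Re_le_cmod[of "cpt c r x - cpt c 0 y"]
  by (simp add: cpt_0)

lemma adm_kC: "adm kC"
proof -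
  obtain K where K: "\<forall>i\<in>{1..n}. \<forall>r\<in>{1, 2}. \<forall>s. Re (Theta \<tau> i 0 (cpt c r s)) / 2 + 0 * cmod (cpt c r s) \<le> K - s\<^sup>2"
    using gamma_decay[of 0] by blast
  obtain L where L: "\<forall>j\<in>{1..n}. \<forall>s. - Re (Theta \<tau> j 0 (cpt c 0 s)) \<le> L - s\<^sup>2"
    using iR_decay by blast
  have "meas_kernel kC"
    unfolding meas_kernel_def kC_def by (intro ballI) measurable
  moreover have "bdd_kernel (exp (K + L) / c) kC"
    unfolding bdd_kernel_def
  proof (intro conjI ballI allI)
    show "0 \<le> exp (K + L) / c" using c_pos by simp
    fix ir jr :: "nat \<times> nat" and x y assume ind: "ir \<in> {1..n} \<times> {0, 1, 2, 3}" "jr \<in> {1..n} \<times> {0, 1, 2, 3}"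
    show "cmod (kC ir x jr y) \<le> exp (K + L) / c * maj jr y"
    proof (cases "snd ir \<in> {1, 2} \<and> snd jr = 0")
      case True
      define \<mu> where "\<mu> = cpt c (snd ir) x"
      define la where "la = cpt c 0 y"
      have i: "fst ir \<in> {1..n}" "fst jr \<in> {1..n}" using ind by auto
      have "Re (Theta \<tau> (fst ir) 0 \<mu>) / 2 + 0 * cmod \<mu> \<le> K - x\<^sup>2"
        unfolding \<mu>_def using K i True by blast
      moreover have "- Re (Theta \<tau> (fst jr) 0 la) \<le> L - y\<^sup>2" unfolding la_def using L i by blast
      \<comment> \<open>The decay in the row point is discarded; the column point supplies all that
        the majorant needs.\<close>
      ultimately have e: "Re (Theta \<tau> (fst ir) 0 \<mu>) / 2 - Re (Theta \<tau> (fst jr) 0 la) \<le> K + L - y\<^sup>2"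
        using zero_le_power2[of x] by linarith
      have "cmod (kC ir x jr y) = 1 / (2 * pi) * (exp (Re (Theta \<tau> (fst ir) 0 \<mu>) / 2 - Re (Theta \<tau> (fst jr) 0 la)) / cmod (\<mu> - la))"
        using True by (simp add: kC_def norm_mult norm_divide \<mu>_def la_def)
      also have "\<dots> \<le> 1 * (exp (K + L - y\<^sup>2) / c)"
        using e c_pos gamma_iR_distance[of "snd ir" x y] True pi_gt3
        by (intro mult_mono frac_le) (auto simp: \<mu>_def la_def)
      also have "\<dots> = exp (K + L) / c * exp (- 1 * y\<^sup>2)" by (simp add: exp_diff exp_minus field_simps)
      also have "\<dots> \<le> exp (K + L) / c * maj jr y"
        using True c_pos by (intro mult_left_mono) (auto simp: maj_def intro!: sum_nonneg)
      finally show ?thesis .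
    next
      case False
      then have "kC ir x jr y = 0" by (auto simp: kC_def)
      then show ?thesis using maj_nonneg[of jr y] c_pos by simp
    qed
  qed
  ultimately show ?thesis unfolding adm_def by blast
qed

lemma adm_big: "adm big"
  unfolding big_def[abs_def] by (intro adm_add adm_kF adm_kN adm_kB adm_kC)

text \<open>The three zero diagonal blocks are what permits elimination. The zero blocks from the
  axis to \<gamma> and from \<gamma> to \<open>J\<close> keep the eliminations from creating further
  terms.\<close>

lemma big_iR_J: "big (i, 0) x (j, 3) y = (if i = j then indicator (Jset a k j) y * exp (of_real y * cpt c 0 x) else 0)"
  and big_J_iR: "big (i, 3) x (j, 0) y = (if i < j then - 1 / (2 * pi * \<i>) * indicator (Jset a k i) x *
       exp (of_real (\<tau> j - \<tau> i) * (cpt c 0 y)\<^sup>2 / 2 - of_real x * cpt c 0 y) * cdz 0 y else 0)"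
  and big_J_gamma: "r \<in> {1, 2} \<Longrightarrow> big (i, 3) x (j, r) y = (if i = j then - 1 / (2 * pi * \<i>) * indicator (Jset a k i) x *
       exp (Theta \<tau> i 0 (cpt c r y) / 2 - of_real x * cpt c r y) * cdz r y else 0)"
  and big_gamma_iR: "r \<in> {1, 2} \<Longrightarrow> big (i, r) x (j, 0) y = 1 / (2 * pi * \<i>) *
       (exp (Theta \<tau> i 0 (cpt c r x) / 2 - Theta \<tau> j 0 (cpt c 0 y)) / (cpt c r x - cpt c 0 y)) * cdz 0 y"
  and big_iR_iR: "big (i, 0) x (j, 0) y = 0"
  and big_iR_gamma: "r \<in> {1, 2} \<Longrightarrow> big (i, 0) x (j, r) y = 0"
  and big_J_J: "big (i, 3) x (j, 3) y = 0"
  and big_gamma_J: "r \<in> {1, 2} \<Longrightarrow> big (i, r) x (j, 3) y = 0"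
  and big_gamma_gamma: "r \<in> {1, 2} \<Longrightarrow> r' \<in> {1, 2} \<Longrightarrow> big (i, r) x (j, r') y = 0"
  by (auto simp: big_def kF_def kN_def kB_def kC_def)

definition piece_iR :: "(nat \<times> nat) set" where "piece_iR = {1..n} \<times> {0}"
definition piece_gamma :: "(nat \<times> nat) set" where "piece_gamma = {1..n} \<times> {1, 2}"
definition piece_J :: "(nat \<times> nat) set" where "piece_J = {1..n} \<times> {3}"

section \<open>Eliminating \<open>J\<close>: the kernel of the integrable operator\<close>

lemma schur_J_gamma_row:
  assumes "i \<in> {1..n}" "j \<in> {1..n}" "r \<in> {1, 2}" "r' \<in> {0, 1, 2}"
  shows "schur_kernel lborel piece_J big (i, r) x (j, r') y = big (i, r) x (j, r') y"
  using assms by (auto simp: schur_kernel_def piece_J_def sum_over_piece big_gamma_J)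

text \<open>\<open>F\<close> is diagonal in the time index, so row \<open>i\<close> reaches only the
  set \<open>J\<close> of the same time.\<close>

lemma schur_J_iR_row:
  assumes "i \<in> {1..n}" "j \<in> {1..n}" "r' \<in> {0, 1, 2}"
  shows "schur_kernel lborel piece_J big (i, 0) x (j, r') y
    = (\<integral>z. indicator (Jset a k i) z * exp (of_real z * cpt c 0 x) * big (i, 3) z (j, r') y \<partial>lborel)"
proof -
  have "schur_kernel lborel piece_J big (i, 0) x (j, r') y
      = (\<Sum>m\<in>{1..n}. \<integral>z. big (i, 0) x (m, 3) z * big (m, 3) z (j, r') y \<partial>lborel)"
    using assms big_iR_iR[of i x j y] big_iR_gamma[of r' i x j y]
    by (auto simp: schur_kernel_def piece_J_def sum_over_piece)
  also have "\<dots> = (\<Sum>m\<in>{i}. \<integral>z. big (i, 0) x (m, 3) z * big (m, 3) z (j, r') y \<partial>lborel)"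
    using assms by (intro sum.mono_neutral_right) (auto simp: big_iR_J)
  finally show ?thesis by (simp add: big_iR_J)
qed

lemma a_step': "i \<in> {1..n} \<Longrightarrow> \<forall>s\<in>{1..<2 * k i}. a i s < a i (s + 1)"
  using a_step by blast

text \<open>Equality is restricted to x \<noteq> y: at x = y the quotient in \<open>KP\<close> is a
  division by zero, hence 0, while the integral over \<open>J\<close> has no singularity
  there.\<close>

lemma KP_param_iR_iR:
  assumes "i \<in> {1..n}" "j \<in> {1..n}"
  shows "KP_param \<tau> a k n c (i, 0) x (j, 0) y
    = (if x = y then 0 else schur_kernel lborel piece_J big (i, 0) x (j, 0) y)"
proof -
  let ?la = "cpt c 0 x" and ?mu = "cpt c 0 y"
  have ng: "?la \<notin> gammaLR_set c" "?mu \<notin> gammaLR_set c" using iR_gamma_disjoint[OF c_pos] cpt_iR by blast+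
  show ?thesis
  proof (cases "x \<noteq> y \<and> i < j")
    case True
    then have w: "?la - ?mu \<noteq> 0" by (simp add: cpt_0)
    let ?C = "- 1 / (2 * pi * \<i>) * exp (of_real (\<tau> j - \<tau> i) * ?mu\<^sup>2 / 2) * cdz 0 y"
    have "schur_kernel lborel piece_J big (i, 0) x (j, 0) y
       = (\<integral>z. ?C * (indicator (Jset a k i) z * exp (of_real z * (?la - ?mu))) \<partial>lborel)"
      unfolding schur_J_iR_row[OF assms insertI1] big_J_iR
    proof (rule Bochner_Integration.integral_cong[OF refl])
      fix z :: real
      have "exp (of_real z * ?la) * exp (of_real (\<tau> j - \<tau> i) * ?mu\<^sup>2 / 2 - of_real z * ?mu)
          = exp (of_real (\<tau> j - \<tau> i) * ?mu\<^sup>2 / 2) * exp (of_real z * (?la - ?mu))"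
        by (simp add: exp_add[symmetric] algebra_simps)
      then show "indicator (Jset a k i) z * exp (of_real z * ?la) *
        (if i < j then - 1 / (2 * pi * \<i>) * indicator (Jset a k i) z *
          exp (of_real (\<tau> j - \<tau> i) * ?mu\<^sup>2 / 2 - of_real z * ?mu) * cdz 0 y else 0)
        = ?C * (indicator (Jset a k i) z * exp (of_real z * (?la - ?mu)))"
        using True by (cases "z \<in> Jset a k i") (simp_all add: algebra_simps)
    qed
    also have "\<dots> = ?C * (- (\<Sum>s\<in>{1..2 * k i}. (-1) ^ (s + 1) * exp (of_real (a i s) * (?la - ?mu))) / (?la - ?mu))"
      by (simp only: Bochner_Integration.integral_mult_right_zero Jset_integral[where a=a and k=k and j=i, OF a_step'[OF assms(1)] w])
    also have "\<dots> = KP_param \<tau> a k n c (i, 0) x (j, 0) y"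
    proof -
      have e: "exp (of_real (a i s) * ?la) * exp (- of_real (a i s) * ?mu + of_real (\<tau> j - \<tau> i) * ?mu\<^sup>2 / 2)
        = exp (of_real (a i s) * (?la - ?mu)) * exp (of_real (\<tau> j - \<tau> i) * ?mu\<^sup>2 / 2)" for s
        by (simp add: exp_add[symmetric] algebra_simps)
      have "(\<Sum>s\<in>{1..2 * k i}. exp (of_real (a i s) * ?la) * indicator iR_set ?la *
          ((-1) ^ (s + 1) * exp (- of_real (a i s) * ?mu + of_real (\<tau> j - \<tau> i) * ?mu\<^sup>2 / 2) * indicator iR_set ?mu))
        = (\<Sum>s\<in>{1..2 * k i}. (-1) ^ (s + 1) * exp (of_real (a i s) * (?la - ?mu))) * exp (of_real (\<tau> j - \<tau> i) * ?mu\<^sup>2 / 2)"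
        unfolding sum_distrib_right
      proof (intro sum.cong refl)
        fix s
        have "exp (of_real (a i s) * ?la) * indicator iR_set ?la *
          ((-1) ^ (s + 1) * exp (- of_real (a i s) * ?mu + of_real (\<tau> j - \<tau> i) * ?mu\<^sup>2 / 2) * indicator iR_set ?mu)
         = (-1) ^ (s + 1) * (exp (of_real (a i s) * ?la) * exp (- of_real (a i s) * ?mu + of_real (\<tau> j - \<tau> i) * ?mu\<^sup>2 / 2))"
          using cpt_iR by (simp add: mult_ac)
        then show "exp (of_real (a i s) * ?la) * indicator iR_set ?la *
          ((-1) ^ (s + 1) * exp (- of_real (a i s) * ?mu + of_real (\<tau> j - \<tau> i) * ?mu\<^sup>2 / 2) * indicator iR_set ?mu)
         = (-1) ^ (s + 1) * exp (of_real (a i s) * (?la - ?mu)) * exp (of_real (\<tau> j - \<tau> i) * ?mu\<^sup>2 / 2)"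
          unfolding e by (simp only: mult.assoc)
      qed
      then show ?thesis
        using True ng unfolding KP_param_def by (simp add: KP_blocks[OF assms(1)] mult_ac)
    qed
    finally show ?thesis using True by simp
  next
    case False
    then consider "x = y" | "\<not> i < j" by blast
    then show ?thesis
    proof cases
      case 1
      then show ?thesis by (simp add: KP_param_def KP_def)
    next
      \<comment> \<open>For i = j the block of \<open>gP\<close> lives on \<gamma> and vanishes on
        the axis; for i > j it is zero anyway.\<close>
      case 2
      then have "KP_param \<tau> a k n c (i, 0) x (j, 0) y = 0"
        using ng by (simp add: KP_param_def KP_blocks[OF assms(1)] cong: if_cong)
      moreover have "schur_kernel lborel piece_J big (i, 0) x (j, 0) y = 0"
        using 2 by (simp add: schur_J_iR_row[OF assms] big_J_iR)
      ultimately show ?thesis by simp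
    qed
  qed
qed

text \<open>The contours are disjoint, so the denominator never vanishes and no exceptional points
  appear.\<close>

lemma KP_param_iR_gamma:
  assumes "i \<in> {1..n}" "j \<in> {1..n}" and r: "r \<in> {1, 2}"
  shows "KP_param \<tau> a k n c (i, 0) x (j, r) y = schur_kernel lborel piece_J big (i, 0) x (j, r) y"
proof -
  let ?la = "cpt c 0 x" and ?mu = "cpt c r y"
  have r': "r \<in> {0, 1, 2}" using r by auto
  have ng: "?la \<notin> gammaLR_set c" "?mu \<notin> iR_set" using iR_gamma_disjoint[OF c_pos] cpt_iR cpt_gamma_in[OF r] by blast+
  have w: "?la - ?mu \<noteq> 0" using ng(2) cpt_iR by (metis eq_iff_diff_eq_0)
  show ?thesis
  proof (cases "i = j")
    case True
    let ?C = "- 1 / (2 * pi * \<i>) * exp (Theta \<tau> i 0 ?mu / 2) * cdz r y"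
    have "schur_kernel lborel piece_J big (i, 0) x (j, r) y
       = (\<integral>z. ?C * (indicator (Jset a k i) z * exp (of_real z * (?la - ?mu))) \<partial>lborel)"
      unfolding schur_J_iR_row[OF assms(1,2) r'] big_J_gamma[OF r]
    proof (rule Bochner_Integration.integral_cong[OF refl])
      fix z :: real
      have "exp (of_real z * ?la) * exp (Theta \<tau> i 0 ?mu / 2 - of_real z * ?mu)
          = exp (Theta \<tau> i 0 ?mu / 2) * exp (of_real z * (?la - ?mu))"
        by (simp add: exp_add[symmetric] algebra_simps)
      then show "indicator (Jset a k i) z * exp (of_real z * ?la) *
        (if i = j then - 1 / (2 * pi * \<i>) * indicator (Jset a k i) z *
          exp (Theta \<tau> i 0 ?mu / 2 - of_real z * ?mu) * cdz r y else 0)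
        = ?C * (indicator (Jset a k i) z * exp (of_real z * (?la - ?mu)))"
        using True by (cases "z \<in> Jset a k i") (simp_all add: algebra_simps)
    qed
    also have "\<dots> = ?C * (- (\<Sum>s\<in>{1..2 * k i}. (-1) ^ (s + 1) * exp (of_real (a i s) * (?la - ?mu))) / (?la - ?mu))"
      by (simp only: Bochner_Integration.integral_mult_right_zero Jset_integral[where a=a and k=k and j=i, OF a_step'[OF assms(1)] w])
    also have "\<dots> = KP_param \<tau> a k n c (i, 0) x (j, r) y"
    proof -
      have e: "exp (of_real (a i s) * ?la) * exp (Theta \<tau> i 0 ?mu / 2 - of_real (a i s) * ?mu)
        = exp (of_real (a i s) * (?la - ?mu)) * exp (Theta \<tau> i 0 ?mu / 2)" for s
        by (simp add: exp_add[symmetric] algebra_simps)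
      have "(\<Sum>s\<in>{1..2 * k i}. exp (of_real (a i s) * ?la) * indicator iR_set ?la *
          ((-1) ^ (s + 1) * exp (Theta \<tau> i 0 ?mu / 2 - of_real (a i s) * ?mu) * indicator (gammaLR_set c) ?mu))
        = (\<Sum>s\<in>{1..2 * k i}. (-1) ^ (s + 1) * exp (of_real (a i s) * (?la - ?mu))) * exp (Theta \<tau> i 0 ?mu / 2)"
        unfolding sum_distrib_right
      proof (intro sum.cong refl)
        fix s
        have "exp (of_real (a i s) * ?la) * indicator iR_set ?la *
          ((-1) ^ (s + 1) * exp (Theta \<tau> i 0 ?mu / 2 - of_real (a i s) * ?mu) * indicator (gammaLR_set c) ?mu)
         = (-1) ^ (s + 1) * (exp (of_real (a i s) * ?la) * exp (Theta \<tau> i 0 ?mu / 2 - of_real (a i s) * ?mu))"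
          using cpt_iR cpt_gamma_in[OF r] by (simp add: mult_ac)
        then show "exp (of_real (a i s) * ?la) * indicator iR_set ?la *
          ((-1) ^ (s + 1) * exp (Theta \<tau> i 0 ?mu / 2 - of_real (a i s) * ?mu) * indicator (gammaLR_set c) ?mu)
         = (-1) ^ (s + 1) * exp (of_real (a i s) * (?la - ?mu)) * exp (Theta \<tau> i 0 ?mu / 2)"
          unfolding e by (simp only: mult.assoc)
      qed
      then show ?thesis
        using True ng unfolding KP_param_def fst_conv snd_conv KP_blocks[OF assms(1)] by (simp add: mult_ac)
    qed
    finally show ?thesis by simp
  next
    case False
    have "KP_param \<tau> a k n c (i, 0) x (j, r) y = 0"
      using ng False by (simp add: KP_param_def KP_blocks[OF assms(1)] cong: if_cong)
    moreover have "schur_kernel lborel piece_J big (i, 0) x (j, r) y = 0"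
      using False by (simp add: schur_J_iR_row[OF assms(1,2) r'] big_J_gamma[OF r])
    ultimately show ?thesis by simp
  qed
qed

text \<open>On \<gamma> all blocks of \<open>fP\<close> vanish, so only the first entries
  contribute, and these live on \<gamma> for rows and on the axis for columns.\<close>

lemma KP_param_gamma:
  assumes "i \<in> {1..n}" "j \<in> {1..n}" and r: "r \<in> {1, 2}" and r': "r' \<in> {0, 1, 2}"
  shows "KP_param \<tau> a k n c (i, r) x (j, r') y = schur_kernel lborel piece_J big (i, r) x (j, r') y"
proof -
  have ng: "cpt c r x \<notin> iR_set" using iR_gamma_disjoint[OF c_pos cpt_gamma_in[OF r]] .
  show ?thesis
  proof (cases "r' = 0")
    case True
    have "exp (Theta \<tau> i 0 (cpt c r x) / 2) * exp (- Theta \<tau> j 0 (cpt c 0 y))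
      = exp (Theta \<tau> i 0 (cpt c r x) / 2 - Theta \<tau> j 0 (cpt c 0 y))"
      by (simp add: exp_add[symmetric])
    then show ?thesis
      unfolding schur_J_gamma_row[OF assms] unfolding True big_gamma_iR[OF r]
      using ng cpt_gamma_in[OF r] cpt_iR by (simp add: KP_param_def KP_blocks[OF assms(1)])
  next
    case False
    then have r'': "r' \<in> {1, 2}" using r' by auto
    then have "cpt c r' y \<notin> iR_set" using iR_gamma_disjoint[OF c_pos cpt_gamma_in] by blast
    then show ?thesis
      unfolding schur_J_gamma_row[OF assms] big_gamma_gamma[OF r r'']
      using ng by (simp add: KP_param_def KP_blocks[OF assms(1)])
  qed
qed

section \<open>Eliminating the axis and then \<gamma>: the Pearcey kernel\<close>

abbreviation "big0 \<equiv> schur_kernel lborel piece_iR big"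

lemma sum_iR_J:
  assumes "j \<in> {1..n}"
  shows "(\<Sum>l\<in>piece_iR. \<integral>z. big (i, r) x l z * big l z (j, 3) y \<partial>lborel)
    = (\<integral>z. big (i, r) x (j, 0) z * (indicator (Jset a k j) y * exp (of_real y * cpt c 0 z)) \<partial>lborel)"
proof -
  have "(\<Sum>l\<in>piece_iR. \<integral>z. big (i, r) x l z * big l z (j, 3) y \<partial>lborel)
    = (\<Sum>m\<in>{j}. \<integral>z. big (i, r) x (m, 0) z * big (m, 0) z (j, 3) y \<partial>lborel)"
    unfolding piece_iR_def sum_over_piece
    using assms by (intro sum.mono_neutral_right) (auto simp: big_iR_J)
  then show ?thesis by (simp add: big_iR_J)
qed

text \<open>With \<lambda> = i z the integrand of \<open>NF\<close> is a Gaussian of rate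
  \<open>\<tau> j - \<tau> i\<close> with frequency y - x, so its integral is the heat
  kernel.\<close>

lemma big0_J_J:
  assumes "i \<in> {1..n}" "j \<in> {1..n}"
  shows "big0 (i, 3) x (j, 3) y = - (indicator (Jset a k i) x * Qker \<tau> i j x y * indicator (Jset a k j) y)"
proof -
  have S: "big0 (i, 3) x (j, 3) y
     = (\<integral>z. big (i, 3) x (j, 0) z * (indicator (Jset a k j) y * exp (of_real y * cpt c 0 z)) \<partial>lborel)"
    by (simp add: schur_kernel_def big_J_J sum_iR_J[OF assms(2)]) (simp add: piece_iR_def)
  show ?thesis
  proof (cases "i < j")
    case True
    define T where "T = \<tau> j - \<tau> i"
    have T: "0 < T" using tau_less_iff[OF assms] True by (simp add: T_def)
    \<comment> \<open>The line element \<open>cdz 0 z\<close> is the imaginary unit and cancels the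
      one in 1 / (2 pi i).\<close>
    let ?C = "- 1 / (2 * complex_of_real pi) * indicator (Jset a k i) x * indicator (Jset a k j) y"
    have "big0 (i, 3) x (j, 3) y = (\<integral>z. ?C * exp (\<i> * of_real ((y - x) * z) - of_real (T * z\<^sup>2 / 2)) \<partial>lborel)"
      unfolding S
    proof (rule Bochner_Integration.integral_cong[OF refl])
      fix z :: real
      have e: "exp (of_real (\<tau> j - \<tau> i) * (cpt c 0 z)\<^sup>2 / 2 - of_real x * cpt c 0 z) * exp (of_real y * cpt c 0 z)
        = exp (\<i> * of_real ((y - x) * z) - of_real (T * z\<^sup>2 / 2))"
        unfolding exp_add[symmetric]
        by (rule arg_cong[where f=exp]) (simp add: cpt_0 power_mult_distrib T_def field_simps)
      have "big (i, 3) x (j, 0) z * (indicator (Jset a k j) y * exp (of_real y * cpt c 0 z))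
        = ?C * (exp (of_real (\<tau> j - \<tau> i) * (cpt c 0 z)\<^sup>2 / 2 - of_real x * cpt c 0 z) * exp (of_real y * cpt c 0 z))"
        using True by (simp add: big_J_iR cdz_def)
      then show "big (i, 3) x (j, 0) z * (indicator (Jset a k j) y * exp (of_real y * cpt c 0 z))
        = ?C * exp (\<i> * of_real ((y - x) * z) - of_real (T * z\<^sup>2 / 2))"
        unfolding e .
    qed
    also have "\<dots> = ?C * of_real (sqrt (2 * pi / T) * exp (- (y - x)\<^sup>2 / (2 * T)))"
      by (simp only: Bochner_Integration.integral_mult_right_zero gaussian_fourier[OF T])
    also have "\<dots> = - (indicator (Jset a k i) x * indicator (Jset a k j) y *
        of_real (1 / (2 * pi) * (sqrt (2 * pi / T) * exp (- (y - x)\<^sup>2 / (2 * T)))))"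
      by simp
    also have "1 / (2 * pi) * (sqrt (2 * pi / T) * exp (- (y - x)\<^sup>2 / (2 * T)))
        = 1 / sqrt (2 * pi * T) * exp (- ((x - y)\<^sup>2) / (2 * T))"
    proof -
      have "1 / (2 * pi) * sqrt (2 * pi / T) = 1 / sqrt (2 * pi * T)"
      proof -
        have "sqrt (2 * pi / T) * sqrt (2 * pi * T) = sqrt ((2 * pi)\<^sup>2)"
          unfolding real_sqrt_mult[symmetric] using T by (simp add: power2_eq_square)
        also have "\<dots> = 2 * pi" by (simp only: real_sqrt_abs) simp
        finally show ?thesis using T by (simp add: field_simps)
      qed
      then show ?thesis by (simp add: power2_commute mult.assoc[symmetric])
    qed
    finally show ?thesis
      using tau_less_iff[OF assms] True by (simp add: Qker_def T_def mult_ac)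
  next
    case False
    then show ?thesis using tau_less_iff[OF assms] by (simp add: S big_J_iR Qker_def)
  qed
qed

lemma big0_J_gamma:
  assumes "r \<in> {1, 2}"
  shows "big0 (i, 3) x (j, r) y = big (i, 3) x (j, r) y"
  using assms big_iR_gamma[OF assms] by (auto simp: schur_kernel_def piece_iR_def sum_over_piece)

lemma big0_gamma_gamma:
  assumes "r \<in> {1, 2}" "r' \<in> {1, 2}"
  shows "big0 (i, r) x (j, r') y = 0"
  using assms big_iR_gamma[OF assms(2)] big_gamma_gamma[OF assms]
  by (auto simp: schur_kernel_def piece_iR_def sum_over_piece)

text \<open>The Laplace factor exp(y \<lambda>) is precisely the dependence on y of exp(- Theta), so
  the phase at 0 becomes the phase at y.\<close>

lemma big0_gamma_J:
  assumes "r \<in> {1, 2}" "j \<in> {1..n}"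
  shows "big0 (i, r) x (j, 3) y = indicator (Jset a k j) y / (2 * pi * \<i>) *
    (\<integral>t. exp (Theta \<tau> i 0 (cpt c r x) / 2 - Theta \<tau> j y (cpt c 0 t)) / (cpt c r x - cpt c 0 t) * cdz 0 t \<partial>lborel)"
proof -
  have "big0 (i, r) x (j, 3) y
     = (\<integral>t. big (i, r) x (j, 0) t * (indicator (Jset a k j) y * exp (of_real y * cpt c 0 t)) \<partial>lborel)"
    using assms(1) by (simp add: schur_kernel_def big_gamma_J[OF assms(1)] sum_iR_J[OF assms(2)])
      (auto simp: piece_iR_def)
  also have "\<dots> = (\<integral>t. indicator (Jset a k j) y / (2 * pi * \<i>) *
    (exp (Theta \<tau> i 0 (cpt c r x) / 2 - Theta \<tau> j y (cpt c 0 t)) / (cpt c r x - cpt c 0 t) * cdz 0 t) \<partial>lborel)"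
  proof (rule Bochner_Integration.integral_cong[OF refl])
    fix t :: real
    have "exp (Theta \<tau> i 0 (cpt c r x) / 2 - Theta \<tau> j y (cpt c 0 t))
      = exp (Theta \<tau> i 0 (cpt c r x) / 2 - Theta \<tau> j 0 (cpt c 0 t)) * exp (of_real y * cpt c 0 t)"
      unfolding exp_add[symmetric] by (rule arg_cong[where f=exp]) (simp add: Theta_def)
    then show "big (i, r) x (j, 0) t * (indicator (Jset a k j) y * exp (of_real y * cpt c 0 t))
      = indicator (Jset a k j) y / (2 * pi * \<i>) *
    (exp (Theta \<tau> i 0 (cpt c r x) / 2 - Theta \<tau> j y (cpt c 0 t)) / (cpt c r x - cpt c 0 t) * cdz 0 t)"
      by (simp add: big_gamma_iR[OF assms(1)])
  qed
  also have "\<dots> = indicator (Jset a k j) y / (2 * pi * \<i>) *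
    (\<integral>t. exp (Theta \<tau> i 0 (cpt c r x) / 2 - Theta \<tau> j y (cpt c 0 t)) / (cpt c r x - cpt c 0 t) * cdz 0 t \<partial>lborel)"
    by (rule Bochner_Integration.integral_mult_right_zero)
  finally show ?thesis .
qed

lemma big0_gamma_term:
  assumes "r \<in> {1, 2}" "j \<in> {1..n}"
  shows "(\<integral>s. big0 (i, 3) x (i, r) s * big0 (i, r) s (j, 3) y \<partial>lborel)
    = indicator (Jset a k i) x * indicator (Jset a k j) y * (1 / (2 * pi * \<i>)\<^sup>2 *
       (\<integral>s. iR_integral (\<lambda>la. exp (Theta \<tau> i x (cpt c r s) - Theta \<tau> j y la) / (la - cpt c r s)) * cdz r s \<partial>lborel))"
proof -
  let ?C = "indicator (Jset a k i) x * indicator (Jset a k j) y * (1 / (2 * pi * \<i>)\<^sup>2) :: complex"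
  have "big0 (i, 3) x (i, r) s * big0 (i, r) s (j, 3) y
    = ?C * (iR_integral (\<lambda>la. exp (Theta \<tau> i x (cpt c r s) - Theta \<tau> j y la) / (la - cpt c r s)) * cdz r s)" for s
  proof -
    let ?mu = "cpt c r s"
    let ?f = "\<lambda>t. exp (Theta \<tau> i 0 ?mu / 2 - Theta \<tau> j y (cpt c 0 t)) / (?mu - cpt c 0 t) * cdz 0 t"
    have "iR_integral (\<lambda>la. exp (Theta \<tau> i x ?mu - Theta \<tau> j y la) / (la - ?mu))
      = (\<integral>t. (- exp (Theta \<tau> i 0 ?mu / 2 - of_real x * ?mu)) * ?f t \<partial>lborel)"
      unfolding iR_integral_def
    proof (rule Bochner_Integration.integral_cong[OF refl])
      fix t :: real
      \<comment> \<open>The two halves of the phase reunite, and the factor exp(- x \<mu>) from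
        \<open>kB\<close> moves the phase from 0 to x.\<close>
      have e: "exp (Theta \<tau> i x ?mu - Theta \<tau> j y (cpt c 0 t))
        = exp (Theta \<tau> i 0 ?mu / 2 - of_real x * ?mu) * exp (Theta \<tau> i 0 ?mu / 2 - Theta \<tau> j y (cpt c 0 t))"
        unfolding exp_add[symmetric] by (rule arg_cong[where f=exp]) (simp add: Theta_def field_simps)
      \<comment> \<open>\<open>iR_integral\<close> fixes the contour parameter at 0; on the axis the
        parametrisation does not depend on it.\<close>
      have c0: "cpt 0 0 t = cpt c 0 t" by (simp add: cpt_0)
      \<comment> \<open>Turning 1 / (\<mu> - \<lambda>) into 1 / (\<lambda> - \<mu>) uses up the
        minus sign of \<open>kB\<close>.\<close>
      have d: "cpt c 0 t - ?mu = - (?mu - cpt c 0 t)" by simp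
      show "exp (Theta \<tau> i x ?mu - Theta \<tau> j y (cpt 0 0 t)) / (cpt 0 0 t - ?mu) * cdz 0 t
        = (- exp (Theta \<tau> i 0 ?mu / 2 - of_real x * ?mu)) * ?f t"
        unfolding c0 e d by (simp del: minus_diff_eq)
    qed
    also have "\<dots> = (- exp (Theta \<tau> i 0 ?mu / 2 - of_real x * ?mu)) * (\<integral>t. ?f t \<partial>lborel)"
      by (rule Bochner_Integration.integral_mult_right_zero)
    finally have I: "iR_integral (\<lambda>la. exp (Theta \<tau> i x ?mu - Theta \<tau> j y la) / (la - ?mu)) = \<dots>" .
    show ?thesis
      unfolding I big0_J_gamma[OF assms(1)] big_J_gamma[OF assms(1)] big0_gamma_J[OF assms]
      by (simp add: power2_eq_square)
  qed
  then have "(\<integral>s. big0 (i, 3) x (i, r) s * big0 (i, r) s (j, 3) y \<partial>lborel)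
    = ?C * (\<integral>s. iR_integral (\<lambda>la. exp (Theta \<tau> i x (cpt c r s) - Theta \<tau> j y la) / (la - cpt c r s)) * cdz r s \<partial>lborel)"
    by (simp only: Bochner_Integration.integral_mult_right_zero)
  then show ?thesis by (simp only: mult.assoc)
qed

text \<open>\<open>B\<close> is diagonal in the time index, so the sum over \<gamma> keeps only time
  \<open>i\<close>; its two arcs form the double contour integral, next to - Q from the previous
  elimination.\<close>

lemma schur_gamma_J_J:
  assumes "i \<in> {1..n}" "j \<in> {1..n}"
  shows "schur_kernel lborel piece_gamma big0 (i, 3) x (j, 3) y
    = indicator (Jset a k i) x * Pearcey \<tau> c i j x y * indicator (Jset a k j) y"
proof -
  have "(\<Sum>l\<in>piece_gamma. \<integral>s. big0 (i, 3) x l s * big0 l s (j, 3) y \<partial>lborel)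
    = (\<Sum>m\<in>{1..n}. \<Sum>r\<in>{1, 2}. \<integral>s. big0 (i, 3) x (m, r) s * big0 (m, r) s (j, 3) y \<partial>lborel)"
    unfolding piece_gamma_def by (subst sum.cartesian_product) (simp add: case_prod_beta)
  also have "\<dots> = (\<Sum>m\<in>{i}. \<Sum>r\<in>{1, 2}. \<integral>s. big0 (i, 3) x (m, r) s * big0 (m, r) s (j, 3) y \<partial>lborel)"
  proof (rule sum.mono_neutral_right)
    show "\<forall>m\<in>{1..n} - {i}. (\<Sum>r\<in>{1, 2}. \<integral>s. big0 (i, 3) x (m, r) s * big0 (m, r) s (j, 3) y \<partial>lborel) = 0"
      by (intro ballI sum.neutral) (simp add: big0_J_gamma big_J_gamma)
  qed (use assms in auto)
  also have "\<dots> = (\<Sum>r\<in>{1, 2}. \<integral>s. big0 (i, 3) x (i, r) s * big0 (i, r) s (j, 3) y \<partial>lborel)" by simp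
  also have "\<dots> = (\<Sum>r\<in>{1, 2}. indicator (Jset a k i) x * indicator (Jset a k j) y * (1 / (2 * pi * \<i>)\<^sup>2 *
       (\<integral>s. iR_integral (\<lambda>la. exp (Theta \<tau> i x (cpt c r s) - Theta \<tau> j y la) / (la - cpt c r s)) * cdz r s \<partial>lborel)))"
    by (intro sum.cong refl big0_gamma_term[OF _ assms(2)])
  also have "\<dots> = indicator (Jset a k i) x * indicator (Jset a k j) y * Ptilde \<tau> c i j x y"
    unfolding Ptilde_def gammaLR_integral_def sum_distrib_left by simp
  finally have "(\<Sum>l\<in>piece_gamma. \<integral>s. big0 (i, 3) x l s * big0 l s (j, 3) y \<partial>lborel) = \<dots>" .
  moreover have "(i, 3) \<notin> piece_gamma" "(j, 3) \<notin> piece_gamma" by (auto simp: piece_gamma_def)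
  ultimately have "schur_kernel lborel piece_gamma big0 (i, 3) x (j, 3) y
     = - (indicator (Jset a k i) x * Qker \<tau> i j x y * indicator (Jset a k j) y)
       + indicator (Jset a k i) x * indicator (Jset a k j) y * Ptilde \<tau> c i j x y"
    by (simp add: schur_kernel_def[of lborel piece_gamma] big0_J_J[OF assms])
  then show ?thesis by (simp add: Pearcey_def algebra_simps)
qed

section \<open>Comparison of the two Fredholm series\<close>

lemma fredholm_term_Pearcey:
  "fredholm_term {1..n} lborel (\<lambda>i x j y. indicator (Jset a k i) x * Pearcey \<tau> c i j x y) N
   = fredholm_term ({1..n} \<times> {0, 1, 2, 3}) lborel (schur_kernel lborel piece_gamma big0) N"
proof -
  let ?S = "schur_kernel lborel piece_gamma big0"
  have "fredholm_term ({1..n} \<times> {0, 1, 2, 3}) lborel ?S N = fredholm_term piece_J lborel ?S N"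
  proof (rule fredholm_term_restrict_index)
    fix l x l' y assume "l \<in> {1..n} \<times> {0, 1, 2, 3} - piece_J"
    \<comment> \<open>On \<gamma> the padding gives 0 directly; on the axis it is inherited, since
      the rows of \<open>big0\<close> there are already zero.\<close>
    then have "l \<in> piece_gamma \<or> l \<in> piece_iR" by (auto simp: piece_J_def piece_gamma_def piece_iR_def)
    then show "?S l x l' y = 0" by (auto simp: schur_kernel_def)
  qed (auto simp: piece_J_def)
  also have "\<dots> = fredholm_term {1..n} lborel (\<lambda>i x j y. ?S (i, 3) x (j, 3) y) N"
    by (rule fredholm_term_reindex[where f="\<lambda>i. (i, 3)"]) (auto simp: piece_J_def bij_betw_def inj_on_def)
  also have "\<dots> = fredholm_term {1..n} lborel
      (\<lambda>i x j y. indicator (Jset a k i) x * Pearcey \<tau> c i j x y * indicator (Jset a k j) y) N"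
    by (rule fredholm_term_cong) (rule schur_gamma_J_J)
  also have "\<dots> = fredholm_term {1..n} lborel (\<lambda>i x j y. indicator (Jset a k i) x * Pearcey \<tau> c i j x y) N"
    by (rule fredholm_term_indicator_column[where P="\<lambda>i x j y. Pearcey \<tau> c i j x y"])
  finally show ?thesis by (rule sym)
qed

lemma KP_param_eq_schur:
  assumes "l \<in> {1..n} \<times> {0, 1, 2}" "l' \<in> {1..n} \<times> {0, 1, 2}"
  shows "KP_param \<tau> a k n c l x l' y
    = (if snd l = 0 \<and> snd l' = 0 \<and> x = y then 0 else schur_kernel lborel piece_J big l x l' y)"
proof -
  obtain i r j r' where [simp]: "l = (i, r)" "l' = (j, r')" by (metis surj_pair)
  have ij: "i \<in> {1..n}" "j \<in> {1..n}" and r: "r \<in> {0, 1, 2}" "r' \<in> {0, 1, 2}" using assms by auto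
  consider "r = 0" "r' = 0" | "r = 0" "r' \<in> {1, 2}" | "r \<in> {1, 2}" using r by blast
  then show ?thesis
  proof cases
    case 1
    then show ?thesis using KP_param_iR_iR[OF ij] by simp
  next
    case 2
    then show ?thesis using KP_param_iR_gamma[OF ij, of r'] by auto
  next
    case 3
    then show ?thesis using KP_param_gamma[OF ij 3 r(2)] by auto
  qed
qed

text \<open>The two kernels may differ where both points lie on the axis and coincide, so the
  integrals agree although the integrands need not agree everywhere.\<close>

lemma fredholm_term_KP:
  "fredholm_term ({1..n} \<times> {0, 1, 2}) lborel (KP_param \<tau> a k n c) N
   = fredholm_term ({1..n} \<times> {0, 1, 2, 3}) lborel (schur_kernel lborel piece_J big) N"
proof -
  let ?I = "{1..n} \<times> {0, 1, 2} :: (nat \<times> nat) set" and ?S = "schur_kernel lborel piece_J big"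
  have adm_S: "adm ?S"
    by (rule fredholm_elimination(1)[OF adm_big]) (auto simp: piece_J_def big_J_J)
  \<comment> \<open>A copy of \<open>KP_param\<close> extended to the piece \<open>J\<close>; its
    measurability follows from that of the Schur complement.\<close>
  define D where "D l x l' y = (if snd l = 0 \<and> snd l' = 0 \<and> x = y then 0 else ?S l x l' y)" for l x l' y
  have D_eq: "KP_param \<tau> a k n c l x l' y = D l x l' y" if "l \<in> ?I" "l' \<in> ?I" for l x l' y
    unfolding D_def by (rule KP_param_eq_schur[OF that])
  have meas_D: "meas_kernel D"
    unfolding meas_kernel_def
  proof (intro ballI)
    fix l l' :: "nat \<times> nat" assume l: "l \<in> {1..n} \<times> {0, 1, 2, 3}" "l' \<in> {1..n} \<times> {0, 1, 2, 3}"
    have [measurable]: "(\<lambda>p. ?S l (fst p) l' (snd p)) \<in> borel_measurable (lborel \<Otimes>\<^sub>M lborel)"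
      using adm_S l unfolding adm_def meas_kernel_def by blast
    show "(\<lambda>p. D l (fst p) l' (snd p)) \<in> borel_measurable (lborel \<Otimes>\<^sub>M lborel)"
      unfolding D_def by measurable
  qed
  have "fredholm_term ({1..n} \<times> {0, 1, 2, 3}) lborel ?S N = fredholm_term ?I lborel ?S N"
    by (rule fredholm_term_restrict_index) (auto simp: schur_kernel_def piece_J_def)
  also have "\<dots> = fredholm_term ?I lborel (KP_param \<tau> a k n c) N"
    unfolding fredholm_term_def
  proof (intro arg_cong2[where f="(*)"] refl sum.cong)
    fix \<iota> assume \<iota>: "\<iota> \<in> PiE {..<N} (\<lambda>_. ?I)"
    then have I: "\<iota> b \<in> ?I" if "b < N" for b using that by auto
    have \<iota>': "\<iota> \<in> PiE {..<N} (\<lambda>_. {1..n} \<times> {0, 1, 2, 3})"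
      using \<iota> by (rule subsetD[OF PiE_mono, rotated]) auto
    have "(\<integral>\<xi>. ldet N (\<lambda>b d. ?S (\<iota> b) (\<xi> b) (\<iota> d) (\<xi> d)) \<partial>PiM {..<N} (\<lambda>_. lborel))
      = (\<integral>\<xi>. ldet N (\<lambda>b d. D (\<iota> b) (\<xi> b) (\<iota> d) (\<xi> d)) \<partial>PiM {..<N} (\<lambda>_. lborel))"
    proof (rule integral_cong_AE)
      show "(\<lambda>\<xi>. ldet N (\<lambda>b d. ?S (\<iota> b) (\<xi> b) (\<iota> d) (\<xi> d))) \<in> borel_measurable (PiM {..<N} (\<lambda>_. lborel))"
        by (rule ldet_kernel_measurable[OF _ \<iota>', of "\<lambda>_. ?S"]) (use adm_S in \<open>unfold adm_def, blast\<close>)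
      show "(\<lambda>\<xi>. ldet N (\<lambda>b d. D (\<iota> b) (\<xi> b) (\<iota> d) (\<xi> d))) \<in> borel_measurable (PiM {..<N} (\<lambda>_. lborel))"
        by (rule ldet_kernel_measurable[OF _ \<iota>', of "\<lambda>_. D"]) (rule meas_D)
      show "AE \<xi> in PiM {..<N} (\<lambda>_. lborel). ldet N (\<lambda>b d. ?S (\<iota> b) (\<xi> b) (\<iota> d) (\<xi> d))
        = ldet N (\<lambda>b d. D (\<iota> b) (\<xi> b) (\<iota> d) (\<xi> d))"
        using AE_PiM_coordinates_distinct[of N]
      proof eventually_elim
        case (elim \<xi>)
        show ?case
        proof (rule ldet_cong)
          fix b d assume bd: "b < N" "d < N"
          show "?S (\<iota> b) (\<xi> b) (\<iota> d) (\<xi> d) = D (\<iota> b) (\<xi> b) (\<iota> d) (\<xi> d)"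
          proof (cases "b = d \<and> snd (\<iota> b) = 0")
            \<comment> \<open>On the matrix diagonal the points always coincide, so
              almost-everywhere arguments cannot help; but \<open>N\<close> vanishes for equal
              times, so both entries are 0.\<close>
            case True
            obtain i where i: "\<iota> b = (i, 0)" "i \<in> {1..n}" using I[OF bd(1)] True by (cases "\<iota> b") auto
            have "?S (i, 0) (\<xi> b) (i, 0) (\<xi> b) = 0"
              by (simp add: schur_J_iR_row[OF i(2) i(2)] big_J_iR)
            then show ?thesis using True i by (auto simp: D_def)
          next
            case False
            then show ?thesis using elim bd by (auto simp: D_def)
          qed
        qed
      qed
    qed
    also have "\<dots> = (\<integral>\<xi>. ldet N (\<lambda>b d. KP_param \<tau> a k n c (\<iota> b) (\<xi> b) (\<iota> d) (\<xi> d)) \<partial>PiM {..<N} (\<lambda>_. lborel))"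
      using I D_eq by (intro Bochner_Integration.integral_cong refl ldet_cong) auto
    finally show "(\<integral>\<xi>. ldet N (\<lambda>b d. ?S (\<iota> b) (\<xi> b) (\<iota> d) (\<xi> d)) \<partial>PiM {..<N} (\<lambda>_. lborel)) = \<dots>" .
  qed
  finally show ?thesis by simp
qed

text \<open>The series of \<open>big\<close> is the common link: limits of series are unique, so
  eliminations along two different routes give the same value.\<close>

lemma fredholm_identity:
  "\<exists>D. fredholm_term {1..n} lborel (\<lambda>i x j y. indicator (Jset a k i) x * Pearcey \<tau> c i j x y) sums D
     \<and> fredholm_term ({1..n} \<times> {0, 1, 2}) lborel (KP_param \<tau> a k n c) sums D"
proof -
  let ?I = "{1..n} \<times> {0, 1, 2, 3} :: (nat \<times> nat) set"
  have J: "piece_J \<subseteq> ?I" "\<And>l x l' y. l \<in> piece_J \<Longrightarrow> l' \<in> piece_J \<Longrightarrow> big l x l' y = 0"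
    by (auto simp: piece_J_def big_J_J)
  obtain D1 where D1: "fredholm_term ?I lborel big sums D1"
      "fredholm_term ?I lborel (schur_kernel lborel piece_J big) sums D1"
    using fredholm_elimination(2)[OF adm_big J] by blast
  have iR: "piece_iR \<subseteq> ?I" "\<And>l x l' y. l \<in> piece_iR \<Longrightarrow> l' \<in> piece_iR \<Longrightarrow> big l x l' y = 0"
    by (auto simp: piece_iR_def big_iR_iR)
  obtain D2 where D2: "fredholm_term ?I lborel big sums D2" "fredholm_term ?I lborel big0 sums D2"
    using fredholm_elimination(2)[OF adm_big iR] by blast
  have gamma: "piece_gamma \<subseteq> ?I" "\<And>l x l' y. l \<in> piece_gamma \<Longrightarrow> l' \<in> piece_gamma \<Longrightarrow> big0 l x l' y = 0"
    by (auto simp: piece_gamma_def big0_gamma_gamma[simplified])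
  \<comment> \<open>The second elimination starts from a kernel that is itself a Schur complement,
    so it needs the admissibility part of the elimination rule.\<close>
  obtain D3 where D3: "fredholm_term ?I lborel big0 sums D3"
      "fredholm_term ?I lborel (schur_kernel lborel piece_gamma big0) sums D3"
    using fredholm_elimination(2)[OF fredholm_elimination(1)[OF adm_big iR] gamma] by blast
  have "D1 = D2" "D2 = D3" using D1(1) D2 D3(1) by (auto dest: sums_unique2)
  then show ?thesis
    using D1(2) D3(2)
    unfolding fredholm_term_Pearcey[abs_def] fredholm_term_KP[abs_def] by auto
qed

end

theorem theorem3p1:
  fixes n :: nat and \<tau> :: "nat \<Rightarrow> real" and k :: "nat \<Rightarrow> nat"
    and a :: "nat \<Rightarrow> nat \<Rightarrow> real" and c :: real
  assumes "n \<ge> 1"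
    and "\<forall>i\<in>{1..<n}. \<tau> i < \<tau> (i + 1)"
    and "\<forall>j\<in>{1..n}. k j \<ge> 1"
    and "\<forall>j\<in>{1..n}. \<forall>s\<in>{1..<2 * k j}. a j s < a j (s + 1)"
    and "c > 0"
  shows "\<exists>D. fredholm_term {1..n} lborel
               (\<lambda>i x j y. indicator (Jset a k i) x * Pearcey \<tau> c i j x y) sums D
           \<and> fredholm_term ({1..n} \<times> {0, 1, 2}) lborel (KP_param \<tau> a k n c) sums D"
proof -
  interpret pearcey n \<tau> k a c
    using assms by unfold_locales
  show ?thesis by (rule fredholm_identity)
qed

end
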